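(* Let $(P,\pi_P,\langle\cdot,\cdot\rangle_P)$ and $(M,\pi_M,\langle\cdot,\cdot\rangle_M)$ be smooth manifolds with Poisson bivectors and pseudo-Riemannian metrics, and let $t:P\to M$ be simultaneously a (pseudo-)Riemannian submersion and a Poisson map. Let $Z(M,\pi_M)$ and $Z(P,\pi_P)$ be the centers of the Lie algebras $(\Omega^1(M),[\cdot,\cdot]_{\pi_M})$ and $(\Omega^1(P),[\cdot,\cdot]_{\pi_P})$, respectively. Suppose that $(P,\pi_P,\langle\cdot,\cdot\rangle_P)$ is transversally invariant and that one of the following conditions holds: (i) $t^*\big(Z(M,\pi_M)\big)\subset Z(P,\pi_P)$; (ii) $t^*(\operatorname{Ker}\pi_M^\sharp)\subset\operatorname{Ker}\pi_P^\sharp$. Then $(M,\pi_M,\langle\cdot,\cdot\rangle_M)$ is also transversally invariant.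
   Context: For a Poisson bivector $\pi$, the anchor $\pi^\sharp:T^*M\to TM$ is $\beta(\pi^\sharp\alpha)=\pi(\alpha,\beta)$. The Koszul bracket $[\alpha,\beta]_\pi=\mathcal{L}_{\pi^\sharp\alpha}\beta-\mathcal{L}_{\pi^\sharp\beta}\alpha-d(\pi(\alpha,\beta))$ makes $\Omega^1(M)$ a Lie algebra. A function $f$ is Casimir if $\pi^\sharp(df)=0$. $(M,\pi,\langle\cdot,\cdot\rangle)$ is transversally invariant if $\mathcal{L}_{\nabla f}\pi=0$ for every Casimir function $f\in C^\infty(M)$, where $\nabla f$ is the gradient of $f$ with respect to the metric. A surjective submersion $t:P\to M$ is a (pseudo-)Riemannian submersion if $dt:(\operatorname{Ker}dt)^\perp\to TM$ is a (fiberwise) isometry. It is a Poisson map if $\{t^*f,t^*g\}_P=t^*\{f,g\}_M$ for all $f,g\in C^\infty(M)$, where $\{f,g\}=\pi(df,dg)$. *)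

theory Defs
  imports "HOL-Analysis.Analysis"
begin

text \<open>
  A smooth manifold is a second countable Hausdorff space (a type) with a smooth atlas whose
  charts take values in a finite-dimensional real inner product space. The model space is not of
  class \<open>euclidean_space\<close>, since that class would exclude dimension 0.
\<close>

section \<open>Smooth manifolds\<close>

text \<open>For open \<open>S\<close>. In finite dimensions, continuity of \<open>x \<mapsto> Df(x)\<close> amounts to continuity of
  \<open>x \<mapsto> Df(x) v\<close> for every \<open>v\<close>.\<close>

primrec Ck_on :: "nat \<Rightarrow> 'e::real_normed_vector set \<Rightarrow> ('e \<Rightarrow> 'f::real_normed_vector) \<Rightarrow> bool" where
  "Ck_on 0 S f \<longleftrightarrow> continuous_on S f"
| "Ck_on (Suc k) S f \<longleftrightarrow>
     (\<forall>x\<in>S. f differentiable (at x)) \<and> (\<forall>v. Ck_on k S (\<lambda>x. frechet_derivative f (at x) v))"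

definition smooth_on :: "'e::real_normed_vector set \<Rightarrow> ('e \<Rightarrow> 'f::real_normed_vector) \<Rightarrow> bool" where
  "smooth_on S f \<longleftrightarrow> (\<forall>k. Ck_on k S f)"

type_synonym ('a, 'e) atlas = "('a set \<times> ('a \<Rightarrow> 'e)) set"

definition smooth_manifold ::
    "('a::{second_countable_topology,t2_space}, 'e::real_inner) atlas \<Rightarrow> bool" where
  "smooth_manifold A \<longleftrightarrow>
     (\<exists>B::'e set. finite B \<and> span B = UNIV) \<and>
     (\<forall>(U, \<phi>) \<in> A. open U \<and> open (\<phi> ` U) \<and> homeomorphism U (\<phi> ` U) \<phi> (inv_into U \<phi>)) \<and>
     (\<Union>(U, \<phi>) \<in> A. U) = UNIV \<and>
     (\<forall>(U, \<phi>) \<in> A. \<forall>(V, \<psi>) \<in> A. smooth_on (\<phi> ` (U \<inter> V)) (\<psi> \<circ> inv_into U \<phi>))"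

definition smooth_functions ::
    "('a::topological_space, 'e::real_inner) atlas \<Rightarrow> ('a \<Rightarrow> real) set" where
  "smooth_functions A = {f. \<forall>(U, \<phi>) \<in> A. smooth_on (\<phi> ` U) (f \<circ> inv_into U \<phi>)}"

definition smooth_map ::
    "('a::topological_space, 'e::real_inner) atlas \<Rightarrow>
     ('b::topological_space, 'f::real_inner) atlas \<Rightarrow> ('a \<Rightarrow> 'b) \<Rightarrow> bool" where
  "smooth_map A A' t \<longleftrightarrow> continuous_on UNIV t \<and>
     (\<forall>(U, \<phi>) \<in> A. \<forall>(V, \<psi>) \<in> A'.
        smooth_on (\<phi> ` (U \<inter> t -` V)) (\<psi> \<circ> t \<circ> inv_into U \<phi>))"


section \<open>Tangent and cotangent spaces\<close>

text \<open>
  Tangent vectors at \<open>p\<close> are the derivations at \<open>p\<close> of the algebra of smooth functions, covectors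
  the linear functionals on the tangent space. Both are total functions in HOL; they are required
  to vanish outside their intended domain, so that equality of functions is equality of vectors
  (covectors), and the zero vector (covector) is the constant function 0.
\<close>

type_synonym 'a tangent = "('a \<Rightarrow> real) \<Rightarrow> real"
type_synonym 'a cotangent = "'a tangent \<Rightarrow> real"

definition linear_functional_on :: "('x \<Rightarrow> real) set \<Rightarrow> (('x \<Rightarrow> real) \<Rightarrow> real) \<Rightarrow> bool" where
  "linear_functional_on V l \<longleftrightarrow>
     (\<forall>u\<in>V. \<forall>v\<in>V. \<forall>a b. l (\<lambda>x. a * u x + b * v x) = a * l u + b * l v)"

definition bilinear_form_on ::
    "('x \<Rightarrow> real) set \<Rightarrow> (('x \<Rightarrow> real) \<Rightarrow> ('x \<Rightarrow> real) \<Rightarrow> real) \<Rightarrow> bool" where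
  "bilinear_form_on V b \<longleftrightarrow>
     (\<forall>w\<in>V. linear_functional_on V (\<lambda>v. b v w)) \<and> (\<forall>v\<in>V. linear_functional_on V (b v))"

definition tangent_space ::
    "('a::topological_space, 'e::real_inner) atlas \<Rightarrow> 'a \<Rightarrow> 'a tangent set" where
  "tangent_space A p = {v.
     linear_functional_on (smooth_functions A) v \<and>
     (\<forall>f\<in>smooth_functions A. \<forall>g\<in>smooth_functions A. v (\<lambda>x. f x * g x) = f p * v g + g p * v f) \<and>
     (\<forall>f. f \<notin> smooth_functions A \<longrightarrow> v f = 0)}"

definition cotangent_space ::
    "('a::topological_space, 'e::real_inner) atlas \<Rightarrow> 'a \<Rightarrow> 'a cotangent set" where
  "cotangent_space A p = {\<xi>.
     linear_functional_on (tangent_space A p) \<xi> \<and> (\<forall>v. v \<notin> tangent_space A p \<longrightarrow> \<xi> v = 0)}"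

definition vector_fields ::
    "('a::topological_space, 'e::real_inner) atlas \<Rightarrow> ('a \<Rightarrow> 'a tangent) set" where
  "vector_fields A = {X.
     (\<forall>p. X p \<in> tangent_space A p) \<and>
     (\<forall>f\<in>smooth_functions A. (\<lambda>p. X p f) \<in> smooth_functions A)}"

definition one_forms ::
    "('a::topological_space, 'e::real_inner) atlas \<Rightarrow> ('a \<Rightarrow> 'a cotangent) set" where
  "one_forms A = {\<alpha>.
     (\<forall>p. \<alpha> p \<in> cotangent_space A p) \<and>
     (\<forall>X\<in>vector_fields A. (\<lambda>p. \<alpha> p (X p)) \<in> smooth_functions A)}"

definition differential ::
    "('a::topological_space, 'e::real_inner) atlas \<Rightarrow> ('a \<Rightarrow> real) \<Rightarrow> 'a \<Rightarrow> 'a cotangent" where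
  "differential A f p = (\<lambda>v. if v \<in> tangent_space A p then v f else 0)"

definition tangent_map ::
    "('b::topological_space, 'f::real_inner) atlas \<Rightarrow> ('a \<Rightarrow> 'b) \<Rightarrow> 'a tangent \<Rightarrow> 'b tangent" where
  "tangent_map A' t v = (\<lambda>f. if f \<in> smooth_functions A' then v (f \<circ> t) else 0)"

definition pullback_form ::
    "('a::topological_space, 'e::real_inner) atlas \<Rightarrow>
     ('b::topological_space, 'f::real_inner) atlas \<Rightarrow> ('a \<Rightarrow> 'b) \<Rightarrow>
     ('b \<Rightarrow> 'b cotangent) \<Rightarrow> 'a \<Rightarrow> 'a cotangent" where
  "pullback_form A A' t \<alpha> p =
     (\<lambda>v. if v \<in> tangent_space A p then \<alpha> (t p) (tangent_map A' t v) else 0)"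


section \<open>Lie derivatives\<close>

text \<open>No case distinction on \<open>f\<close> is needed: if \<open>f\<close> is not smooth, both terms are derivations
  applied to the zero function.\<close>

definition lie_bracket ::
    "('a \<Rightarrow> 'a tangent) \<Rightarrow> ('a \<Rightarrow> 'a tangent) \<Rightarrow> 'a \<Rightarrow> 'a tangent" where
  "lie_bracket X Y p = (\<lambda>f. X p (\<lambda>q. Y q f) - Y p (\<lambda>q. X q f))"

text \<open>\<open>L\<^sub>X \<beta>\<close> is the unique 1-form with \<open>(L\<^sub>X \<beta>)(Y) = X(\<beta>(Y)) - \<beta>([X, Y])\<close> for all \<open>Y\<close>.\<close>

definition lie_form ::
    "('a::topological_space, 'e::real_inner) atlas \<Rightarrow> ('a \<Rightarrow> 'a tangent) \<Rightarrow>
     ('a \<Rightarrow> 'a cotangent) \<Rightarrow> 'a \<Rightarrow> 'a cotangent" where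
  "lie_form A X \<beta> = (THE \<gamma>. \<gamma> \<in> one_forms A \<and>
     (\<forall>Y\<in>vector_fields A. \<forall>p.
        \<gamma> p (Y p) = X p (\<lambda>q. \<beta> q (Y q)) - \<beta> p (lie_bracket X Y p)))"

text \<open>The function \<open>(L\<^sub>X \<pi>)(\<alpha>, \<beta>) = X(\<pi>(\<alpha>, \<beta>)) - \<pi>(L\<^sub>X \<alpha>, \<beta>) - \<pi>(\<alpha>, L\<^sub>X \<beta>)\<close>.\<close>

definition lie_bivector ::
    "('a::topological_space, 'e::real_inner) atlas \<Rightarrow> ('a \<Rightarrow> 'a tangent) \<Rightarrow>
     ('a \<Rightarrow> 'a cotangent \<Rightarrow> 'a cotangent \<Rightarrow> real) \<Rightarrow>
     ('a \<Rightarrow> 'a cotangent) \<Rightarrow> ('a \<Rightarrow> 'a cotangent) \<Rightarrow> 'a \<Rightarrow> real" where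
  "lie_bivector A X \<pi> \<alpha> \<beta> p =
     X p (\<lambda>q. \<pi> q (\<alpha> q) (\<beta> q)) - \<pi> p (lie_form A X \<alpha> p) (\<beta> p) - \<pi> p (\<alpha> p) (lie_form A X \<beta> p)"


section \<open>Poisson bivectors\<close>

type_synonym 'a bivector_field = "'a \<Rightarrow> 'a cotangent \<Rightarrow> 'a cotangent \<Rightarrow> real"

definition bivector_field ::
    "('a::topological_space, 'e::real_inner) atlas \<Rightarrow> 'a bivector_field \<Rightarrow> bool" where
  "bivector_field A \<pi> \<longleftrightarrow>
     (\<forall>p. bilinear_form_on (cotangent_space A p) (\<pi> p) \<and>
        (\<forall>\<xi>\<in>cotangent_space A p. \<forall>\<eta>\<in>cotangent_space A p. \<pi> p \<xi> \<eta> = - \<pi> p \<eta> \<xi>)) \<and>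
     (\<forall>\<alpha>\<in>one_forms A. \<forall>\<beta>\<in>one_forms A. (\<lambda>p. \<pi> p (\<alpha> p) (\<beta> p)) \<in> smooth_functions A)"

definition poisson_bracket ::
    "('a::topological_space, 'e::real_inner) atlas \<Rightarrow> 'a bivector_field \<Rightarrow>
     ('a \<Rightarrow> real) \<Rightarrow> ('a \<Rightarrow> real) \<Rightarrow> 'a \<Rightarrow> real" where
  "poisson_bracket A \<pi> f g p = \<pi> p (differential A f p) (differential A g p)"

definition poisson_bivector ::
    "('a::topological_space, 'e::real_inner) atlas \<Rightarrow> 'a bivector_field \<Rightarrow> bool" where
  "poisson_bivector A \<pi> \<longleftrightarrow> bivector_field A \<pi> \<and>
     (\<forall>f\<in>smooth_functions A. \<forall>g\<in>smooth_functions A. \<forall>h\<in>smooth_functions A. \<forall>p.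
        poisson_bracket A \<pi> f (poisson_bracket A \<pi> g h) p +
        poisson_bracket A \<pi> g (poisson_bracket A \<pi> h f) p +
        poisson_bracket A \<pi> h (poisson_bracket A \<pi> f g) p = 0)"

definition sharp ::
    "('a::topological_space, 'e::real_inner) atlas \<Rightarrow> 'a bivector_field \<Rightarrow>
     'a \<Rightarrow> 'a cotangent \<Rightarrow> 'a tangent" where
  "sharp A \<pi> p \<xi> =
     (THE v. v \<in> tangent_space A p \<and> (\<forall>\<eta>\<in>cotangent_space A p. \<eta> v = \<pi> p \<xi> \<eta>))"

definition koszul_bracket ::
    "('a::topological_space, 'e::real_inner) atlas \<Rightarrow> 'a bivector_field \<Rightarrow>
     ('a \<Rightarrow> 'a cotangent) \<Rightarrow> ('a \<Rightarrow> 'a cotangent) \<Rightarrow> 'a \<Rightarrow> 'a cotangent" where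
  "koszul_bracket A \<pi> \<alpha> \<beta> p = (\<lambda>v.
     lie_form A (\<lambda>q. sharp A \<pi> q (\<alpha> q)) \<beta> p v - lie_form A (\<lambda>q. sharp A \<pi> q (\<beta> q)) \<alpha> p v
     - differential A (\<lambda>q. \<pi> q (\<alpha> q) (\<beta> q)) p v)"

definition koszul_center ::
    "('a::topological_space, 'e::real_inner) atlas \<Rightarrow> 'a bivector_field \<Rightarrow>
     ('a \<Rightarrow> 'a cotangent) set" where
  "koszul_center A \<pi> =
     {\<alpha>\<in>one_forms A. \<forall>\<beta>\<in>one_forms A. \<forall>p. koszul_bracket A \<pi> \<alpha> \<beta> p = (\<lambda>v. 0)}"

text \<open>
  The kernel of the anchor acting on 1-forms. For \<open>t\<close> smooth, if \<open>t\<^sup>*\<close> maps the kernel of the anchor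
  of \<open>M\<close> into that of \<open>P\<close> covector by covector, then \<open>t\<^sup>*\<close> also maps \<open>sharp_kernel\<close> of \<open>M\<close> into
  that of \<open>P\<close>; where the rank of the bivector is not locally constant, the converse may fail.
\<close>

definition sharp_kernel ::
    "('a::topological_space, 'e::real_inner) atlas \<Rightarrow> 'a bivector_field \<Rightarrow>
     ('a \<Rightarrow> 'a cotangent) set" where
  "sharp_kernel A \<pi> = {\<alpha>\<in>one_forms A. \<forall>p. sharp A \<pi> p (\<alpha> p) = (\<lambda>f. 0)}"

definition casimir ::
    "('a::topological_space, 'e::real_inner) atlas \<Rightarrow> 'a bivector_field \<Rightarrow> ('a \<Rightarrow> real) \<Rightarrow> bool" where
  "casimir A \<pi> f \<longleftrightarrow>
     f \<in> smooth_functions A \<and> (\<forall>p. sharp A \<pi> p (differential A f p) = (\<lambda>h. 0))"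

definition poisson_map ::
    "('a::topological_space, 'e::real_inner) atlas \<Rightarrow> 'a bivector_field \<Rightarrow>
     ('b::topological_space, 'f::real_inner) atlas \<Rightarrow> 'b bivector_field \<Rightarrow> ('a \<Rightarrow> 'b) \<Rightarrow> bool" where
  "poisson_map A \<pi> A' \<pi>' t \<longleftrightarrow> smooth_map A A' t \<and>
     (\<forall>f\<in>smooth_functions A'. \<forall>g\<in>smooth_functions A'.
        poisson_bracket A \<pi> (f \<circ> t) (g \<circ> t) = poisson_bracket A' \<pi>' f g \<circ> t)"


section \<open>Pseudo-Riemannian metrics\<close>

type_synonym 'a metric_field = "'a \<Rightarrow> 'a tangent \<Rightarrow> 'a tangent \<Rightarrow> real"

text \<open>Nondegeneracy and continuity make the signature locally constant; it is not required to be
  the same on all components.\<close>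

definition pseudo_riemannian_metric ::
    "('a::topological_space, 'e::real_inner) atlas \<Rightarrow> 'a metric_field \<Rightarrow> bool" where
  "pseudo_riemannian_metric A G \<longleftrightarrow>
     (\<forall>p. bilinear_form_on (tangent_space A p) (G p) \<and>
        (\<forall>u\<in>tangent_space A p. \<forall>v\<in>tangent_space A p. G p u v = G p v u) \<and>
        (\<forall>u\<in>tangent_space A p. (\<forall>v\<in>tangent_space A p. G p u v = 0) \<longrightarrow> u = (\<lambda>f. 0))) \<and>
     (\<forall>X\<in>vector_fields A. \<forall>Y\<in>vector_fields A. (\<lambda>p. G p (X p) (Y p)) \<in> smooth_functions A)"

definition gradient ::
    "('a::topological_space, 'e::real_inner) atlas \<Rightarrow> 'a metric_field \<Rightarrow>
     ('a \<Rightarrow> real) \<Rightarrow> 'a \<Rightarrow> 'a tangent" where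
  "gradient A G f p =
     (THE v. v \<in> tangent_space A p \<and> (\<forall>w\<in>tangent_space A p. G p v w = differential A f p w))"

definition tangent_kernel ::
    "('a::topological_space, 'e::real_inner) atlas \<Rightarrow>
     ('b::topological_space, 'f::real_inner) atlas \<Rightarrow> ('a \<Rightarrow> 'b) \<Rightarrow> 'a \<Rightarrow> 'a tangent set" where
  "tangent_kernel A A' t p = {v\<in>tangent_space A p. tangent_map A' t v = (\<lambda>f. 0)}"

definition orthogonal_space ::
    "('a::topological_space, 'e::real_inner) atlas \<Rightarrow> 'a metric_field \<Rightarrow>
     'a \<Rightarrow> 'a tangent set \<Rightarrow> 'a tangent set" where
  "orthogonal_space A G p W = {v\<in>tangent_space A p. \<forall>w\<in>W. G p v w = 0}"

definition surjective_submersion ::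
    "('a::topological_space, 'e::real_inner) atlas \<Rightarrow>
     ('b::topological_space, 'f::real_inner) atlas \<Rightarrow> ('a \<Rightarrow> 'b) \<Rightarrow> bool" where
  "surjective_submersion A A' t \<longleftrightarrow> smooth_map A A' t \<and> surj t \<and>
     (\<forall>p. tangent_map A' t ` tangent_space A p = tangent_space A' (t p))"

text \<open>A fibrewise isometry is a bijection of each \<open>(Ker dt\<^sub>p)\<^sup>\<bottom>\<close> onto the tangent space at
  \<open>t p\<close> that preserves the metrics. Bijectivity has to be stated: for indefinite metrics it
  does not follow from preservation of the metrics, as \<open>Ker dt\<^sub>p\<close> could be degenerate.\<close>

definition pseudo_riemannian_submersion ::
    "('a::topological_space, 'e::real_inner) atlas \<Rightarrow> 'a metric_field \<Rightarrow>
     ('b::topological_space, 'f::real_inner) atlas \<Rightarrow> 'b metric_field \<Rightarrow> ('a \<Rightarrow> 'b) \<Rightarrow> bool" where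
  "pseudo_riemannian_submersion A G A' G' t \<longleftrightarrow> surjective_submersion A A' t \<and>
     (\<forall>p. let H = orthogonal_space A G p (tangent_kernel A A' t p) in
        bij_betw (tangent_map A' t) H (tangent_space A' (t p)) \<and>
        (\<forall>u\<in>H. \<forall>v\<in>H. G' (t p) (tangent_map A' t u) (tangent_map A' t v) = G p u v))"


section \<open>Transversal invariance\<close>

definition transversally_invariant ::
    "('a::topological_space, 'e::real_inner) atlas \<Rightarrow> 'a bivector_field \<Rightarrow>
     'a metric_field \<Rightarrow> bool" where
  "transversally_invariant A \<pi> G \<longleftrightarrow> (\<forall>f. casimir A \<pi> f \<longrightarrow>
     (\<forall>\<alpha>\<in>one_forms A. \<forall>\<beta>\<in>one_forms A. \<forall>p. lie_bivector A (gradient A G f) \<pi> \<alpha> \<beta> p = 0))"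

end

theory Submission
  imports Defs
begin

text \<open>
  Let \<open>f\<close> be a Casimir function on \<open>M\<close>. Its differential lies in the kernel of the anchor, and it is
  central for the Koszul bracket (\<open>casimir_differential_central\<close>). Under either hypothesis the function
  \<open>f \<circ> t\<close> is therefore a Casimir function on \<open>P\<close>: for the kernel this is immediate, and for the center
  it holds because exact central forms come from Casimir functions
  (\<open>casimir_if_differential_central\<close>).

  Since \<open>t\<close> is a Riemannian submersion, the gradient of \<open>f \<circ> t\<close> is horizontal and projects to the
  gradient of \<open>f\<close> (\<open>tangent_map_gradient\<close>). Transversal invariance says that the gradient of every
  Casimir function is a derivation of the Poisson bracket (\<open>transversally_invariant_iff\<close>). For the
  functions \<open>g \<circ> t\<close> and \<open>h \<circ> t\<close> this identity on \<open>P\<close> is the pullback of the same identity for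
  \<open>f\<close>, \<open>g\<close>, \<open>h\<close> on \<open>M\<close>, because \<open>t\<close> is a Poisson map; and \<open>t\<close> is surjective.

  Tangent vectors are derivations and covectors are functionals on them, while the anchor, the gradient
  and the Lie derivative of a form are descriptions of objects whose existence needs proof. All of this
  rests on local frames (\<open>local_frame_exists\<close>): near each point there are globally defined smooth
  coordinates and vector fields in which every derivation can be expanded. Bump functions and Hadamard's
  lemma provide them. The anchor is then given by components in a frame, the gradient by solving the
  linear system of the Gram matrix over the ring of smooth functions, and the Lie derivative of a form by
  the Leibniz rule. The last of these also shows that \<open>L\<^sub>X \<pi>\<close> is a tensor, so that it vanishes as soon as
  it vanishes on differentials of functions.
\<close>

section \<open>Calculus of \<open>C\<^sup>k\<close> functions\<close>

lemma frechet_derivative_cong_open: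
  assumes "open S" "x \<in> S" "\<And>y. y \<in> S \<Longrightarrow> f y = g y"
  shows "frechet_derivative f (at x) = frechet_derivative g (at x)"
    and "f differentiable (at x) \<longleftrightarrow> g differentiable (at x)"
proof -
  have "(f has_derivative f') (at x) \<longleftrightarrow> (g has_derivative f') (at x)" for f'
    using has_derivative_transform_within_open[of f f' x UNIV S g]
      has_derivative_transform_within_open[of g f' x UNIV S f] assms by auto
  then show "frechet_derivative f (at x) = frechet_derivative g (at x)"
    and "f differentiable (at x) \<longleftrightarrow> g differentiable (at x)"
    by (simp_all add: frechet_derivative_def differentiable_def)
qed

lemma Ck_on_cong:
  assumes "open S" "\<And>x. x \<in> S \<Longrightarrow> f x = g x"
  shows "Ck_on k S f \<longleftrightarrow> Ck_on k S g"
  using assms(2)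
proof (induction k arbitrary: f g)
  case 0
  then show ?case by (simp cong: continuous_on_cong)
next
  case (Suc k)
  have "Ck_on k S (\<lambda>x. frechet_derivative f (at x) v) \<longleftrightarrow>
      Ck_on k S (\<lambda>x. frechet_derivative g (at x) v)" for v
  proof (rule Suc.IH)
    fix x assume "x \<in> S"
    from frechet_derivative_cong_open(1)[OF assms(1) this Suc.prems]
    show "frechet_derivative f (at x) v = frechet_derivative g (at x) v" by simp
  qed
  moreover have "f differentiable (at x) \<longleftrightarrow> g differentiable (at x)" if "x \<in> S" for x
    using frechet_derivative_cong_open(2)[OF assms(1) that Suc.prems] .
  ultimately show ?case by auto
qed

lemma Ck_on_SucI:
  assumes "open S" "\<And>x. x \<in> S \<Longrightarrow> (f has_derivative f' x) (at x)"
    and "\<And>v. Ck_on k S (\<lambda>x. f' x v)"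
  shows "Ck_on (Suc k) S f"
proof -
  have "Ck_on k S (\<lambda>x. frechet_derivative f (at x) v)" for v
  proof (rule iffD1[OF Ck_on_cong[OF assms(1)] assms(3)[of v]])
    fix x assume "x \<in> S"
    show "f' x v = frechet_derivative f (at x) v"
      using frechet_derivative_at[OF assms(2)[OF \<open>x \<in> S\<close>]] by simp
  qed
  moreover have "f differentiable (at x)" if "x \<in> S" for x
    using assms(2)[OF that] by (rule differentiableI)
  ultimately show ?thesis
    by simp
qed

lemma Ck_on_SucD:
  assumes "Ck_on (Suc k) S f"
  shows "x \<in> S \<Longrightarrow> (f has_derivative frechet_derivative f (at x)) (at x)"
    and "Ck_on k S (\<lambda>x. frechet_derivative f (at x) v)"
  using assms by (auto simp: frechet_derivative_works)

lemma Ck_on_pred: "Ck_on (Suc k) S f \<Longrightarrow> Ck_on k S f"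
proof (induction k arbitrary: f)
  case 0
  then show ?case
    by (auto intro!: continuous_at_imp_continuous_on differentiable_imp_continuous_within)
next
  case (Suc k)
  then show ?case by (metis Ck_on.simps(2))
qed

lemma Ck_on_continuous: "Ck_on k S f \<Longrightarrow> continuous_on S f"
  by (induction k) (auto simp del: Ck_on.simps(2) dest: Ck_on_pred)

lemma Ck_on_subset: "Ck_on k S f \<Longrightarrow> T \<subseteq> S \<Longrightarrow> Ck_on k T f"
  by (induction k arbitrary: f) (auto intro: continuous_on_subset)

lemma Ck_on_locally:
  assumes "\<And>x. x \<in> S \<Longrightarrow> \<exists>T. open T \<and> x \<in> T \<and> Ck_on k T f"
  shows "Ck_on k S f"
  using assms
proof (induction k arbitrary: f)
  case 0
  have "isCont f x" if "x \<in> S" for x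
    using 0[OF that] by (auto simp: continuous_on_eq_continuous_at)
  then show ?case
    by (simp add: continuous_at_imp_continuous_on)
next
  case (Suc k)
  have "f differentiable (at x)" if "x \<in> S" for x
    using Suc.prems[OF that] by (auto simp del: Ck_on.simps(2) simp: Ck_on.simps(2)[of _ _ f])
  moreover have "Ck_on k S (\<lambda>x. frechet_derivative f (at x) v)" for v
  proof (rule Suc.IH)
    fix x assume "x \<in> S"
    then obtain T where "open T" "x \<in> T" "Ck_on (Suc k) T f"
      using Suc.prems by blast
    then show "\<exists>T. open T \<and> x \<in> T \<and> Ck_on k T (\<lambda>x. frechet_derivative f (at x) v)"
      by auto
  qed
  ultimately show ?case by simp
qed

lemma Ck_on_const: "open S \<Longrightarrow> Ck_on k S (\<lambda>x. c)"
proof (induction k arbitrary: c)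
  case (Suc k)
  show ?case
    by (rule Ck_on_SucI[where f' = "\<lambda>x v. 0"]) (rule Suc.prems has_derivative_const Suc.IH)+
qed simp

lemma Ck_on_bounded_linear:
  assumes "open S" "Ck_on k S f" "bounded_linear L"
  shows "Ck_on k S (\<lambda>x. L (f x))"
  using assms(2)
proof (induction k arbitrary: f)
  case 0
  then show ?case
    using bounded_linear.continuous_on[OF assms(3)] by simp
next
  case (Suc k)
  show ?case
    by (intro Ck_on_SucI[where f' = "\<lambda>x v. L (frechet_derivative f (at x) v)"] assms(1) Suc.IH
      bounded_linear.has_derivative[OF assms(3)] Ck_on_SucD[OF Suc.prems])
qed

lemma Ck_on_ident: "open S \<Longrightarrow> Ck_on k S (\<lambda>x. x)"
proof (cases k)
  case (Suc n)
  assume "open S"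
  then show ?thesis
    unfolding Suc
    by (intro Ck_on_SucI[where f' = "\<lambda>x v. v"] Ck_on_const has_derivative_ident)
qed simp

lemma Ck_on_add:
  assumes "open S" "Ck_on k S f" "Ck_on k S g"
  shows "Ck_on k S (\<lambda>x. f x + g x)"
  using assms(2,3)
proof (induction k arbitrary: f g)
  case 0
  then show ?case by (simp add: continuous_on_add)
next
  case (Suc k)
  show ?case
    by (intro Ck_on_SucI[where f' = "\<lambda>x v. frechet_derivative f (at x) v + frechet_derivative g (at x) v"]
      assms(1) Suc.IH has_derivative_add Ck_on_SucD[OF Suc.prems(1)] Ck_on_SucD[OF Suc.prems(2)])
qed

lemma Ck_on_sum:
  assumes "open S" "\<And>i. i \<in> I \<Longrightarrow> Ck_on k S (f i)"
  shows "Ck_on k S (\<lambda>x. \<Sum>i\<in>I. f i x)"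
  using assms(2)
  by (induction I rule: infinite_finite_induct) (auto intro: Ck_on_add Ck_on_const assms(1))

lemma Ck_on_mult:
  fixes f g :: "'e::real_normed_vector \<Rightarrow> real"
  assumes "open S" "Ck_on k S f" "Ck_on k S g"
  shows "Ck_on k S (\<lambda>x. f x * g x)"
  using assms(2,3)
proof (induction k arbitrary: f g)
  case 0
  then show ?case by (simp add: continuous_on_mult)
next
  case (Suc k)
  have "Ck_on k S (\<lambda>x. f x * frechet_derivative g (at x) v + frechet_derivative f (at x) v * g x)" for v
    by (intro Ck_on_add Suc.IH assms Suc.prems[THEN Ck_on_pred] Ck_on_SucD(2)[OF Suc.prems(1)]
      Ck_on_SucD(2)[OF Suc.prems(2)])
  then show ?case
    by (intro Ck_on_SucI[where f' = "\<lambda>x v. f x * frechet_derivative g (at x) v + frechet_derivative f (at x) v * g x"]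
      assms(1) has_derivative_mult Ck_on_SucD[OF Suc.prems(1)] Ck_on_SucD[OF Suc.prems(2)])
qed

lemma Ck_on_inverse:
  fixes f :: "'e::real_normed_vector \<Rightarrow> real"
  assumes "open S" "Ck_on k S f" "\<And>x. x \<in> S \<Longrightarrow> f x \<noteq> 0"
  shows "Ck_on k S (\<lambda>x. inverse (f x))"
  using assms(2)
proof (induction k)
  case 0
  then show ?case by (simp add: continuous_on_inverse assms)
next
  case (Suc k)
  have "Ck_on k S (\<lambda>x. - (inverse (f x) * frechet_derivative f (at x) v * inverse (f x)))" for v
    by (intro Ck_on_bounded_linear[where L = uminus] Ck_on_mult assms Suc.IH Ck_on_pred[OF Suc.prems]
      Ck_on_SucD(2)[OF Suc.prems] bounded_linear_minus bounded_linear_ident)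
  then show ?case
    by (intro Ck_on_SucI[where f' = "\<lambda>x v. - (inverse (f x) * frechet_derivative f (at x) v * inverse (f x))"]
      assms(1,3) Deriv.has_derivative_inverse Ck_on_SucD[OF Suc.prems])
qed

text \<open>Expansion in the basis is part of the definition, in place of \<open>span I = UNIV\<close>: this is the form in
  which the basis is used, and the empty set is a basis of the zero space.\<close>

definition orthonormal_basis :: "'e::real_inner set \<Rightarrow> bool" where
  "orthonormal_basis I \<longleftrightarrow> finite I \<and> (\<forall>c\<in>I. \<forall>d\<in>I. c \<bullet> d = (if c = d then 1 else 0)) \<and>
     (\<forall>x. x = (\<Sum>c\<in>I. (x \<bullet> c) *\<^sub>R c))"

text \<open>Gram--Schmidt yields an orthogonal spanning set; it remains to drop zero and to normalize. The
  difference between a vector and its expansion is orthogonal to a spanning set, hence zero.\<close>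

lemma orthonormal_basis_exists:
  assumes "finite (B :: 'e::real_inner set)" "span B = UNIV"
  shows "\<exists>I :: 'e set. orthonormal_basis I"
proof -
  obtain C :: "'e set" where C: "finite C" "span C = UNIV" "pairwise orthogonal C"
    using basis_orthogonal[OF assms(1)] assms(2) by auto
  define I where "I = (\<lambda>c. c /\<^sub>R norm c) ` (C - {0})"
  have fin: "finite I" using C by (simp add: I_def)
  have on: "c \<bullet> d = (if c = d then 1 else 0)" if cd: "c \<in> I" "d \<in> I" for c d
  proof -
    obtain a b where ab: "a \<in> C" "b \<in> C" "a \<noteq> 0" "b \<noteq> 0" "c = a /\<^sub>R norm a" "d = b /\<^sub>R norm b"
      using cd unfolding I_def by blast
    have "a \<noteq> b \<Longrightarrow> a \<bullet> b = 0"
      using C(3) ab by (auto simp: pairwise_def orthogonal_def)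
    then have "a \<noteq> b \<Longrightarrow> c \<bullet> d = 0" by (simp add: ab)
    moreover have "c \<bullet> c = 1"
      using ab by (simp add: dot_square_norm power2_eq_square)
    ultimately show ?thesis using ab(5,6) by (cases "c = d"; cases "a = b") fastforce+
  qed
  have "x = (\<Sum>c\<in>I. (x \<bullet> c) *\<^sub>R c)" for x
  proof -
    define y where "y = x - (\<Sum>c\<in>I. (x \<bullet> c) *\<^sub>R c)"
    have yI: "y \<bullet> d = 0" if "d \<in> I" for d
    proof -
      have "(\<Sum>c\<in>I. (x \<bullet> c) * (c \<bullet> d)) = (\<Sum>c\<in>I. if c = d then x \<bullet> c else 0)"
        by (intro sum.cong) (auto simp: on that)
      then show ?thesis
        using fin that by (simp add: y_def inner_diff_left inner_sum_left)
    qed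
    have yC: "y \<bullet> d = 0" if "d \<in> C" for d
      using yI[of "d /\<^sub>R norm d"] that by (cases "d = 0") (auto simp: I_def)
    have "y \<bullet> z = 0" if "z \<in> span C" for z
      using that
    proof (rule span_induct)
      show "subspace {z. y \<bullet> z = 0}"
        by (auto simp: subspace_def inner_add_right)
    qed (rule yC)
    then have "y \<bullet> y = 0" using C(2) by auto
    then show ?thesis by (simp add: y_def)
  qed
  then show ?thesis
    using fin on unfolding orthonormal_basis_def by blast
qed

lemma orthonormal_basis_linear:
  assumes "orthonormal_basis I" "linear L"
  shows "L x = (\<Sum>c\<in>I. (x \<bullet> c) *\<^sub>R L c)"
proof -
  have "x = (\<Sum>c\<in>I. (x \<bullet> c) *\<^sub>R c)"
    using assms(1) by (auto simp: orthonormal_basis_def)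
  then have "L x = L (\<Sum>c\<in>I. (x \<bullet> c) *\<^sub>R c)" by simp
  also have "\<dots> = (\<Sum>c\<in>I. (x \<bullet> c) *\<^sub>R L c)"
    using assms(2) by (simp add: linear_sum linear_cmul)
  finally show ?thesis .
qed

text \<open>By the chain rule, \<open>D(g \<circ> f)(x) v = \<Sum>\<^sub>c (Df(x) v \<bullet> c) \<cdot> Dg(f x) c\<close>; expanding in a fixed basis
  turns the derivative into sums and products of \<open>C\<^sup>k\<close> functions and of compositions of the same
  kind.\<close>

lemma Ck_on_compose:
  fixes f :: "'d::real_normed_vector \<Rightarrow> 'e::real_inner" and g :: "'e \<Rightarrow> real"
  assumes I: "orthonormal_basis (I :: 'e set)" and "open S" "open T" "f ` S \<subseteq> T"
    and "Ck_on k S f" "Ck_on k T g"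
  shows "Ck_on k S (\<lambda>x. g (f x))"
  using assms(5,6)
proof (induction k arbitrary: g)
  case 0
  then show ?case
    using continuous_on_compose2[of T g S f] assms(4) by simp
next
  case (Suc k)
  let ?D = "\<lambda>x v. frechet_derivative g (at (f x)) (frechet_derivative f (at x) v)"
  have der: "((\<lambda>x. g (f x)) has_derivative ?D x) (at x)" if "x \<in> S" for x
    using that assms(4)
    by (intro has_derivative_compose[OF Ck_on_SucD(1)[OF Suc.prems(1) that] Ck_on_SucD(1)[OF Suc.prems(2)]])
      blast
  have "Ck_on k S (\<lambda>x. ?D x v)" for v
  proof -
    have exp: "(\<Sum>c\<in>I. (frechet_derivative f (at x) v \<bullet> c) * frechet_derivative g (at (f x)) c) = ?D x v"
      if "x \<in> S" for x
    proof -
      have "linear (frechet_derivative g (at (f x)))"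
        using that assms(4)
        by (intro has_derivative_linear[OF Ck_on_SucD(1)[OF Suc.prems(2)]]) blast
      from orthonormal_basis_linear[OF I this, of "frechet_derivative f (at x) v"]
      show ?thesis by simp
    qed
    have "Ck_on k S (\<lambda>x. \<Sum>c\<in>I. (frechet_derivative f (at x) v \<bullet> c) * frechet_derivative g (at (f x)) c)"
    proof (intro Ck_on_sum Ck_on_mult \<open>open S\<close>)
      fix c
      show "Ck_on k S (\<lambda>x. frechet_derivative f (at x) v \<bullet> c)"
        by (rule Ck_on_bounded_linear[OF \<open>open S\<close> Ck_on_SucD(2)[OF Suc.prems(1)]
          bounded_linear_inner_left])
      show "Ck_on k S (\<lambda>x. frechet_derivative g (at (f x)) c)"
        by (rule Suc.IH[OF Ck_on_pred[OF Suc.prems(1)] Ck_on_SucD(2)[OF Suc.prems(2)]])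
    qed
    then show ?thesis
      using Ck_on_cong[OF assms(2) exp] by simp
  qed
  from Ck_on_SucI[OF \<open>open S\<close> der this] show ?case .
qed

section \<open>Bump functions\<close>

text \<open>The flat functions \<open>x\<^sup>-\<^sup>k exp(-1/x)\<close>, extended by zero to \<open>x \<le> 0\<close>. The derivative of each is a
  combination of two others, so all of them are smooth as soon as all of them are differentiable.\<close>

definition flat :: "nat \<Rightarrow> real \<Rightarrow> real" where
  "flat k x = (if x > 0 then inverse x ^ k / exp (inverse x) else 0)"

lemma flat_tendsto_0: "(flat k \<longlongrightarrow> 0) (at 0)"
proof -
  have "((\<lambda>x. inverse x ^ k / exp (inverse x)) \<longlongrightarrow> 0) (at_right (0::real))"
    by (rule filterlim_compose[OF tendsto_power_div_exp_0 filterlim_inverse_at_top_right])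
  then have "(flat k \<longlongrightarrow> 0) (at_right 0)"
    by (rule Lim_transform_eventually)
      (auto simp: flat_def eventually_at_right_field intro: exI[of _ 1])
  moreover have "(flat k \<longlongrightarrow> 0) (at_left 0)"
    by (rule Lim_transform_eventually[OF tendsto_const])
      (auto simp: flat_def eventually_at_left_field intro: exI[of _ "-1"])
  ultimately show ?thesis
    by (rule filterlim_split_at[rotated])
qed

lemma flat_has_derivative:
  "(flat k has_real_derivative flat (k + 2) x - real k * flat (k + 1) x) (at x)"
proof -
  consider "x > 0" | "x < 0" | "x = 0" by linarith
  then show ?thesis
  proof cases
    case 1
    have pow: "real k * inverse x ^ (k - Suc 0) * (inverse x * inverse x) = real k * inverse x ^ (k + 1)"
      by (cases k) auto
    have "((\<lambda>x. inverse x ^ k * exp (- inverse x)) has_real_derivative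
        (real k * inverse x ^ (k - Suc 0) * - (inverse x * inverse x)) * exp (- inverse x)
        + inverse x ^ k * (exp (- inverse x) * (inverse x * inverse x))) (at x)"
      by (rule derivative_eq_intros refl | use 1 in \<open>simp add: power2_eq_square\<close>)+
    also have "(real k * inverse x ^ (k - Suc 0) * - (inverse x * inverse x)) * exp (- inverse x)
        + inverse x ^ k * (exp (- inverse x) * (inverse x * inverse x))
        = flat (k + 2) x - real k * flat (k + 1) x"
      using pow 1 by (auto simp: flat_def exp_minus divide_inverse algebra_simps power2_eq_square)
    finally show ?thesis
      by (rule has_field_derivative_transform_within_open[where S = "{0<..}"])
        (use 1 in \<open>auto simp: flat_def exp_minus divide_inverse\<close>)
  next
    case 2
    have "((\<lambda>x. 0::real) has_real_derivative 0) (at x)" by simp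
    then have "(flat k has_real_derivative 0) (at x)"
      by (rule has_field_derivative_transform_within_open[where S = "{..<0}"])
        (use 2 in \<open>auto simp: flat_def\<close>)
    then show ?thesis using 2 by (simp add: flat_def)
  next
    case 3
    \<comment> \<open>At \<open>0\<close> the difference quotient of one flat function is the next one.\<close>
    have "(flat k h - flat k 0) / h = flat (Suc k) h" for h
      by (simp add: flat_def divide_inverse)
    moreover have "flat j 0 = 0" for j by (simp add: flat_def)
    ultimately show ?thesis
      using flat_tendsto_0[of "Suc k"] 3 by (simp add: has_field_derivative_iff)
  qed
qed

lemma flat_Ck: "Ck_on n UNIV (flat k)"
proof (induction n arbitrary: k)
  case 0
  show ?case
    using flat_has_derivative by (auto intro!: DERIV_isCont continuous_at_imp_continuous_on)
next
  case (Suc n)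
  let ?D = "\<lambda>x v. (flat (k + 2) x + (- real k) * flat (k + 1) x) * v"
  have "(flat k has_derivative ?D x) (at x)" for x
    using flat_has_derivative[of k x] by (simp add: has_field_derivative_def)
  then show ?case
    by (rule Ck_on_SucI[rotated]) (intro open_UNIV Ck_on_mult Ck_on_add Ck_on_const Suc.IH)+
qed

lemma orthonormal_basis_real: "orthonormal_basis {1::real}"
  by (simp add: orthonormal_basis_def)

text \<open>The bump is \<open>\<beta>(s)\<close> with \<open>s = \<bar>x - a\<bar>\<^sup>2 / r\<^sup>2\<close>, where \<open>\<beta>\<close> is a quotient of flat functions. Its numerator
  vanishes for \<open>s \<ge> 1\<close>, the second term of its denominator for \<open>s \<le> 1/2\<close>, and these two never vanish
  together.\<close>

lemma bump_on_inner_product_space: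
  fixes a :: "'e::real_inner"
  assumes "r > 0"
  shows "\<exists>\<rho> :: 'e \<Rightarrow> real. smooth_on UNIV \<rho> \<and> (\<forall>x\<in>ball a (r / 2). \<rho> x = 1) \<and>
    (\<forall>x. x \<notin> ball a r \<longrightarrow> \<rho> x = 0)"
proof -
  define \<beta> where "\<beta> = (\<lambda>s::real. flat 0 (1 - s) * inverse (flat 0 (1 - s) + flat 0 (s - 1/2)))"
  define \<rho> where "\<rho> = (\<lambda>x. \<beta> ((x - a) \<bullet> (x - a) * inverse (r\<^sup>2)))"
  have pos: "flat 0 (1 - s) + flat 0 (s - 1/2) > 0" for s :: real
    unfolding flat_def by (cases "s < 1"; cases "s > 1/2") (auto intro: add_pos_pos)
  have lin: "Ck_on k UNIV (\<lambda>s::real. 1 - s)" "Ck_on k UNIV (\<lambda>s::real. s - 1/2)" for k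
    using Ck_on_add[OF open_UNIV Ck_on_const[OF open_UNIV, of k 1]
        Ck_on_bounded_linear[OF open_UNIV Ck_on_ident[OF open_UNIV] bounded_linear_minus[OF bounded_linear_ident]]]
      Ck_on_add[OF open_UNIV Ck_on_ident[OF open_UNIV] Ck_on_const[OF open_UNIV, of k "-1/2::real"]]
    by simp_all
  have fl: "Ck_on k UNIV (\<lambda>s. flat 0 (1 - s))" "Ck_on k UNIV (\<lambda>s. flat 0 (s - 1/2))" for k
    by (rule Ck_on_compose[OF orthonormal_basis_real open_UNIV open_UNIV _ lin(1) flat_Ck]; simp)
      (rule Ck_on_compose[OF orthonormal_basis_real open_UNIV open_UNIV _ lin(2) flat_Ck]; simp)
  have \<beta>: "Ck_on k UNIV \<beta>" for k
    unfolding \<beta>_def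
    by (intro Ck_on_mult[OF open_UNIV fl(1)] Ck_on_inverse[OF open_UNIV]
        Ck_on_add[OF open_UNIV fl]) (rule less_imp_neq[OF pos, symmetric])
  have q: "Ck_on k UNIV (\<lambda>x. (x - a) \<bullet> (x - a) * inverse (r\<^sup>2))" for k
  proof (intro Ck_on_mult Ck_on_const open_UNIV)
    show "Ck_on k UNIV (\<lambda>x. (x - a) \<bullet> (x - a))"
    proof (cases k)
      case 0
      then show ?thesis by (auto intro!: continuous_intros)
    next
      case (Suc n)
      have der: "((\<lambda>x. (x - a) \<bullet> (x - a)) has_derivative (\<lambda>v. 2 * (x \<bullet> v) + - 2 * (a \<bullet> v))) (at x)" for x
        by (rule has_derivative_eq_rhs, (rule derivative_intros)+)
          (auto simp: fun_eq_iff inner_diff_left inner_diff_right inner_commute)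
      have "Ck_on n UNIV (\<lambda>x. 2 * (x \<bullet> v) + - 2 * (a \<bullet> v))" for v
        by (intro Ck_on_add Ck_on_const Ck_on_mult open_UNIV
            Ck_on_bounded_linear[OF open_UNIV Ck_on_ident[OF open_UNIV] bounded_linear_inner_left])
      from Ck_on_SucI[OF open_UNIV der this] show ?thesis by (simp only: Suc)
    qed
  qed
  have "Ck_on k UNIV \<rho>" for k
    unfolding \<rho>_def by (rule Ck_on_compose[OF orthonormal_basis_real open_UNIV open_UNIV _ q \<beta>]) simp
  moreover have "\<rho> x = 1" if "x \<in> ball a (r / 2)" for x
  proof -
    have "(x - a) \<bullet> (x - a) \<le> (r / 2)\<^sup>2"
      using that by (simp add: power2_norm_eq_inner[symmetric] dist_norm norm_minus_commute power_mono)
    moreover have "(r / 2)\<^sup>2 = r\<^sup>2 / 4" by (simp add: power_divide)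
    moreover have "0 \<le> (x - a) \<bullet> (x - a)" by (rule inner_ge_zero)
    ultimately have "2 * ((x - a) \<bullet> (x - a)) \<le> r\<^sup>2" by linarith
    then have "(x - a) \<bullet> (x - a) * inverse (r\<^sup>2) \<le> 1/2"
      using assms by (simp add: field_simps)
    then show ?thesis
      unfolding \<rho>_def \<beta>_def by (auto simp: flat_def)
  qed
  moreover have "\<rho> x = 0" if "x \<notin> ball a r" for x
  proof -
    have "(x - a) \<bullet> (x - a) \<ge> r\<^sup>2"
      using that assms
      by (auto simp: power2_norm_eq_inner[symmetric] dist_norm norm_minus_commute power_mono)
    then have "(x - a) \<bullet> (x - a) * inverse (r\<^sup>2) \<ge> 1"
      using assms by (simp add: field_simps)
    then show ?thesis
      unfolding \<rho>_def \<beta>_def by (auto simp: flat_def)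
  qed
  ultimately show ?thesis unfolding smooth_on_def by blast
qed

text \<open>A ball lies in a coordinate box, and a box is a finite sum of segments.\<close>

lemma compact_cball_orthonormal:
  assumes "orthonormal_basis (I :: 'e::real_inner set)"
  shows "compact (cball (a :: 'e) r)"
proof -
  have fin: "finite I" using assms by (simp add: orthonormal_basis_def)
  define box where "box J = {\<Sum>c\<in>J. u c *\<^sub>R c | u. \<forall>c\<in>J. \<bar>u c\<bar> \<le> r}" for J :: "'e set"
  have "compact (box J)" if "finite J" for J
    using that
  proof induction
    case empty
    have "box {} = {0}" by (auto simp: box_def)
    then show ?case by simp
  next
    case (insert d J)
    have "box (insert d J) = {x + y | x y. x \<in> (\<lambda>t. t *\<^sub>R d) ` {- r..r} \<and> y \<in> box J}" (is "_ = ?B")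
    proof
      show "box (insert d J) \<subseteq> ?B"
      proof
        fix z assume "z \<in> box (insert d J)"
        then obtain u where u: "z = (\<Sum>c\<in>insert d J. u c *\<^sub>R c)" "\<forall>c\<in>insert d J. \<bar>u c\<bar> \<le> r"
          unfolding box_def by blast
        have "z = u d *\<^sub>R d + (\<Sum>c\<in>J. u c *\<^sub>R c)" using u(1) insert.hyps by simp
        moreover have "u d *\<^sub>R d \<in> (\<lambda>t. t *\<^sub>R d) ` {- r..r}" using u(2) by (auto simp: abs_le_iff)
        moreover have "(\<Sum>c\<in>J. u c *\<^sub>R c) \<in> box J" using u(2) by (auto simp: box_def)
        ultimately show "z \<in> ?B" by blast
      qed
    next
      show "?B \<subseteq> box (insert d J)"
      proof
        fix z assume "z \<in> ?B"
        then obtain s u where su: "s \<in> {- r..r}" "z = s *\<^sub>R d + (\<Sum>c\<in>J. u c *\<^sub>R c)" "\<forall>c\<in>J. \<bar>u c\<bar> \<le> r"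
          unfolding box_def by blast
        have "(\<Sum>c\<in>J. u c *\<^sub>R c) = (\<Sum>c\<in>J. (u(d := s)) c *\<^sub>R c)"
          using insert.hyps by (intro sum.cong) auto
        then have "z = (\<Sum>c\<in>insert d J. (u(d := s)) c *\<^sub>R c)"
          using su(2) insert.hyps by simp
        moreover have "\<forall>c\<in>insert d J. \<bar>(u(d := s)) c\<bar> \<le> r" using su by auto
        ultimately show "z \<in> box (insert d J)" unfolding box_def by blast
      qed
    qed
    moreover have "compact ((\<lambda>t. t *\<^sub>R d) ` {- r..r})"
      by (intro compact_continuous_image continuous_intros) auto
    ultimately show ?case using compact_sums[OF _ insert.IH] by simp
  qed
  then have "compact ((\<lambda>y. a + y) ` box I)"
    using fin by (intro compact_continuous_image continuous_intros)
  moreover have "cball a r \<subseteq> (\<lambda>y. a + y) ` box I"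
  proof
    fix x assume x: "x \<in> cball a r"
    have "\<bar>(x - a) \<bullet> c\<bar> \<le> r" if "c \<in> I" for c
    proof -
      have "norm c = 1"
        using assms that by (auto simp: orthonormal_basis_def norm_eq_1)
      then show ?thesis
        using Cauchy_Schwarz_ineq2[of "x - a" c] x by (simp add: dist_norm norm_minus_commute)
    qed
    moreover have "x - a = (\<Sum>c\<in>I. ((x - a) \<bullet> c) *\<^sub>R c)"
      using assms by (auto simp: orthonormal_basis_def)
    ultimately have "x - a \<in> box I" unfolding box_def by blast
    then show "x \<in> (\<lambda>y. a + y) ` box I" by (intro image_eqI[of _ _ "x - a"]) auto
  qed
  ultimately show ?thesis
    using compact_Int_closed[of _ "cball a r"] by (metis Int_absorb1 closed_cball inf_commute)
qed

section \<open>Smooth functions on a manifold\<close>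

lemma smooth_manifold_basis:
  fixes A :: "('a::{second_countable_topology,t2_space}, 'e::real_inner) atlas"
  assumes "smooth_manifold A"
  obtains I :: "'e set" where "orthonormal_basis I"
proof -
  from assms obtain B :: "'e set" where "finite B" "span B = UNIV"
    unfolding smooth_manifold_def by auto
  from orthonormal_basis_exists[OF this] show ?thesis using that by auto
qed

lemma chart_exists:
  assumes "smooth_manifold A"
  obtains U \<phi> where "(U, \<phi>) \<in> A" "p \<in> U"
proof -
  have "p \<in> (\<Union>(U, \<phi>) \<in> A. U)"
    using assms by (simp add: smooth_manifold_def)
  then show ?thesis using that by auto
qed

lemma chart_homeomorphism:
  assumes "smooth_manifold A" "(U, \<phi>) \<in> A"
  shows "open U" "open (\<phi> ` U)" "homeomorphism U (\<phi> ` U) \<phi> (inv_into U \<phi>)"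
proof -
  from assms(1) have "\<forall>(U, \<phi>) \<in> A. open U \<and> open (\<phi> ` U) \<and> homeomorphism U (\<phi> ` U) \<phi> (inv_into U \<phi>)"
    unfolding smooth_manifold_def by (elim conjE)
  from bspec[OF this assms(2)]
  show "open U" "open (\<phi> ` U)" "homeomorphism U (\<phi> ` U) \<phi> (inv_into U \<phi>)" by simp_all
qed

lemma chart_continuous:
  assumes "smooth_manifold A" "(U, \<phi>) \<in> A"
  shows "continuous_on U \<phi>" "continuous_on (\<phi> ` U) (inv_into U \<phi>)"
  using chart_homeomorphism(3)[OF assms] by (auto simp: homeomorphism_def)

lemma chart_inv:
  assumes "smooth_manifold A" "(U, \<phi>) \<in> A" "q \<in> U"
  shows "inv_into U \<phi> (\<phi> q) = q"
  using chart_homeomorphism(3)[OF assms(1,2)] assms(3) by (auto simp: homeomorphism_def)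

lemma chart_image:
  assumes "smooth_manifold A" "(U, \<phi>) \<in> A" "W \<subseteq> U"
  shows "\<phi> ` W = \<phi> ` U \<inter> inv_into U \<phi> -` W"
  using chart_inv[OF assms(1,2)] assms(3) by force

lemma chart_open_image:
  assumes "smooth_manifold A" "(U, \<phi>) \<in> A" "open W" "W \<subseteq> U"
  shows "open (\<phi> ` W)"
  unfolding chart_image[OF assms(1,2,4)]
  by (intro continuous_open_preimage chart_continuous[OF assms(1,2)]
    chart_homeomorphism[OF assms(1,2)] assms)

lemma chart_open_preimage:
  assumes "smooth_manifold A" "(U, \<phi>) \<in> A" "open T"
  shows "open (U \<inter> \<phi> -` T)"
  by (intro continuous_open_preimage chart_continuous[OF assms(1,2)]
    chart_homeomorphism[OF assms(1,2)] assms)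

lemma chart_transition:
  assumes "smooth_manifold A" "(U, \<phi>) \<in> A" "(V, \<psi>) \<in> A"
  shows "smooth_on (\<phi> ` (U \<inter> V)) (\<psi> \<circ> inv_into U \<phi>)"
proof -
  from assms(1) have "\<forall>(U, \<phi>) \<in> A. \<forall>(V, \<psi>) \<in> A. smooth_on (\<phi> ` (U \<inter> V)) (\<psi> \<circ> inv_into U \<phi>)"
    unfolding smooth_manifold_def by (elim conjE)
  from bspec[OF this assms(2)] assms(3) show ?thesis by auto
qed

text \<open>A single chart is asked for, which suits constructions in a chart; \<open>smooth_at_chart\<close> gives the same
  in every chart.\<close>

definition smooth_at ::
    "('a::topological_space, 'e::real_inner) atlas \<Rightarrow> ('a \<Rightarrow> real) \<Rightarrow> 'a \<Rightarrow> bool" where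
  "smooth_at A f p \<longleftrightarrow> (\<exists>U \<phi> W. (U, \<phi>) \<in> A \<and> open W \<and> p \<in> W \<and> W \<subseteq> U \<and>
     smooth_on (\<phi> ` W) (f \<circ> inv_into U \<phi>))"

text \<open>Write \<open>f\<close> in the second chart as \<open>f\<close> in the first chart composed with the smooth transition map.\<close>

lemma smooth_at_chart:
  fixes A :: "('a::{second_countable_topology,t2_space}, 'e::real_inner) atlas"
  assumes M: "smooth_manifold A" and f: "smooth_at A f p" and V: "(V, \<psi>) \<in> A" "p \<in> V"
  shows "\<exists>W. open W \<and> p \<in> W \<and> W \<subseteq> V \<and> smooth_on (\<psi> ` W) (f \<circ> inv_into V \<psi>)"
proof -
  obtain I :: "'e set" where I: "orthonormal_basis I"
    using smooth_manifold_basis[OF M] .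
  obtain U \<phi> W where U: "(U, \<phi>) \<in> A" and W: "open W" "p \<in> W" "W \<subseteq> U"
    and sm: "smooth_on (\<phi> ` W) (f \<circ> inv_into U \<phi>)"
    using f unfolding smooth_at_def by blast
  let ?W = "W \<inter> V"
  have oV: "open V" using chart_homeomorphism(1)[OF M V(1)] .
  have op: "open (\<psi> ` ?W)" "open (\<phi> ` W)"
    using W oV by (auto intro: chart_open_image[OF M V(1)] chart_open_image[OF M U])
  have img: "(\<phi> \<circ> inv_into V \<psi>) ` \<psi> ` ?W \<subseteq> \<phi> ` W"
    using chart_inv[OF M V(1)] by auto
  have "Ck_on k (\<psi> ` ?W) (f \<circ> inv_into V \<psi>)" for k
  proof -
    have "Ck_on k (\<psi> ` ?W) (\<phi> \<circ> inv_into V \<psi>)"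
      using chart_transition[OF M V(1) U] W(3) unfolding smooth_on_def
      by (elim allE[of _ k] Ck_on_subset) auto
    moreover have "Ck_on k (\<phi> ` W) (f \<circ> inv_into U \<phi>)"
      using sm by (simp add: smooth_on_def)
    ultimately have "Ck_on k (\<psi> ` ?W) (\<lambda>y. (f \<circ> inv_into U \<phi>) ((\<phi> \<circ> inv_into V \<psi>) y))"
      by (rule Ck_on_compose[OF I op img])
    moreover have "(f \<circ> inv_into U \<phi>) ((\<phi> \<circ> inv_into V \<psi>) y) = (f \<circ> inv_into V \<psi>) y"
      if "y \<in> \<psi> ` ?W" for y
      using that chart_inv[OF M V(1)] chart_inv[OF M U] W(3) by auto
    ultimately show ?thesis
      by (rule iffD1[OF Ck_on_cong[OF op(1)], rotated])
  qed
  then have "smooth_on (\<psi> ` ?W) (f \<circ> inv_into V \<psi>)" unfolding smooth_on_def ..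
  moreover have "open ?W" "p \<in> ?W" "?W \<subseteq> V" using W V oV by auto
  ultimately show ?thesis by blast
qed

lemma smooth_functionsD:
  "f \<in> smooth_functions A \<Longrightarrow> (U, \<phi>) \<in> A \<Longrightarrow> Ck_on k (\<phi> ` U) (\<lambda>y. f (inv_into U \<phi> y))"
  by (auto simp: smooth_functions_def smooth_on_def o_def)

lemma smooth_functionsI:
  "(\<And>U \<phi> k. (U, \<phi>) \<in> A \<Longrightarrow> Ck_on k (\<phi> ` U) (\<lambda>y. f (inv_into U \<phi> y))) \<Longrightarrow> f \<in> smooth_functions A"
  by (auto simp: smooth_functions_def smooth_on_def o_def)

lemma smooth_functions_iff:
  assumes M: "smooth_manifold A"
  shows "f \<in> smooth_functions A \<longleftrightarrow> (\<forall>p. smooth_at A f p)"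
proof
  assume f: "f \<in> smooth_functions A"
  show "\<forall>p. smooth_at A f p"
  proof
    fix p
    obtain U \<phi> where "(U, \<phi>) \<in> A" "p \<in> U" using chart_exists[OF M] .
    moreover have "smooth_on (\<phi> ` U) (f \<circ> inv_into U \<phi>)"
      using smooth_functionsD[OF f \<open>(U, \<phi>) \<in> A\<close>] by (simp add: smooth_on_def o_def)
    ultimately show "smooth_at A f p"
      using chart_homeomorphism(1)[OF M \<open>(U, \<phi>) \<in> A\<close>] unfolding smooth_at_def by blast
  qed
next
  assume f: "\<forall>p. smooth_at A f p"
  show "f \<in> smooth_functions A"
  proof (intro smooth_functionsI Ck_on_locally)
    fix U \<phi> k y assume U: "(U, \<phi>) \<in> A" and "y \<in> \<phi> ` U"
    from \<open>y \<in> \<phi> ` U\<close> obtain p where p: "p \<in> U" "y = \<phi> p" by blast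
    obtain W where W: "open W" "p \<in> W" "W \<subseteq> U" "smooth_on (\<phi> ` W) (f \<circ> inv_into U \<phi>)"
      using smooth_at_chart[OF M _ U p(1)] f by blast
    note chart_open_image[OF M U W(1,3)]
    moreover have "Ck_on k (\<phi> ` W) (\<lambda>y. f (inv_into U \<phi> y))"
      using W(4) by (simp add: smooth_on_def o_def)
    ultimately show "\<exists>T. open T \<and> y \<in> T \<and> Ck_on k T (\<lambda>y. f (inv_into U \<phi> y))"
      using W(2) p(2) by blast
  qed
qed

lemma smooth_at_cong:
  assumes M: "smooth_manifold A" and "smooth_at A f p" "open N" "p \<in> N" "\<And>q. q \<in> N \<Longrightarrow> f q = g q"
  shows "smooth_at A g p"
proof -
  obtain U \<phi> W where U: "(U, \<phi>) \<in> A" and W: "open W" "p \<in> W" "W \<subseteq> U"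
    and sm: "smooth_on (\<phi> ` W) (f \<circ> inv_into U \<phi>)"
    using assms(2) unfolding smooth_at_def by blast
  have op: "open (\<phi> ` (W \<inter> N))"
    using W assms(3) by (intro chart_open_image[OF M U]) auto
  have "Ck_on k (\<phi> ` (W \<inter> N)) (g \<circ> inv_into U \<phi>)" for k
  proof (rule iffD1[OF Ck_on_cong[OF op]])
    show "Ck_on k (\<phi> ` (W \<inter> N)) (f \<circ> inv_into U \<phi>)"
      using sm unfolding smooth_on_def by (elim allE[of _ k] Ck_on_subset) blast
    show "(f \<circ> inv_into U \<phi>) y = (g \<circ> inv_into U \<phi>) y" if "y \<in> \<phi> ` (W \<inter> N)" for y
      using that chart_inv[OF M U] W(3) assms(5) by auto
  qed
  then have "smooth_on (\<phi> ` (W \<inter> N)) (g \<circ> inv_into U \<phi>)" unfolding smooth_on_def ..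
  moreover have "open (W \<inter> N)" "p \<in> W \<inter> N" "W \<inter> N \<subseteq> U" using W assms(3,4) by auto
  ultimately show ?thesis unfolding smooth_at_def using U by blast
qed

lemma smooth_at_mult:
  assumes M: "smooth_manifold A" and "smooth_at A f p" "smooth_at A g p"
  shows "smooth_at A (\<lambda>q. f q * g q) p"
proof -
  obtain U \<phi> W where U: "(U, \<phi>) \<in> A" and W: "open W" "p \<in> W" "W \<subseteq> U"
    and sm: "smooth_on (\<phi> ` W) (f \<circ> inv_into U \<phi>)"
    using assms(2) unfolding smooth_at_def by blast
  obtain W' where W': "open W'" "p \<in> W'" "W' \<subseteq> U" "smooth_on (\<phi> ` W') (g \<circ> inv_into U \<phi>)"
    using smooth_at_chart[OF M assms(3) U] W by blast
  have op: "open (\<phi> ` (W \<inter> W'))"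
    using W W' by (intro chart_open_image[OF M U]) auto
  have "Ck_on k (\<phi> ` (W \<inter> W')) (\<lambda>y. (f \<circ> inv_into U \<phi>) y * (g \<circ> inv_into U \<phi>) y)" for k
  proof (rule Ck_on_mult[OF op])
    show "Ck_on k (\<phi> ` (W \<inter> W')) (f \<circ> inv_into U \<phi>)" "Ck_on k (\<phi> ` (W \<inter> W')) (g \<circ> inv_into U \<phi>)"
      using sm W'(4) unfolding smooth_on_def by (elim allE[of _ k] Ck_on_subset; blast)+
  qed
  then have "smooth_on (\<phi> ` (W \<inter> W')) ((\<lambda>q. f q * g q) \<circ> inv_into U \<phi>)"
    by (simp add: smooth_on_def o_def)
  moreover have "open (W \<inter> W')" "p \<in> W \<inter> W'" "W \<inter> W' \<subseteq> U" using W W' by auto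
  ultimately show ?thesis unfolding smooth_at_def using U by blast
qed

lemma smooth_functions_const:
  "smooth_manifold A \<Longrightarrow> (\<lambda>p. c) \<in> smooth_functions A"
  by (intro smooth_functionsI Ck_on_const chart_homeomorphism(2))

lemma smooth_functions_add:
  assumes "smooth_manifold A" "f \<in> smooth_functions A" "g \<in> smooth_functions A"
  shows "(\<lambda>p. f p + g p) \<in> smooth_functions A"
  by (intro smooth_functionsI Ck_on_add smooth_functionsD[OF assms(2)] smooth_functionsD[OF assms(3)]
    chart_homeomorphism(2)[OF assms(1)])

lemma smooth_functions_mult:
  assumes "smooth_manifold A" "f \<in> smooth_functions A" "g \<in> smooth_functions A"
  shows "(\<lambda>p. f p * g p) \<in> smooth_functions A"
  by (intro smooth_functionsI Ck_on_mult smooth_functionsD[OF assms(2)] smooth_functionsD[OF assms(3)]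
    chart_homeomorphism(2)[OF assms(1)])

lemma smooth_functions_diff:
  assumes "smooth_manifold A" "f \<in> smooth_functions A" "g \<in> smooth_functions A"
  shows "(\<lambda>p. f p - g p) \<in> smooth_functions A"
  using smooth_functions_add[OF assms(1,2) smooth_functions_mult[OF assms(1)
    smooth_functions_const[OF assms(1), of "-1"] assms(3)]] by simp

lemma smooth_functions_sum:
  assumes "smooth_manifold A" "\<And>i. i \<in> I \<Longrightarrow> f i \<in> smooth_functions A"
  shows "(\<lambda>p. \<Sum>i\<in>I. f i p) \<in> smooth_functions A"
  using assms(2)
  by (induction I rule: infinite_finite_induct)
    (auto intro: smooth_functions_add smooth_functions_const assms(1))

lemma smooth_functions_local:
  assumes "smooth_manifold A"
    and "\<And>p. \<exists>g\<in>smooth_functions A. \<exists>N. open N \<and> p \<in> N \<and> (\<forall>q\<in>N. g q = f q)"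
  shows "f \<in> smooth_functions A"
  unfolding smooth_functions_iff[OF assms(1)]
proof
  fix p
  show "smooth_at A f p"
    using assms(2)[of p] smooth_at_cong[OF assms(1)] smooth_functions_iff[OF assms(1)] by blast
qed

lemma smooth_functions_continuous:
  assumes M: "smooth_manifold A" and f: "f \<in> smooth_functions A"
  shows "continuous_on UNIV f"
proof (rule continuous_at_imp_continuous_on, rule ballI)
  fix p
  obtain U \<phi> where U: "(U, \<phi>) \<in> A" "p \<in> U" using chart_exists[OF M] .
  have "Ck_on 0 (\<phi> ` U) (f \<circ> inv_into U \<phi>)"
    using smooth_functionsD[OF f U(1)] by (simp only: o_def)
  then have "continuous_on U (\<lambda>q. (f \<circ> inv_into U \<phi>) (\<phi> q))"
    by (intro continuous_on_compose2[OF _ chart_continuous(1)[OF M U(1)]]) auto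
  then have "continuous_on U f"
    by (rule continuous_on_eq) (simp add: chart_inv[OF M U(1)])
  then show "isCont f p"
    using U chart_homeomorphism(1)[OF M U(1)] by (simp add: continuous_on_eq_continuous_at)
qed

text \<open>A function that is smooth only on part of the manifold becomes smooth on all of it when it is
  multiplied by a bump function supported in that part.\<close>

lemma smooth_functions_cut_off:
  assumes M: "smooth_manifold A" and \<eta>: "\<eta> \<in> smooth_functions A" "closed K" "\<And>q. q \<notin> K \<Longrightarrow> \<eta> q = 0"
    and h: "\<And>q. q \<in> K \<Longrightarrow> smooth_at A h q"
  shows "(\<lambda>q. \<eta> q * h q) \<in> smooth_functions A"
  unfolding smooth_functions_iff[OF M]
proof
  fix p
  show "smooth_at A (\<lambda>q. \<eta> q * h q) p"
  proof (cases "p \<in> K")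
    case True
    then show ?thesis
      using smooth_at_mult[OF M _ h] \<eta>(1) smooth_functions_iff[OF M] by blast
  next
    case False
    have "smooth_at A (\<lambda>q. 0) p"
      using smooth_functions_const[OF M] smooth_functions_iff[OF M] by blast
    then show ?thesis
      by (rule smooth_at_cong[OF M, where N = "- K"]) (use \<eta> False in auto)
  qed
qed

text \<open>The Hausdorff property enters here: the preimage in the manifold of a closed ball in a chart is
  closed because it is compact.\<close>

lemma bump_function:
  fixes A :: "('a::{second_countable_topology,t2_space}, 'e::real_inner) atlas"
  assumes M: "smooth_manifold A" and W: "open W" "p \<in> W"
  obtains \<eta> N K where "\<eta> \<in> smooth_functions A" "open N" "p \<in> N" "N \<subseteq> K" "\<And>q. q \<in> N \<Longrightarrow> \<eta> q = 1"
    "closed K" "K \<subseteq> W" "\<And>q. q \<notin> K \<Longrightarrow> \<eta> q = 0"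
proof -
  obtain I :: "'e set" where I: "orthonormal_basis I"
    using smooth_manifold_basis[OF M] .
  obtain U \<phi> where U: "(U, \<phi>) \<in> A" "p \<in> U" using chart_exists[OF M] .
  have oU: "open U" using chart_homeomorphism(1)[OF M U(1)] .
  have op: "open (\<phi> ` (U \<inter> W))"
    using W oU by (intro chart_open_image[OF M U(1)]) auto
  then obtain r where r: "r > 0" "cball (\<phi> p) r \<subseteq> \<phi> ` (U \<inter> W)"
    using W U unfolding open_contains_cball by blast
  obtain \<rho> :: "'e \<Rightarrow> real" where \<rho>: "smooth_on UNIV \<rho>" "\<And>x. x \<in> ball (\<phi> p) (r / 2) \<Longrightarrow> \<rho> x = 1"
    "\<And>x. x \<notin> ball (\<phi> p) r \<Longrightarrow> \<rho> x = 0"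
    using bump_on_inner_product_space[OF r(1)] by metis
  define \<eta> where "\<eta> = (\<lambda>q. if q \<in> U then \<rho> (\<phi> q) else 0)"
  define K where "K = inv_into U \<phi> ` cball (\<phi> p) r"
  define N where "N = U \<inter> \<phi> -` ball (\<phi> p) (r / 2)"
  have "compact K"
    unfolding K_def using r(2)
    by (intro compact_continuous_image compact_cball_orthonormal[OF I]
        continuous_on_subset[OF chart_continuous(2)[OF M U(1)]]) auto
  then have K: "closed K" by (rule compact_imp_closed)
  have KU: "K \<subseteq> U \<inter> W"
    using r(2) chart_inv[OF M U(1)] unfolding K_def by force
  have mem_K: "q \<in> K" if "q \<in> U" "\<phi> q \<in> cball (\<phi> p) r" for q
    using that chart_inv[OF M U(1)] unfolding K_def by (metis imageI)
  have zero: "\<eta> q = 0" if "q \<notin> K" for q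
    using that mem_K \<rho>(3) unfolding \<eta>_def by (meson ball_subset_cball subsetD)
  have "smooth_at A \<eta> q" for q
  proof (cases "q \<in> U")
    case True
    have "Ck_on k (\<phi> ` U) (\<eta> \<circ> inv_into U \<phi>)" for k
    proof (rule iffD1[OF Ck_on_cong[OF chart_homeomorphism(2)[OF M U(1)]]])
      show "Ck_on k (\<phi> ` U) \<rho>"
        using \<rho>(1) unfolding smooth_on_def by (elim allE[of _ k] Ck_on_subset) simp
      show "\<rho> y = (\<eta> \<circ> inv_into U \<phi>) y" if "y \<in> \<phi> ` U" for y
        using that chart_inv[OF M U(1)] by (auto simp: \<eta>_def)
    qed
    then have "smooth_on (\<phi> ` U) (\<eta> \<circ> inv_into U \<phi>)" unfolding smooth_on_def ..
    then show ?thesis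
      unfolding smooth_at_def using U True oU by blast
  next
    case False
    have "smooth_at A (\<lambda>q. 0) q"
      using smooth_functions_const[OF M] smooth_functions_iff[OF M] by blast
    then show ?thesis
      by (rule smooth_at_cong[OF M, where N = "- K"]) (use K KU False zero in auto)
  qed
  then have "\<eta> \<in> smooth_functions A" using smooth_functions_iff[OF M] by blast
  moreover have "open N" "p \<in> N"
    unfolding N_def using U r by (auto intro: chart_open_preimage[OF M U(1)])
  moreover have "N \<subseteq> K" using mem_K r(1) unfolding N_def by auto
  moreover have "\<eta> q = 1" if "q \<in> N" for q
    using that \<rho>(2) unfolding N_def \<eta>_def by auto
  ultimately show ?thesis using that[of \<eta> N K] K KU zero by blast
qed

text \<open>Cut off \<open>1/f\<close> by a bump function supported where \<open>f\<close> does not vanish.\<close>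

lemma smooth_functions_local_inverse:
  assumes M: "smooth_manifold A" and f: "f \<in> smooth_functions A" "f p \<noteq> 0"
  shows "\<exists>g\<in>smooth_functions A. \<exists>N. open N \<and> p \<in> N \<and> (\<forall>q\<in>N. f q * g q = 1)"
proof -
  let ?W = "{q. f q \<noteq> 0}"
  have oW: "open ?W"
    using smooth_functions_continuous[OF M f(1)] by (intro open_Collect_neq continuous_on_const)
  obtain \<eta> N K where \<eta>: "\<eta> \<in> smooth_functions A" "open N" "p \<in> N" "N \<subseteq> K"
    "\<And>q. q \<in> N \<Longrightarrow> \<eta> q = 1" "closed K" "K \<subseteq> ?W" "\<And>q. q \<notin> K \<Longrightarrow> \<eta> q = 0"
    using bump_function[OF M oW, of p] f(2) by blast
  have inv: "smooth_at A (\<lambda>q. inverse (f q)) q" if q: "q \<in> K" for q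
  proof -
    obtain U \<phi> where U: "(U, \<phi>) \<in> A" "q \<in> U" using chart_exists[OF M] .
    have op: "open (U \<inter> ?W)" "open (\<phi> ` (U \<inter> ?W))"
      using oW chart_homeomorphism(1)[OF M U(1)] by (auto intro: chart_open_image[OF M U(1)])
    have "Ck_on k (\<phi> ` (U \<inter> ?W)) (\<lambda>y. inverse ((f \<circ> inv_into U \<phi>) y))" for k
    proof (rule Ck_on_inverse[OF op(2)])
      show "Ck_on k (\<phi> ` (U \<inter> ?W)) (f \<circ> inv_into U \<phi>)"
        using smooth_functionsD[OF f(1) U(1)] unfolding o_def by (rule Ck_on_subset) blast
      show "(f \<circ> inv_into U \<phi>) y \<noteq> 0" if "y \<in> \<phi> ` (U \<inter> ?W)" for y
        using that chart_inv[OF M U(1)] by auto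
    qed
    then have "smooth_on (\<phi> ` (U \<inter> ?W)) ((\<lambda>q. inverse (f q)) \<circ> inv_into U \<phi>)"
      by (simp add: smooth_on_def o_def)
    moreover have "q \<in> U \<inter> ?W" using U q \<eta>(7) by auto
    ultimately show ?thesis
      unfolding smooth_at_def using U(1) op(1) by blast
  qed
  have "(\<lambda>q. \<eta> q * inverse (f q)) \<in> smooth_functions A"
    by (rule smooth_functions_cut_off[OF M \<eta>(1,6) _ inv]) (use \<eta>(8) in auto)
  moreover have "f q * (\<eta> q * inverse (f q)) = 1" if "q \<in> N" for q
  proof -
    have "f q \<noteq> 0" using \<eta>(4,7) that by blast
    then show ?thesis by (simp add: \<eta>(5)[OF that])
  qed
  ultimately show ?thesis
    using \<eta>(2,3) by (intro bexI[of _ "\<lambda>q. \<eta> q * inverse (f q)"] exI[of _ N]) auto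
qed

lemma smooth_functions_compose:
  fixes A :: "('a::{second_countable_topology,t2_space}, 'e::real_inner) atlas"
    and A' :: "('b::{second_countable_topology,t2_space}, 'f::real_inner) atlas"
  assumes M: "smooth_manifold A" and M': "smooth_manifold A'" and t: "smooth_map A A' t"
    and f: "f \<in> smooth_functions A'"
  shows "f \<circ> t \<in> smooth_functions A"
  unfolding smooth_functions_iff[OF M]
proof
  fix p
  obtain I :: "'f set" where I: "orthonormal_basis I"
    using smooth_manifold_basis[OF M'] .
  obtain U \<phi> where U: "(U, \<phi>) \<in> A" "p \<in> U" using chart_exists[OF M] .
  obtain V \<psi> where V: "(V, \<psi>) \<in> A'" "t p \<in> V" using chart_exists[OF M'] .
  let ?W = "U \<inter> t -` V"
  have "open (t -` V)"
    using t chart_homeomorphism(1)[OF M' V(1)] by (auto simp: smooth_map_def open_vimage)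
  then have oW: "open ?W" using chart_homeomorphism(1)[OF M U(1)] by auto
  have op: "open (\<phi> ` ?W)" "open (\<psi> ` V)"
    using chart_open_image[OF M U(1) oW] chart_homeomorphism(2)[OF M' V(1)] by auto
  have img: "(\<psi> \<circ> t \<circ> inv_into U \<phi>) ` \<phi> ` ?W \<subseteq> \<psi> ` V"
    using chart_inv[OF M U(1)] by auto
  have "Ck_on k (\<phi> ` ?W) (f \<circ> t \<circ> inv_into U \<phi>)" for k
  proof (rule iffD1[OF Ck_on_cong[OF op(1)]])
    from t have "\<forall>(U, \<phi>) \<in> A. \<forall>(V, \<psi>) \<in> A'. smooth_on (\<phi> ` (U \<inter> t -` V)) (\<psi> \<circ> t \<circ> inv_into U \<phi>)"
      unfolding smooth_map_def by (rule conjunct2)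
    from bspec[OF this U(1)] V(1) have "Ck_on k (\<phi> ` ?W) (\<psi> \<circ> t \<circ> inv_into U \<phi>)"
      by (auto simp: smooth_on_def)
    moreover have "Ck_on k (\<psi> ` V) (f \<circ> inv_into V \<psi>)"
      using smooth_functionsD[OF f V(1)] by (simp only: o_def)
    ultimately show "Ck_on k (\<phi> ` ?W) (\<lambda>y. (f \<circ> inv_into V \<psi>) ((\<psi> \<circ> t \<circ> inv_into U \<phi>) y))"
      by (rule Ck_on_compose[OF I op img])
    show "(f \<circ> inv_into V \<psi>) ((\<psi> \<circ> t \<circ> inv_into U \<phi>) y) = (f \<circ> t \<circ> inv_into U \<phi>) y"
      if "y \<in> \<phi> ` ?W" for y
      using that chart_inv[OF M U(1)] chart_inv[OF M' V(1)] by auto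
  qed
  then have "smooth_on (\<phi> ` ?W) (f \<circ> t \<circ> inv_into U \<phi>)" unfolding smooth_on_def ..
  moreover have "p \<in> ?W" using U V by simp
  ultimately show "smooth_at A (f \<circ> t) p"
    unfolding smooth_at_def using U(1) oW by blast
qed

section \<open>Hadamard's lemma\<close>

text \<open>The mean value theorem along the segment from \<open>y\<close> to \<open>y + w\<close> bounds the remainder by the
  variation of the directional derivative \<open>K w\<close> on that segment, which is controlled by the finitely
  many continuous functions \<open>K c\<close>.\<close>

lemma has_derivative_from_directional:
  fixes F :: "'e::real_inner \<Rightarrow> real"
  assumes I: "orthonormal_basis I" and S: "open S" "y \<in> S"
    and K: "\<And>x w. x \<in> S \<Longrightarrow> ((\<lambda>s. F (x + s *\<^sub>R w)) has_real_derivative K w x) (at 0)"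
    and exp: "\<And>x w. x \<in> S \<Longrightarrow> K w x = (\<Sum>c\<in>I. (w \<bullet> c) * K c x)"
    and cont: "\<And>c. continuous_on S (K c)"
  shows "(F has_derivative (\<lambda>w. K w y)) (at y)"
proof -
  have fin: "finite I" and unit: "\<And>c. c \<in> I \<Longrightarrow> norm c = 1"
    using I by (auto simp: orthonormal_basis_def norm_eq_1)
  have comp_le: "\<bar>w \<bullet> c\<bar> \<le> norm w" if "c \<in> I" for w c
    using Cauchy_Schwarz_ineq2[of w c] unit[OF that] by simp
  have "bounded_linear (\<lambda>w. K w y)"
  proof -
    have "bounded_linear (\<lambda>w. \<Sum>c\<in>I. (w \<bullet> c) * K c y)"
      by (intro bounded_linear_sum bounded_linear_mult_const bounded_linear_inner_left)
    also have "(\<lambda>w. \<Sum>c\<in>I. (w \<bullet> c) * K c y) = (\<lambda>w. K w y)"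
      by (rule ext) (rule exp[OF S(2), symmetric])
    finally show ?thesis .
  qed
  moreover have "\<exists>d>0. \<forall>x. norm (x - y) < d \<longrightarrow> norm (F x - F y - K (x - y) y) \<le> e * norm (x - y)"
    if e: "e > 0" for e
  proof -
    \<comment> \<open>The \<open>1\<close> keeps the quotient meaningful when the space is zero and \<open>I\<close> is empty.\<close>
    define e' where "e' = e / (1 + real (card I))"
    have e': "e' > 0" using e by (simp add: e'_def)
    have "\<forall>\<^sub>F x in at y. \<bar>K c x - K c y\<bar> < e'" if "c \<in> I" for c
    proof -
      have "isCont (K c) y" using cont[of c] S by (simp add: continuous_on_eq_continuous_at)
      then show ?thesis
        using tendstoD[OF _ e', of "K c" "K c y" "at y"] by (simp add: isCont_def dist_real_def)
    qed
    then have "\<forall>\<^sub>F x in at y. \<forall>c\<in>I. \<bar>K c x - K c y\<bar> < e'"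
      using fin by (simp add: eventually_ball_finite)
    then obtain d1 where d1: "d1 > 0" "\<And>x. x \<noteq> y \<Longrightarrow> dist x y < d1 \<Longrightarrow> \<forall>c\<in>I. \<bar>K c x - K c y\<bar> < e'"
      unfolding eventually_at by auto
    obtain d2 where d2: "d2 > 0" "ball y d2 \<subseteq> S"
      using S open_contains_ball by blast
    define d where "d = min d1 d2"
    have near: "\<bar>K c x - K c y\<bar> \<le> e'" if "c \<in> I" "dist x y < d" for c x
      using d1(2)[of x] that e' unfolding d_def by (cases "x = y") (auto intro: less_imp_le)
    have "norm (F x - F y - K (x - y) y) \<le> e * norm (x - y)" if x: "norm (x - y) < d" for x
    proof -
      define w where "w = x - y"
      have seg: "dist (y + s *\<^sub>R w) y < d" "y + s *\<^sub>R w \<in> S" if "0 \<le> s" "s \<le> 1" for s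
      proof -
        have "norm (s *\<^sub>R w) \<le> norm w" using that by (simp add: mult_left_le_one_le)
        then show "dist (y + s *\<^sub>R w) y < d" using x by (simp add: dist_norm w_def)
        then show "y + s *\<^sub>R w \<in> S"
          using d2(2) unfolding d_def by (auto simp: dist_commute mem_ball)
      qed
      have "((\<lambda>s. F (y + s *\<^sub>R w) - s * K w y) has_real_derivative K w (y + s *\<^sub>R w) - K w y) (at s)"
        if "0 \<le> s" "s \<le> 1" for s
      proof -
        have "((\<lambda>u. F ((y + s *\<^sub>R w) + u *\<^sub>R w)) has_real_derivative K w (y + s *\<^sub>R w)) (at (s - s))"
          using K[OF seg(2)[OF that]] by simp
        moreover have "((\<lambda>u. u - s) has_real_derivative 1) (at s)"
          by (auto intro!: derivative_eq_intros)
        ultimately have "((\<lambda>u. F ((y + s *\<^sub>R w) + (u - s) *\<^sub>R w)) has_real_derivative K w (y + s *\<^sub>R w)) (at s)"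
          using DERIV_chain2[of "\<lambda>u. F ((y + s *\<^sub>R w) + u *\<^sub>R w)" _ "\<lambda>u. u - s" s] by fastforce
        moreover have "(y + s *\<^sub>R w) + (u - s) *\<^sub>R w = y + u *\<^sub>R w" for u
          by (simp add: algebra_simps)
        ultimately have "((\<lambda>u. F (y + u *\<^sub>R w)) has_real_derivative K w (y + s *\<^sub>R w)) (at s)"
          by simp
        then show ?thesis by (auto intro!: derivative_eq_intros)
      qed
      from MVT2[OF zero_less_one this]
      obtain z where z: "0 < z" "z < 1"
        "F (y + w) - K w y - F y = K w (y + z *\<^sub>R w) - K w y" by auto
      have zS: "y + z *\<^sub>R w \<in> S" using seg(2)[of z] z by simp
      have "\<bar>K w (y + z *\<^sub>R w) - K w y\<bar> = \<bar>\<Sum>c\<in>I. (w \<bullet> c) * (K c (y + z *\<^sub>R w) - K c y)\<bar>"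
        unfolding exp[OF zS, of w] exp[OF S(2), of w] by (simp add: sum_subtractf right_diff_distrib)
      also have "\<dots> \<le> (\<Sum>c\<in>I. \<bar>w \<bullet> c\<bar> * \<bar>K c (y + z *\<^sub>R w) - K c y\<bar>)"
        unfolding abs_mult[symmetric] by (rule sum_abs)
      also have "\<dots> \<le> (\<Sum>c\<in>I. norm w * e')"
        using near[OF _ seg(1)[of z]] z by (intro sum_mono mult_mono comp_le) auto
      also have "\<dots> = (real (card I) * e') * norm w" by simp
      also have "\<dots> \<le> e * norm w"
        using e by (intro mult_right_mono) (simp_all add: e'_def field_simps)
      finally show ?thesis using z(3) by (simp add: w_def algebra_simps)
    qed
    then show ?thesis using d1(1) d2(1) by (intro exI[of _ d]) (auto simp: d_def)
  qed
  ultimately show ?thesis by (simp add: has_derivative_within_alt)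
qed

text \<open>A weighted mean of \<open>G\<close> along the segment from \<open>a\<close> to \<open>y\<close>. Differentiating under the integral
  raises the weight by one, so the family of all these means is closed under differentiation.\<close>

definition radial_mean :: "'e::real_inner \<Rightarrow> nat \<Rightarrow> ('e \<Rightarrow> real) \<Rightarrow> 'e \<Rightarrow> real" where
  "radial_mean a m G y = integral (cbox 0 1) (\<lambda>s. s ^ m * G (a + s *\<^sub>R (y - a)))"

lemma segment_in_ball:
  fixes a :: "'e::real_inner"
  assumes "y \<in> ball a r" "0 \<le> s" "s \<le> 1"
  shows "a + s *\<^sub>R (y - a) \<in> ball a r"
proof -
  have "norm (s *\<^sub>R (y - a)) \<le> norm (y - a)" using assms by (simp add: mult_left_le_one_le)
  then show ?thesis using assms(1) by (simp add: dist_norm norm_minus_commute)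
qed

lemma radial_integrand_continuous:
  fixes G :: "'e::real_inner \<Rightarrow> real"
  assumes "continuous_on (ball a r) G"
  shows "continuous_on (ball a r \<times> cbox 0 1) (\<lambda>(y, s). s ^ m * G (a + s *\<^sub>R (y - a)))"
  unfolding split_beta
  by (intro continuous_intros continuous_on_compose2[OF assms]) (auto intro!: segment_in_ball)

lemma radial_integrand_integrable:
  fixes G :: "'e::real_inner \<Rightarrow> real"
  assumes "continuous_on (ball a r) G" "y \<in> ball a r"
  shows "(\<lambda>s. s ^ m * G (a + s *\<^sub>R (y - a))) integrable_on cbox 0 1"
  using assms(2)
  by (intro integrable_continuous continuous_intros continuous_on_compose2[OF assms(1)])
    (auto intro!: segment_in_ball)

lemma radial_mean_continuous:
  assumes "continuous_on (ball a r) G"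
  shows "continuous_on (ball a r) (radial_mean a m G)"
  unfolding radial_mean_def[abs_def]
  by (rule integral_continuous_on_param[OF radial_integrand_continuous[OF assms]])

lemma radial_mean_directional:
  fixes G :: "'e::real_inner \<Rightarrow> real"
  assumes G: "\<And>x. x \<in> ball a r \<Longrightarrow> (G has_derivative G' x) (at x)"
    and cont: "continuous_on (ball a r) (\<lambda>x. G' x w)" and y: "y \<in> ball a r"
  shows "((\<lambda>u. radial_mean a m G (y + u *\<^sub>R w)) has_real_derivative
    radial_mean a (Suc m) (\<lambda>x. G' x w) y) (at 0)"
proof -
  define U where "U = (\<lambda>u. y + u *\<^sub>R w) -` ball a r"
  have U: "open U" "0 \<in> U" "convex U"
  proof -
    show "open U" unfolding U_def by (intro open_vimage open_ball continuous_intros)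
    show "0 \<in> U" using y by (simp add: U_def)
    have "U = (\<lambda>u. u *\<^sub>R w) -` ((\<lambda>x. x - y) ` ball a r)"
      unfolding U_def by (force simp: image_iff algebra_simps)
    moreover have "convex ((\<lambda>u. u *\<^sub>R w) -` ((\<lambda>x. x - y) ` ball a r))"
      by (intro convex_linear_vimage convex_translation_subtract convex_ball)
        (auto simp: linear_iff algebra_simps)
    ultimately show "convex U" by simp
  qed
  have inb: "a + s *\<^sub>R (y + u *\<^sub>R w - a) \<in> ball a r" if "u \<in> U" "s \<in> cbox 0 1" for u s :: real
    using that unfolding U_def by (intro segment_in_ball) auto
  have cG: "continuous_on (ball a r) G"
    using G by (intro continuous_at_imp_continuous_on ballI has_derivative_continuous)
  have "((\<lambda>u. integral (cbox 0 1) (\<lambda>s. s ^ m * G (a + s *\<^sub>R (y + u *\<^sub>R w - a))))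
     has_vector_derivative integral (cbox 0 1) (\<lambda>s. s ^ Suc m * G' (a + s *\<^sub>R (y + 0 *\<^sub>R w - a)) w))
     (at 0 within U)"
  proof (rule leibniz_rule_vector_derivative[OF _ _ _ U(2,3)])
    fix u s :: real assume us: "u \<in> U" "s \<in> cbox 0 1"
    have "((\<lambda>u. a + s *\<^sub>R (y + u *\<^sub>R w - a)) has_derivative (\<lambda>h. s *\<^sub>R (h *\<^sub>R w))) (at u)"
      by (auto intro!: derivative_eq_intros)
    from has_derivative_compose[OF this G[OF inb[OF us]]]
    have "((\<lambda>u. G (a + s *\<^sub>R (y + u *\<^sub>R w - a))) has_derivative
        (\<lambda>h. G' (a + s *\<^sub>R (y + u *\<^sub>R w - a)) (s *\<^sub>R (h *\<^sub>R w)))) (at u)" .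
    from has_derivative_mult_right[OF this, of "s ^ m"]
    have "((\<lambda>u. s ^ m * G (a + s *\<^sub>R (y + u *\<^sub>R w - a))) has_derivative
        (\<lambda>h. s ^ m * G' (a + s *\<^sub>R (y + u *\<^sub>R w - a)) (s *\<^sub>R (h *\<^sub>R w)))) (at u)" .
    moreover have "linear (G' (a + s *\<^sub>R (y + u *\<^sub>R w - a)))"
      using G[OF inb[OF us]] by (rule has_derivative_linear)
    ultimately show "((\<lambda>u. s ^ m * G (a + s *\<^sub>R (y + u *\<^sub>R w - a))) has_vector_derivative
        s ^ Suc m * G' (a + s *\<^sub>R (y + u *\<^sub>R w - a)) w) (at u within U)"
      by (simp add: has_vector_derivative_def linear_cmul mult_ac has_derivative_at_withinI)
  next
    fix u :: real assume "u \<in> U"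
    then show "(\<lambda>s. s ^ m * G (a + s *\<^sub>R (y + u *\<^sub>R w - a))) integrable_on cbox 0 1"
      by (intro radial_integrand_integrable[OF cG]) (simp add: U_def)
  next
    show "continuous_on (U \<times> cbox 0 1) (\<lambda>(u, s). s ^ Suc m * G' (a + s *\<^sub>R (y + u *\<^sub>R w - a)) w)"
      unfolding split_beta
      by (intro continuous_intros continuous_on_compose2[OF cont]) (use inb in auto)
  qed
  then show ?thesis
    unfolding radial_mean_def has_real_derivative_iff_has_vector_derivative
    using at_within_open[OF U(2,1)] by simp
qed

lemma radial_mean_has_derivative:
  fixes G :: "'e::real_inner \<Rightarrow> real"
  assumes I: "orthonormal_basis (I :: 'e set)"
    and G: "\<And>x. x \<in> ball a r \<Longrightarrow> (G has_derivative G' x) (at x)"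
    and cont: "\<And>w. continuous_on (ball a r) (\<lambda>x. G' x w)" and y: "y \<in> ball a r"
  shows "(radial_mean a m G has_derivative (\<lambda>w. radial_mean a (Suc m) (\<lambda>x. G' x w) y)) (at y)"
proof (rule has_derivative_from_directional[OF I open_ball y])
  fix x w assume x: "x \<in> ball a r"
  show "((\<lambda>s. radial_mean a m G (x + s *\<^sub>R w)) has_real_derivative
      radial_mean a (Suc m) (\<lambda>x. G' x w) x) (at 0)"
    by (rule radial_mean_directional[OF G cont x])
  have fin: "finite I" using I by (simp add: orthonormal_basis_def)
  have "radial_mean a (Suc m) (\<lambda>x. G' x w) x =
      integral (cbox 0 1) (\<lambda>s. \<Sum>c\<in>I. (w \<bullet> c) * (s ^ Suc m * G' (a + s *\<^sub>R (x - a)) c))"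
    unfolding radial_mean_def
  proof (rule integral_cong)
    fix s :: real assume "s \<in> cbox 0 1"
    then have "linear (G' (a + s *\<^sub>R (x - a)))"
      using segment_in_ball[OF x] by (intro has_derivative_linear[OF G]) simp
    from orthonormal_basis_linear[OF I this, of w]
    show "s ^ Suc m * G' (a + s *\<^sub>R (x - a)) w =
        (\<Sum>c\<in>I. (w \<bullet> c) * (s ^ Suc m * G' (a + s *\<^sub>R (x - a)) c))"
      by (simp add: sum_distrib_left mult_ac)
  qed
  also have "\<dots> = (\<Sum>c\<in>I. (w \<bullet> c) * radial_mean a (Suc m) (\<lambda>x. G' x c) x)"
    unfolding radial_mean_def
    using integrable_on_mult_right[OF radial_integrand_integrable[OF cont x]]
    by (simp add: integral_sum[OF fin] del: power_Suc cbox_interval)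
  finally show "radial_mean a (Suc m) (\<lambda>x. G' x w) x =
      (\<Sum>c\<in>I. (w \<bullet> c) * radial_mean a (Suc m) (\<lambda>x. G' x c) x)" .
next
  fix c show "continuous_on (ball a r) (radial_mean a (Suc m) (\<lambda>x. G' x c))"
    by (rule radial_mean_continuous[OF cont])
qed

lemma radial_mean_Ck:
  fixes G :: "'e::real_inner \<Rightarrow> real"
  assumes "orthonormal_basis (I :: 'e set)" "Ck_on k (ball a r) G"
  shows "Ck_on k (ball a r) (radial_mean a m G)"
  using assms(2)
proof (induction k arbitrary: m G)
  case 0
  then show ?case by (simp add: radial_mean_continuous)
next
  case (Suc k)
  note D = Ck_on_SucD[OF Suc.prems]
  show ?case
    by (rule Ck_on_SucI[OF open_ball radial_mean_has_derivative[OF assms(1) D(1)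
          Ck_on_continuous[OF D(2)]] Suc.IH[OF D(2)]])
qed

text \<open>Integrate the derivative of \<open>F\<close> along the segment from \<open>a\<close> to \<open>y\<close> and expand \<open>y - a\<close> in the basis.\<close>

lemma hadamard:
  fixes F :: "'e::real_inner \<Rightarrow> real"
  assumes I: "orthonormal_basis (I :: 'e set)" and F: "smooth_on (ball a r) F" and r: "r > 0"
  obtains h where "\<And>c. smooth_on (ball a r) (h c)" "\<And>c. h c a = frechet_derivative F (at a) c"
    "\<And>y. y \<in> ball a r \<Longrightarrow> F y = F a + (\<Sum>c\<in>I. ((y - a) \<bullet> c) * h c y)"
proof -
  define h where "h = (\<lambda>c. radial_mean a 0 (\<lambda>x. frechet_derivative F (at x) c))"
  have fin: "finite I" using I by (simp add: orthonormal_basis_def)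
  have C: "Ck_on k (ball a r) (\<lambda>x. frechet_derivative F (at x) c)"
    and D: "x \<in> ball a r \<Longrightarrow> (F has_derivative frechet_derivative F (at x)) (at x)" for k c x
    using F Ck_on_SucD[of k "ball a r" F] unfolding smooth_on_def by blast+
  have "smooth_on (ball a r) (h c)" for c
    unfolding h_def smooth_on_def using radial_mean_Ck[OF I C] by blast
  moreover have "h c a = frechet_derivative F (at a) c" for c
    by (simp add: h_def radial_mean_def)
  moreover have "F y = F a + (\<Sum>c\<in>I. ((y - a) \<bullet> c) * h c y)" if y: "y \<in> ball a r" for y
  proof -
    let ?D = "\<lambda>s. frechet_derivative F (at (a + s *\<^sub>R (y - a)))"
    have "((\<lambda>s. ?D s (y - a)) has_integral F (a + 1 *\<^sub>R (y - a)) - F (a + 0 *\<^sub>R (y - a))) {0..1}"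
    proof (rule fundamental_theorem_of_calculus)
      fix s :: real assume "s \<in> {0..1}"
      then have b: "a + s *\<^sub>R (y - a) \<in> ball a r" using segment_in_ball[OF y] by simp
      have "((\<lambda>s. a + s *\<^sub>R (y - a)) has_derivative (\<lambda>h. h *\<^sub>R (y - a))) (at s)"
        by (auto intro!: derivative_eq_intros)
      from has_derivative_compose[OF this D[OF b]] has_derivative_linear[OF D[OF b]]
      show "((\<lambda>s. F (a + s *\<^sub>R (y - a))) has_vector_derivative ?D s (y - a)) (at s within {0..1})"
        by (simp add: has_vector_derivative_def linear_cmul has_derivative_at_withinI)
    qed simp
    then have "F y - F a = integral (cbox 0 1) (\<lambda>s. ?D s (y - a))"
      by (simp add: integral_unique)
    also have "\<dots> = integral (cbox 0 1) (\<lambda>s. \<Sum>c\<in>I. ((y - a) \<bullet> c) * (s ^ 0 * ?D s c))"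
    proof (rule integral_cong)
      fix s :: real assume "s \<in> cbox 0 1"
      then have "linear (?D s)"
        using segment_in_ball[OF y] by (intro has_derivative_linear[OF D]) simp
      from orthonormal_basis_linear[OF I this, of "y - a"]
      show "?D s (y - a) = (\<Sum>c\<in>I. ((y - a) \<bullet> c) * (s ^ 0 * ?D s c))" by simp
    qed
    also have "\<dots> = (\<Sum>c\<in>I. ((y - a) \<bullet> c) * h c y)"
      unfolding h_def radial_mean_def
      using integrable_on_mult_right[OF radial_integrand_integrable[OF Ck_on_continuous[OF C] y]]
      by (simp add: integral_sum[OF fin] del: power_0 cbox_interval)
    finally show ?thesis by simp
  qed
  ultimately show ?thesis using that by blast
qed

section \<open>Tangent spaces and local frames\<close>

text \<open>Tangent spaces and cotangent spaces are both subspaces of spaces of functions; sums over frames are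
  treated for both at once.\<close>

definition function_subspace :: "('x \<Rightarrow> real) set \<Rightarrow> bool" where
  "function_subspace V \<longleftrightarrow> (\<lambda>x. 0) \<in> V \<and> (\<forall>u\<in>V. \<forall>v\<in>V. \<forall>a b. (\<lambda>x. a * u x + b * v x) \<in> V)"

lemma function_subspaceD:
  "function_subspace V \<Longrightarrow> u \<in> V \<Longrightarrow> v \<in> V \<Longrightarrow> (\<lambda>x. a * u x + b * v x) \<in> V"
  by (simp add: function_subspace_def)

lemma function_subspace_sum:
  assumes V: "function_subspace V" and "\<And>i. i \<in> I \<Longrightarrow> v i \<in> V"
  shows "(\<lambda>x. \<Sum>i\<in>I. a i * v i x) \<in> V"
  using assms(2)
proof (induction I rule: infinite_finite_induct)
  case (insert i I)
  have "(\<lambda>x. a i * v i x + 1 * (\<Sum>i\<in>I. a i * v i x)) \<in> V"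
    by (rule function_subspaceD[OF V]) (use insert in auto)
  then show ?case using insert.hyps by simp
qed (use V in \<open>simp_all add: function_subspace_def\<close>)

lemma linear_functional_onD:
  "linear_functional_on V l \<Longrightarrow> u \<in> V \<Longrightarrow> v \<in> V \<Longrightarrow> l (\<lambda>x. a * u x + b * v x) = a * l u + b * l v"
  by (simp add: linear_functional_on_def)

lemma linear_functional_on_zero:
  "linear_functional_on V l \<Longrightarrow> function_subspace V \<Longrightarrow> l (\<lambda>x. 0) = 0"
  using linear_functional_onD[of V l "\<lambda>x. 0" "\<lambda>x. 0" 0 0] by (simp add: function_subspace_def)

lemma linear_functional_on_sum:
  assumes l: "linear_functional_on V l" and V: "function_subspace V"
    and "\<And>i. i \<in> I \<Longrightarrow> v i \<in> V"
  shows "l (\<lambda>x. \<Sum>i\<in>I. a i * v i x) = (\<Sum>i\<in>I. a i * l (v i))"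
  using assms(3)
proof (induction I rule: infinite_finite_induct)
  case (insert i I)
  have "l (\<lambda>x. a i * v i x + 1 * (\<Sum>i\<in>I. a i * v i x)) = a i * l (v i) + 1 * l (\<lambda>x. \<Sum>i\<in>I. a i * v i x)"
    using insert.prems by (intro linear_functional_onD[OF l] function_subspace_sum[OF V]) auto
  then show ?case using insert by simp
qed (use linear_functional_on_zero[OF l V] in simp_all)

lemma tangent_comb:
  assumes "v \<in> tangent_space A p" "f \<in> smooth_functions A" "g \<in> smooth_functions A"
  shows "v (\<lambda>x. a * f x + b * g x) = a * v f + b * v g"
  using assms by (simp add: tangent_space_def linear_functional_on_def)

lemma tangent_add:
  assumes "v \<in> tangent_space A p" "f \<in> smooth_functions A" "g \<in> smooth_functions A"
  shows "v (\<lambda>x. f x + g x) = v f + v g"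
  using tangent_comb[OF assms, of 1 1] by simp

lemma tangent_mult:
  assumes "v \<in> tangent_space A p" "f \<in> smooth_functions A" "g \<in> smooth_functions A"
  shows "v (\<lambda>x. f x * g x) = f p * v g + g p * v f"
  using assms by (simp add: tangent_space_def)

lemma tangent_const:
  assumes M: "smooth_manifold A" and "v \<in> tangent_space A p"
  shows "v (\<lambda>x. c) = 0"
proof -
  note C = smooth_functions_const[OF M, of 1]
  have "v (\<lambda>x. 1) = v (\<lambda>x. 1) + v (\<lambda>x. 1)"
    using tangent_mult[OF assms(2) C C] by simp
  then show ?thesis using tangent_comb[OF assms(2) C C, of c 0] by simp
qed

lemma tangent_outside:
  "v \<in> tangent_space A p \<Longrightarrow> f \<notin> smooth_functions A \<Longrightarrow> v f = 0"
  by (simp add: tangent_space_def)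

lemma tangent_sum:
  assumes M: "smooth_manifold A" and v: "v \<in> tangent_space A p"
    and "\<And>i. i \<in> I \<Longrightarrow> f i \<in> smooth_functions A"
  shows "v (\<lambda>x. \<Sum>i\<in>I. f i x) = (\<Sum>i\<in>I. v (f i))"
  using assms(3)
proof (induction I rule: infinite_finite_induct)
  case (insert i I)
  then show ?case
    using tangent_add[OF v, of "f i" "\<lambda>x. \<Sum>i\<in>I. f i x"] smooth_functions_sum[OF M, of I f] by simp
qed (simp_all add: tangent_const[OF M v])

lemma tangent_eqI:
  assumes "u \<in> tangent_space A p" "v \<in> tangent_space A p"
    and "\<And>f. f \<in> smooth_functions A \<Longrightarrow> u f = v f"
  shows "u = v"
proof
  fix f show "u f = v f"
    using assms by (cases "f \<in> smooth_functions A") (simp_all add: tangent_outside)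
qed

lemma tangent_space_comb:
  assumes "u \<in> tangent_space A p" "v \<in> tangent_space A p"
  shows "(\<lambda>f. a * u f + b * v f) \<in> tangent_space A p"
  using assms unfolding tangent_space_def linear_functional_on_def
  by (simp add: algebra_simps)

lemma tangent_space_zero: "(\<lambda>f. 0) \<in> tangent_space A p"
  by (simp add: tangent_space_def linear_functional_on_def)

lemma function_subspace_tangent: "function_subspace (tangent_space A p)"
  by (simp add: function_subspace_def tangent_space_zero tangent_space_comb)

lemmas tangent_space_sum = function_subspace_sum[OF function_subspace_tangent]

text \<open>A bump function at \<open>p\<close> times the difference \<open>f - g\<close> vanishes identically, and by the Leibniz rule \<open>v\<close> maps
  this product to \<open>v f - v g\<close>.\<close>

lemma tangent_local:
  fixes A :: "('a::{second_countable_topology,t2_space}, 'e::real_inner) atlas"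
  assumes M: "smooth_manifold A" and v: "v \<in> tangent_space A p"
    and f: "f \<in> smooth_functions A" and g: "g \<in> smooth_functions A"
    and N: "open N" "p \<in> N" "\<And>q. q \<in> N \<Longrightarrow> f q = g q"
  shows "v f = v g"
proof -
  let ?d = "\<lambda>q. 1 * f q + (- 1) * g q"
  have d: "?d \<in> smooth_functions A"
    using smooth_functions_diff[OF M f g] by simp
  obtain \<eta> N' K where \<eta>: "\<eta> \<in> smooth_functions A" "open N'" "p \<in> N'" "N' \<subseteq> K"
    "\<And>q. q \<in> N' \<Longrightarrow> \<eta> q = 1" "closed K" "K \<subseteq> N" "\<And>q. q \<notin> K \<Longrightarrow> \<eta> q = 0"
    using bump_function[OF M N(1,2)] by blast
  have "(\<lambda>q. \<eta> q * ?d q) = (\<lambda>q. 0)"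
  proof
    fix q show "\<eta> q * ?d q = 0"
      using \<eta>(7,8) N(3) by (cases "q \<in> K") auto
  qed
  then have "v (\<lambda>q. \<eta> q * ?d q) = 0"
    using tangent_const[OF M v, of 0] by simp
  moreover have "?d p = 0" using N(2,3) by simp
  ultimately have "v ?d = 0"
    using tangent_mult[OF v \<eta>(1) d] \<eta>(3,5) by simp
  then show ?thesis using tangent_comb[OF v f g, of 1 "- 1"] by simp
qed

lemma vector_field_tangent: "X \<in> vector_fields A \<Longrightarrow> X p \<in> tangent_space A p"
  by (simp add: vector_fields_def)

lemma vector_field_smooth:
  "X \<in> vector_fields A \<Longrightarrow> f \<in> smooth_functions A \<Longrightarrow> (\<lambda>p. X p f) \<in> smooth_functions A"
  by (simp add: vector_fields_def)

lemma vector_fields_sum: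
  assumes "smooth_manifold A" "\<And>i. i \<in> I \<Longrightarrow> h i \<in> smooth_functions A"
    "\<And>i. i \<in> I \<Longrightarrow> X i \<in> vector_fields A"
  shows "(\<lambda>p f. \<Sum>i\<in>I. h i p * X i p f) \<in> vector_fields A"
  unfolding vector_fields_def mem_Collect_eq
proof (intro conjI allI ballI)
  show "(\<lambda>f. \<Sum>i\<in>I. h i p * X i p f) \<in> tangent_space A p" for p
    using assms(3) by (intro tangent_space_sum vector_field_tangent)
  show "(\<lambda>p. \<Sum>i\<in>I. h i p * X i p f) \<in> smooth_functions A" if "f \<in> smooth_functions A" for f
    by (rule smooth_functions_sum[OF assms(1) smooth_functions_mult[OF assms(1,2)
      vector_field_smooth[OF assms(3) that]]])
qed

text \<open>Global smooth functions \<open>x c\<close> and global vector fields \<open>D c\<close> that on the open set \<open>N\<close> are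
  coordinates and the coordinate vector fields: there they are dual to each other, and every
  derivation is determined by its values on the coordinates. Having global objects avoids any
  further mention of charts.\<close>

definition local_frame ::
    "('a::topological_space, 'e::real_inner) atlas \<Rightarrow> 'a set \<Rightarrow> 'e set \<Rightarrow>
     ('e \<Rightarrow> 'a \<Rightarrow> real) \<Rightarrow> ('e \<Rightarrow> 'a \<Rightarrow> 'a tangent) \<Rightarrow> bool" where
  "local_frame A N I x D \<longleftrightarrow> open N \<and> finite I \<and>
     (\<forall>c. x c \<in> smooth_functions A) \<and> (\<forall>c. D c \<in> vector_fields A) \<and>
     (\<forall>q\<in>N. \<forall>c\<in>I. \<forall>d\<in>I. D c q (x d) = (if c = d then 1 else 0)) \<and>
     (\<forall>q\<in>N. \<forall>v\<in>tangent_space A q. v = (\<lambda>f. \<Sum>c\<in>I. v (x c) * D c q f))"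

text \<open>A coordinate vector field is multiplied by a bump function to make it global.\<close>

definition chart_field ::
    "('a::topological_space, 'e::real_inner) atlas \<Rightarrow> 'a set \<Rightarrow> ('a \<Rightarrow> 'e) \<Rightarrow> ('a \<Rightarrow> real) \<Rightarrow>
     'e \<Rightarrow> 'a \<Rightarrow> 'a tangent" where
  "chart_field A U \<phi> \<eta> c q = (\<lambda>f. if f \<in> smooth_functions A \<and> q \<in> U
     then \<eta> q * frechet_derivative (\<lambda>y. f (inv_into U \<phi> y)) (at (\<phi> q)) c else 0)"

lemma chart_has_derivative:
  assumes "(U, \<phi>) \<in> A" "f \<in> smooth_functions A" "q \<in> U"
  shows "((\<lambda>y. f (inv_into U \<phi> y)) has_derivative
    frechet_derivative (\<lambda>y. f (inv_into U \<phi> y)) (at (\<phi> q))) (at (\<phi> q))"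
  using Ck_on_SucD(1)[OF smooth_functionsD[OF assms(2,1), of "Suc 0"]] assms(3) by blast

lemma smooth_at_chartI:
  assumes M: "smooth_manifold A" and U: "(U, \<phi>) \<in> A" and W: "open W" "q \<in> W" "W \<subseteq> U"
    and h: "\<And>k. Ck_on k (\<phi> ` W) h"
  shows "smooth_at A (\<lambda>z. h (\<phi> z)) q"
proof -
  have "Ck_on k (\<phi> ` W) ((\<lambda>z. h (\<phi> z)) \<circ> inv_into U \<phi>)" for k
    by (rule iffD1[OF Ck_on_cong[OF chart_open_image[OF M U W(1,3)]] h])
      (use chart_inv[OF M U] W(3) in auto)
  then have "smooth_on (\<phi> ` W) ((\<lambda>z. h (\<phi> z)) \<circ> inv_into U \<phi>)"
    unfolding smooth_on_def ..
  then show ?thesis unfolding smooth_at_def using U W by blast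
qed

lemma chart_field_vector_field:
  assumes M: "smooth_manifold A" and U: "(U, \<phi>) \<in> A"
    and \<eta>: "\<eta> \<in> smooth_functions A" "closed K" "K \<subseteq> U" "\<And>q. q \<notin> K \<Longrightarrow> \<eta> q = 0"
  shows "chart_field A U \<phi> \<eta> c \<in> vector_fields A"
  unfolding vector_fields_def mem_Collect_eq
proof (intro conjI allI ballI)
  fix q
  let ?F = "\<lambda>f y. f (inv_into U \<phi> y)"
  let ?D = "\<lambda>f. frechet_derivative (?F f) (at (\<phi> q))"
  show "chart_field A U \<phi> \<eta> c q \<in> tangent_space A q"
  proof (cases "q \<in> U")
    case True
    note D = chart_has_derivative[OF U _ True]
    have comb: "?D (\<lambda>x. a * f x + b * g x) = (\<lambda>w. a * ?D f w + b * ?D g w)"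
      if "f \<in> smooth_functions A" "g \<in> smooth_functions A" for f g a b
      by (rule frechet_derivative_at[symmetric])
        (intro has_derivative_add has_derivative_mult_right D that)
    have mult: "?D (\<lambda>x. f x * g x) = (\<lambda>w. f q * ?D g w + ?D f w * g q)"
      if "f \<in> smooth_functions A" "g \<in> smooth_functions A" for f g
      using has_derivative_mult[OF D[OF that(1)] D[OF that(2)]] chart_inv[OF M U True]
      by (intro frechet_derivative_at[symmetric]) simp
    have CC: "(\<lambda>x. a * f x + b * g x) \<in> smooth_functions A" "(\<lambda>x. f x * g x) \<in> smooth_functions A"
      if "f \<in> smooth_functions A" "g \<in> smooth_functions A" for f g a b
      by (intro smooth_functions_add smooth_functions_mult smooth_functions_const M that)+
    show ?thesis
      using True unfolding tangent_space_def linear_functional_on_def chart_field_def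
      by (simp add: CC comb mult) (simp add: algebra_simps)
  qed (simp add: chart_field_def tangent_space_zero)
next
  fix f assume f: "f \<in> smooth_functions A"
  let ?h = "\<lambda>y. frechet_derivative (\<lambda>y. f (inv_into U \<phi> y)) (at y) c"
  have "Ck_on k (\<phi> ` U) ?h" for k
    by (rule Ck_on_SucD(2)[OF smooth_functionsD[OF f U]])
  then have "(\<lambda>q. \<eta> q * ?h (\<phi> q)) \<in> smooth_functions A"
    using \<eta>(3,4) chart_homeomorphism(1)[OF M U]
    by (intro smooth_functions_cut_off[OF M \<eta>(1,2)] smooth_at_chartI[OF M U, of U]) auto
  moreover have "(\<lambda>q. \<eta> q * ?h (\<phi> q)) = (\<lambda>q. chart_field A U \<phi> \<eta> c q f)"
    using \<eta>(3,4) f by (auto simp: chart_field_def fun_eq_iff)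
  ultimately show "(\<lambda>q. chart_field A U \<phi> \<eta> c q f) \<in> smooth_functions A" by simp
qed

text \<open>Near \<open>q\<close>, Hadamard's lemma gives \<open>f = f(q) + \<Sum>\<^sub>c (x\<^sub>c - x\<^sub>c(q)) h\<^sub>c\<close> with smooth \<open>h\<^sub>c\<close>, so a
  derivation at \<open>q\<close> maps \<open>f\<close> to \<open>\<Sum>\<^sub>c v(x\<^sub>c) h\<^sub>c(q)\<close>.\<close>

lemma derivation_expansion:
  fixes A :: "('a::{second_countable_topology,t2_space}, 'e::real_inner) atlas"
  assumes M: "smooth_manifold A" and I: "orthonormal_basis (I :: 'e set)" and U: "(U, \<phi>) \<in> A"
    and N: "open N" "N \<subseteq> U" "q \<in> N"
    and x: "\<And>c. x c \<in> smooth_functions A" "\<And>c z. z \<in> N \<Longrightarrow> x c z = \<phi> z \<bullet> c"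
    and v: "v \<in> tangent_space A q" and f: "f \<in> smooth_functions A"
  shows "v f = (\<Sum>c\<in>I. v (x c) * frechet_derivative (\<lambda>y. f (inv_into U \<phi> y)) (at (\<phi> q)) c)"
proof -
  let ?F = "\<lambda>y. f (inv_into U \<phi> y)"
  have "open (\<phi> ` N)" "\<phi> q \<in> \<phi> ` N" using N by (auto intro: chart_open_image[OF M U])
  then obtain r where r: "r > 0" "ball (\<phi> q) r \<subseteq> \<phi> ` N"
    using open_contains_ball by blast
  have "smooth_on (ball (\<phi> q) r) ?F"
    unfolding smooth_on_def
  proof
    fix k show "Ck_on k (ball (\<phi> q) r) ?F"
      by (rule Ck_on_subset[OF smooth_functionsD[OF f U]]) (use r N in auto)
  qed
  from hadamard[OF I this r(1)] obtain h where
    h: "\<And>c. smooth_on (ball (\<phi> q) r) (h c)" "\<And>c. h c (\<phi> q) = frechet_derivative ?F (at (\<phi> q)) c"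
      "\<And>y. y \<in> ball (\<phi> q) r \<Longrightarrow> ?F y = ?F (\<phi> q) + (\<Sum>c\<in>I. ((y - \<phi> q) \<bullet> c) * h c y)"
    by blast
  define W where "W = U \<inter> \<phi> -` ball (\<phi> q) r"
  have W: "open W" "q \<in> W" "W \<subseteq> U"
    unfolding W_def using r(1) N by (auto intro: chart_open_preimage[OF M U])
  have WN: "z \<in> N" if z: "z \<in> W" for z
  proof -
    obtain z' where "z' \<in> N" "\<phi> z = \<phi> z'" using z r(2) unfolding W_def by blast
    then show ?thesis using chart_inv[OF M U] z N(2) unfolding W_def by (metis IntE subsetD)
  qed
  obtain \<eta> N' K where \<eta>: "\<eta> \<in> smooth_functions A" "open N'" "q \<in> N'" "N' \<subseteq> K"
    "\<And>z. z \<in> N' \<Longrightarrow> \<eta> z = 1" "closed K" "K \<subseteq> W" "\<And>z. z \<notin> K \<Longrightarrow> \<eta> z = 0"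
    using bump_function[OF M W(1,2)] by blast
  define H where "H = (\<lambda>c z. \<eta> z * h c (\<phi> z))"
  have "Ck_on k (\<phi> ` W) (h c)" for k c
    by (rule Ck_on_subset[of k "ball (\<phi> q) r"]) (use h(1) in \<open>auto simp: smooth_on_def W_def\<close>)
  then have H: "H c \<in> smooth_functions A" for c
    unfolding H_def using \<eta>(7,8) W
    by (intro smooth_functions_cut_off[OF M \<eta>(1,6)] smooth_at_chartI[OF M U W(1)]) auto
  let ?x = "\<lambda>c z. x c z - x c q"
  have xC: "?x c \<in> smooth_functions A" for c
    by (intro smooth_functions_diff[OF M] x smooth_functions_const[OF M])
  let ?S = "\<lambda>z. \<Sum>c\<in>I. ?x c z * H c z"
  have SC: "?S \<in> smooth_functions A"
    by (intro smooth_functions_sum smooth_functions_mult M xC H)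
  have eq: "f z = f q + ?S z" if z: "z \<in> N'" for z
  proof -
    have zW: "z \<in> W" using z \<eta>(4,7) by blast
    have "?F (\<phi> z) = ?F (\<phi> q) + (\<Sum>c\<in>I. ((\<phi> z - \<phi> q) \<bullet> c) * h c (\<phi> z))"
      using zW by (intro h(3)) (simp add: W_def)
    moreover have "?F (\<phi> z) = f z" "?F (\<phi> q) = f q"
      using chart_inv[OF M U] zW W N by auto
    ultimately show ?thesis
      using x(2)[OF WN[OF zW]] x(2)[OF N(3)] \<eta>(5)[OF z] by (simp add: H_def inner_diff_left)
  qed
  have "v (?x c) = v (x c)" for c
    using tangent_comb[OF v x(1) smooth_functions_const[OF M], of 1 c "-1" "x c q"]
      tangent_const[OF M v] by simp
  then have vS: "v (\<lambda>z. ?x c z * H c z) = v (x c) * H c q" for c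
    using tangent_mult[OF v xC H] by simp
  have "v f = v (\<lambda>z. f q + ?S z)"
    using tangent_local[OF M v f smooth_functions_add[OF M smooth_functions_const[OF M] SC] \<eta>(2,3) eq] .
  also have "\<dots> = v ?S"
    using tangent_add[OF v smooth_functions_const[OF M] SC] tangent_const[OF M v] by simp
  also have "\<dots> = (\<Sum>c\<in>I. v (x c) * H c q)"
    using tangent_sum[OF M v, of I "\<lambda>c z. ?x c z * H c z"] smooth_functions_mult[OF M xC H] vS by simp
  also have "\<dots> = (\<Sum>c\<in>I. v (x c) * frechet_derivative ?F (at (\<phi> q)) c)"
    using \<eta>(3,5) h(2) by (simp add: H_def)
  finally show ?thesis .
qed

lemma local_frame_exists:
  fixes A :: "('a::{second_countable_topology,t2_space}, 'e::real_inner) atlas"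
  assumes M: "smooth_manifold A"
  obtains N I x D where "local_frame A N I x D" "p \<in> N"
proof -
  obtain I :: "'e set" where I: "orthonormal_basis I" using smooth_manifold_basis[OF M] .
  obtain U \<phi> where U: "(U, \<phi>) \<in> A" "p \<in> U" using chart_exists[OF M] .
  have oU: "open U" using chart_homeomorphism(1)[OF M U(1)] .
  obtain \<eta> N K where \<eta>: "\<eta> \<in> smooth_functions A" "open N" "p \<in> N" "N \<subseteq> K"
    "\<And>z. z \<in> N \<Longrightarrow> \<eta> z = 1" "closed K" "K \<subseteq> U" "\<And>z. z \<notin> K \<Longrightarrow> \<eta> z = 0"
    using bump_function[OF M oU U(2)] by blast
  define x where "x = (\<lambda>c q. \<eta> q * (\<phi> q \<bullet> c))"
  have "Ck_on k (\<phi> ` U) (\<lambda>y. y \<bullet> c)" for k c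
    by (intro Ck_on_bounded_linear[OF _ Ck_on_ident bounded_linear_inner_left]
        chart_homeomorphism(2)[OF M U(1)])
  then have x: "x c \<in> smooth_functions A" for c
    unfolding x_def using \<eta>(7,8) oU
    by (intro smooth_functions_cut_off[OF M \<eta>(1,6)] smooth_at_chartI[OF M U(1), of U]) auto
  have xN: "x c z = \<phi> z \<bullet> c" if "z \<in> N" for c z
    using \<eta>(5)[OF that] by (simp add: x_def)
  have NU: "N \<subseteq> U" using \<eta>(4,7) by blast
  let ?D = "chart_field A U \<phi> \<eta>"
  have D: "?D c \<in> vector_fields A" for c
    by (rule chart_field_vector_field[OF M U(1) \<eta>(1,6,7,8)])
  have dual: "?D c q (x d) = (if c = d then 1 else 0)" if "q \<in> N" "c \<in> I" "d \<in> I" for q c d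
  proof -
    have "((\<lambda>y. x d (inv_into U \<phi> y)) has_derivative (\<lambda>w. w \<bullet> d)) (at (\<phi> q))"
    proof (rule has_derivative_transform_within_open)
      show "((\<lambda>y. y \<bullet> d) has_derivative (\<lambda>w. w \<bullet> d)) (at (\<phi> q))"
        by (intro derivative_eq_intros) auto
      show "open (\<phi> ` N)" "\<phi> q \<in> \<phi> ` N"
        using \<eta>(2) NU that by (auto intro: chart_open_image[OF M U(1)])
      show "y \<bullet> d = x d (inv_into U \<phi> y)" if "y \<in> \<phi> ` N" for y
        using that xN chart_inv[OF M U(1)] NU by auto
    qed
    from frechet_derivative_at[OF this, symmetric] show ?thesis
      using I x that NU \<eta>(5) by (auto simp: chart_field_def orthonormal_basis_def)
  qed
  have "v f = (\<Sum>c\<in>I. v (x c) * ?D c q f)" if q: "q \<in> N" and v: "v \<in> tangent_space A q" for q v f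
  proof (cases "f \<in> smooth_functions A")
    case True
    then show ?thesis
      using derivation_expansion[OF M I U(1) \<eta>(2) NU q x xN v True] q NU \<eta>(5)
      by (auto simp: chart_field_def)
  qed (simp add: chart_field_def tangent_outside[OF v])
  then have "local_frame A N I x ?D"
    unfolding local_frame_def using \<eta>(2) I x D dual by (auto simp: orthonormal_basis_def)
  then show ?thesis using that \<eta>(3) by blast
qed

section \<open>Covectors and one-forms\<close>

lemma tangent_extension:
  fixes A :: "('a::{second_countable_topology,t2_space}, 'e::real_inner) atlas"
  assumes M: "smooth_manifold A" and v: "v \<in> tangent_space A p"
  obtains X where "X \<in> vector_fields A" "X p = v"
proof -
  obtain N I x D where fr: "local_frame A N I x D" "p \<in> N"
    using local_frame_exists[OF M] .
  let ?X = "\<lambda>q f. \<Sum>c\<in>I. v (x c) * D c q f"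
  have "?X \<in> vector_fields A"
    using fr(1) by (intro vector_fields_sum[OF M smooth_functions_const[OF M]]) (simp add: local_frame_def)
  moreover have "?X p = v" using fr v by (simp add: local_frame_def)
  ultimately show ?thesis using that by blast
qed

lemma cotangent_linear: "\<xi> \<in> cotangent_space A p \<Longrightarrow> linear_functional_on (tangent_space A p) \<xi>"
  by (simp add: cotangent_space_def)

lemma cotangent_eqI:
  assumes "\<xi> \<in> cotangent_space A p" "\<eta> \<in> cotangent_space A p"
    and "\<And>v. v \<in> tangent_space A p \<Longrightarrow> \<xi> v = \<eta> v"
  shows "\<xi> = \<eta>"
proof
  fix v show "\<xi> v = \<eta> v"
    using assms by (cases "v \<in> tangent_space A p") (simp_all add: cotangent_space_def)
qed

lemma function_subspace_cotangent: "function_subspace (cotangent_space A p)"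
  unfolding function_subspace_def cotangent_space_def linear_functional_on_def
  by (simp add: algebra_simps)

lemmas cotangent_space_sum = function_subspace_sum[OF function_subspace_cotangent]

lemma differential_cotangent: "differential A f p \<in> cotangent_space A p"
  by (simp add: cotangent_space_def linear_functional_on_def differential_def tangent_space_comb)

lemma differential_apply: "v \<in> tangent_space A p \<Longrightarrow> differential A f p v = v f"
  by (simp add: differential_def)

lemma differential_one_form: "f \<in> smooth_functions A \<Longrightarrow> differential A f \<in> one_forms A"
  by (simp add: one_forms_def differential_cotangent differential_apply vector_field_tangent
      vector_field_smooth)

lemma one_form_cotangent: "\<alpha> \<in> one_forms A \<Longrightarrow> \<alpha> p \<in> cotangent_space A p"
  by (simp add: one_forms_def)

lemma one_form_smooth:
  "\<alpha> \<in> one_forms A \<Longrightarrow> X \<in> vector_fields A \<Longrightarrow> (\<lambda>p. \<alpha> p (X p)) \<in> smooth_functions A"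
  by (simp add: one_forms_def)

lemma local_frame_tangent: "local_frame A N I x D \<Longrightarrow> D c q \<in> tangent_space A q"
  by (simp add: local_frame_def vector_field_tangent)

lemma tangent_frame_expansion:
  assumes "local_frame A N I x D" "q \<in> N" "v \<in> tangent_space A q"
  shows "v = (\<lambda>f. \<Sum>c\<in>I. v (x c) * D c q f)"
  using assms by (simp add: local_frame_def)

lemma functional_frame_expansion:
  assumes fr: "local_frame A N I x D" "q \<in> N" and l: "linear_functional_on (tangent_space A q) l"
    and v: "v \<in> tangent_space A q"
  shows "l v = (\<Sum>c\<in>I. v (x c) * l (D c q))"
proof -
  have "l v = l (\<lambda>f. \<Sum>c\<in>I. v (x c) * D c q f)"
    using tangent_frame_expansion[OF fr v] by (rule arg_cong)
  also have "\<dots> = (\<Sum>c\<in>I. v (x c) * l (D c q))"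
    by (rule linear_functional_on_sum[OF l function_subspace_tangent local_frame_tangent[OF fr(1)]])
  finally show ?thesis .
qed

lemma cotangent_frame_expansion:
  assumes fr: "local_frame A N I x D" "q \<in> N" and \<xi>: "\<xi> \<in> cotangent_space A q"
  shows "\<xi> = (\<lambda>v. \<Sum>c\<in>I. \<xi> (D c q) * differential A (x c) q v)"
proof (rule cotangent_eqI[OF \<xi>])
  show "(\<lambda>v. \<Sum>c\<in>I. \<xi> (D c q) * differential A (x c) q v) \<in> cotangent_space A q"
    by (rule cotangent_space_sum[OF differential_cotangent])
  show "\<xi> v = (\<Sum>c\<in>I. \<xi> (D c q) * differential A (x c) q v)" if "v \<in> tangent_space A q" for v
    using functional_frame_expansion[OF fr cotangent_linear[OF \<xi>] that]
    by (simp add: differential_apply[OF that] mult.commute)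
qed

lemma covector_functional_expansion:
  assumes fr: "local_frame A N I x D" "q \<in> N" and l: "linear_functional_on (cotangent_space A q) l"
    and \<xi>: "\<xi> \<in> cotangent_space A q"
  shows "l \<xi> = (\<Sum>c\<in>I. \<xi> (D c q) * l (differential A (x c) q))"
proof -
  have "l \<xi> = l (\<lambda>v. \<Sum>c\<in>I. \<xi> (D c q) * differential A (x c) q v)"
    using cotangent_frame_expansion[OF fr \<xi>] by (rule arg_cong)
  also have "\<dots> = (\<Sum>c\<in>I. \<xi> (D c q) * l (differential A (x c) q))"
    by (rule linear_functional_on_sum[OF l function_subspace_cotangent differential_cotangent])
  finally show ?thesis .
qed

section \<open>The anchor\<close>

lemma bivector_linear:
  assumes "bivector_field A \<pi>" "\<xi> \<in> cotangent_space A p"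
  shows "linear_functional_on (cotangent_space A p) (\<pi> p \<xi>)"
    and "linear_functional_on (cotangent_space A p) (\<lambda>\<eta>. \<pi> p \<eta> \<xi>)"
  using assms by (simp_all add: bivector_field_def bilinear_form_on_def)

lemma bivector_skew:
  "bivector_field A \<pi> \<Longrightarrow> \<xi> \<in> cotangent_space A p \<Longrightarrow> \<eta> \<in> cotangent_space A p \<Longrightarrow> \<pi> p \<xi> \<eta> = - \<pi> p \<eta> \<xi>"
  unfolding bivector_field_def by blast

lemma bivector_smooth:
  "bivector_field A \<pi> \<Longrightarrow> \<alpha> \<in> one_forms A \<Longrightarrow> \<beta> \<in> one_forms A \<Longrightarrow>
    (\<lambda>p. \<pi> p (\<alpha> p) (\<beta> p)) \<in> smooth_functions A"
  by (simp add: bivector_field_def)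

text \<open>The anchor exists because tangent spaces are finite-dimensional: the functional \<open>\<pi> p \<xi>\<close> on
  covectors is evaluation at the vector with components \<open>\<pi> p \<xi> dx\<^sub>c\<close>.\<close>

lemma sharp_tangent_apply:
  fixes A :: "('a::{second_countable_topology,t2_space}, 'e::real_inner) atlas"
  assumes M: "smooth_manifold A" and \<pi>: "bivector_field A \<pi>" and \<xi>: "\<xi> \<in> cotangent_space A p"
  shows "sharp A \<pi> p \<xi> \<in> tangent_space A p"
    and "\<eta> \<in> cotangent_space A p \<Longrightarrow> \<eta> (sharp A \<pi> p \<xi>) = \<pi> p \<xi> \<eta>"
proof -
  obtain N I x D where fr: "local_frame A N I x D" "p \<in> N"
    using local_frame_exists[OF M] .
  let ?P = "\<lambda>v. v \<in> tangent_space A p \<and> (\<forall>\<eta>\<in>cotangent_space A p. \<eta> v = \<pi> p \<xi> \<eta>)"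
  let ?v = "\<lambda>f. \<Sum>c\<in>I. \<pi> p \<xi> (differential A (x c) p) * D c p f"
  have v: "?P ?v"
  proof (intro conjI ballI)
    show "?v \<in> tangent_space A p"
      by (rule tangent_space_sum[OF local_frame_tangent[OF fr(1)]])
    fix \<eta> assume \<eta>: "\<eta> \<in> cotangent_space A p"
    have "\<eta> ?v = (\<Sum>c\<in>I. \<pi> p \<xi> (differential A (x c) p) * \<eta> (D c p))"
      by (rule linear_functional_on_sum[OF cotangent_linear[OF \<eta>] function_subspace_tangent
          local_frame_tangent[OF fr(1)]])
    also have "\<dots> = \<pi> p \<xi> \<eta>"
      using covector_functional_expansion[OF fr bivector_linear(1)[OF \<pi> \<xi>] \<eta>]
      by (simp add: mult.commute)
    finally show "\<eta> ?v = \<pi> p \<xi> \<eta>" .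
  qed
  have "?P (sharp A \<pi> p \<xi>)"
    unfolding sharp_def
  proof (rule theI[of ?P, OF v])
    fix w assume w: "?P w"
    show "w = ?v"
    proof (rule tangent_eqI)
      show "w \<in> tangent_space A p" by (rule conjunct1[OF w])
      show "?v \<in> tangent_space A p" by (rule conjunct1[OF v])
      fix f
      have "differential A f p w = differential A f p ?v"
        using bspec[OF conjunct2[OF v] differential_cotangent[of A f p]]
          bspec[OF conjunct2[OF w] differential_cotangent[of A f p]] by (rule trans[OF _ sym, rotated])
      then show "w f = ?v f"
        unfolding differential_apply[OF conjunct1[OF v]] differential_apply[OF conjunct1[OF w]] .
    qed
  qed
  then show "sharp A \<pi> p \<xi> \<in> tangent_space A p"
    and "\<eta> \<in> cotangent_space A p \<Longrightarrow> \<eta> (sharp A \<pi> p \<xi>) = \<pi> p \<xi> \<eta>" by simp_all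
qed

lemma sharp_apply:
  fixes A :: "('a::{second_countable_topology,t2_space}, 'e::real_inner) atlas"
  assumes "smooth_manifold A" "bivector_field A \<pi>" "\<xi> \<in> cotangent_space A p"
  shows "sharp A \<pi> p \<xi> f = \<pi> p \<xi> (differential A f p)"
  using sharp_tangent_apply(2)[OF assms differential_cotangent[of A f p]]
  unfolding differential_apply[OF sharp_tangent_apply(1)[OF assms]] .

lemma sharp_eq_zero_iff:
  fixes A :: "('a::{second_countable_topology,t2_space}, 'e::real_inner) atlas"
  assumes M: "smooth_manifold A" and \<pi>: "bivector_field A \<pi>" and \<xi>: "\<xi> \<in> cotangent_space A p"
  shows "sharp A \<pi> p \<xi> = (\<lambda>f. 0) \<longleftrightarrow> (\<forall>g\<in>smooth_functions A. \<pi> p \<xi> (differential A g p) = 0)"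
proof
  assume "sharp A \<pi> p \<xi> = (\<lambda>f. 0)"
  then show "\<forall>g\<in>smooth_functions A. \<pi> p \<xi> (differential A g p) = 0"
    by (simp add: sharp_apply[OF assms, symmetric])
next
  assume "\<forall>g\<in>smooth_functions A. \<pi> p \<xi> (differential A g p) = 0"
  then show "sharp A \<pi> p \<xi> = (\<lambda>f. 0)"
    by (intro tangent_eqI[OF sharp_tangent_apply(1)[OF assms] tangent_space_zero])
      (simp add: sharp_apply[OF assms])
qed

lemma sharp_vector_field:
  fixes A :: "('a::{second_countable_topology,t2_space}, 'e::real_inner) atlas"
  assumes M: "smooth_manifold A" and \<pi>: "bivector_field A \<pi>" and \<alpha>: "\<alpha> \<in> one_forms A"
  shows "(\<lambda>q. sharp A \<pi> q (\<alpha> q)) \<in> vector_fields A"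
  unfolding vector_fields_def mem_Collect_eq
proof (intro conjI allI ballI)
  show "sharp A \<pi> q (\<alpha> q) \<in> tangent_space A q" for q
    by (rule sharp_tangent_apply(1)[OF M \<pi> one_form_cotangent[OF \<alpha>]])
  show "(\<lambda>q. sharp A \<pi> q (\<alpha> q) f) \<in> smooth_functions A" if "f \<in> smooth_functions A" for f
    unfolding sharp_apply[OF M \<pi> one_form_cotangent[OF \<alpha>]]
    by (rule bivector_smooth[OF \<pi> \<alpha> differential_one_form[OF that]])
qed

section \<open>Smooth solutions of linear systems and gradients\<close>

text \<open>Gaussian elimination over the ring of smooth functions: near \<open>p\<close> an entry that does not vanish
  at \<open>p\<close> is invertible and can serve as a pivot.\<close>

lemma solve_linear_system_smooth:
  fixes A :: "('a::{second_countable_topology,t2_space}, 'e::real_inner) atlas"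
    and m :: "'i \<Rightarrow> 'j \<Rightarrow> 'a \<Rightarrow> real"
  assumes M: "smooth_manifold A" and "finite J" "finite I" "card I = card J"
    and "\<And>i j. m i j \<in> smooth_functions A" "\<And>i. b i \<in> smooth_functions A"
    and "\<And>c j. \<forall>i\<in>I. (\<Sum>j\<in>J. m i j p * c j) = 0 \<Longrightarrow> j \<in> J \<Longrightarrow> c j = 0"
  shows "\<exists>u N. (\<forall>j. u j \<in> smooth_functions A) \<and> open N \<and> p \<in> N \<and>
    (\<forall>q\<in>N. \<forall>i\<in>I. (\<Sum>j\<in>J. m i j q * u j q) = b i q)"
  using assms(2-)
proof (induction J arbitrary: I m b rule: finite_induct)
  case empty
  then show ?case
    using smooth_functions_const[OF M, of 0] by (intro exI[of _ "\<lambda>j q. 0"] exI[of _ UNIV]) simp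
next
  case (insert l J)
  have "\<exists>k\<in>I. m k l p \<noteq> 0"
  proof (rule ccontr)
    assume "\<not> (\<exists>k\<in>I. m k l p \<noteq> 0)"
    then have "\<forall>i\<in>I. (\<Sum>j\<in>insert l J. m i j p * (if j = l then 1 else 0)) = 0"
      using insert.hyps by (simp add: sum.delta if_distrib[of "\<lambda>t. _ * t"] cong: if_cong)
    from insert.prems(5)[OF this, of l] show False by simp
  qed
  then obtain k where k: "k \<in> I" "m k l p \<noteq> 0" by blast
  obtain r N1 where r: "r \<in> smooth_functions A" "open N1" "p \<in> N1" "\<And>q. q \<in> N1 \<Longrightarrow> m k l q * r q = 1"
    using smooth_functions_local_inverse[OF M insert.prems(3) k(2)] by blast
  define m' where "m' = (\<lambda>i j q. m i j q - m i l q * r q * m k j q)"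
  define b' where "b' = (\<lambda>i q. b i q - m i l q * r q * b k q)"
  note C = smooth_functions_diff[OF M] smooth_functions_mult[OF M] insert.prems(3,4) r(1)
  have "\<exists>u N. (\<forall>j. u j \<in> smooth_functions A) \<and> open N \<and> p \<in> N \<and>
    (\<forall>q\<in>N. \<forall>i\<in>I - {k}. (\<Sum>j\<in>J. m' i j q * u j q) = b' i q)"
  proof (rule insert.IH)
    show "finite (I - {k})" "card (I - {k}) = card J"
      using insert.prems(1,2) insert.hyps k(1) by simp_all
    show "m' i j \<in> smooth_functions A" "b' i \<in> smooth_functions A" for i j
      unfolding m'_def b'_def by (intro C)+
    fix c j assume c: "\<forall>i\<in>I - {k}. (\<Sum>j\<in>J. m' i j p * c j) = 0" and j: "j \<in> J"
    let ?s = "\<lambda>i. \<Sum>j\<in>J. m i j p * c j"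
    define c' where "c' = c(l := - r p * ?s k)"
    have J: "(\<Sum>j\<in>J. m i j p * c' j) = ?s i" for i
      using insert.hyps by (intro sum.cong) (auto simp: c'_def)
    have tot: "(\<Sum>j\<in>insert l J. m i j p * c' j) = ?s i - m i l p * r p * ?s k" for i
      using insert.hyps by (simp add: J) (simp add: c'_def)
    have "(\<Sum>j\<in>insert l J. m i j p * c' j) = 0" if "i \<in> I" for i
    proof (cases "i = k")
      case True
      then show ?thesis using tot r(4)[OF r(3)] by simp
    next
      case False
      have "(\<Sum>j\<in>J. m' i j p * c j) = ?s i - m i l p * r p * ?s k"
        by (simp add: m'_def left_diff_distrib sum_subtractf sum_distrib_left mult.assoc)
      then show ?thesis using tot c that False by simp
    qed
    then have "c' j = 0" using insert.prems(5)[of c' j] j by simp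
    then show "c j = 0" using insert.hyps j by (auto simp: c'_def split: if_splits)
  qed
  then obtain u N where u: "\<And>j. u j \<in> smooth_functions A" and N: "open N" "p \<in> N"
    and sol: "\<And>q i. q \<in> N \<Longrightarrow> i \<in> I - {k} \<Longrightarrow> (\<Sum>j\<in>J. m' i j q * u j q) = b' i q" by blast
  define ul where "ul = (\<lambda>q. r q * (b k q - (\<Sum>j\<in>J. m k j q * u j q)))"
  define u' where "u' = u(l := ul)"
  have "ul \<in> smooth_functions A"
    unfolding ul_def by (intro C u smooth_functions_sum[OF M])
  then have "u' j \<in> smooth_functions A" for j by (simp add: u'_def u)
  moreover have "(\<Sum>j\<in>insert l J. m i j q * u' j q) = b i q" if q: "q \<in> N \<inter> N1" and i: "i \<in> I" for q i
  proof -
    let ?s = "\<lambda>i. \<Sum>j\<in>J. m i j q * u j q"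
    have J: "(\<Sum>j\<in>J. m i j q * u' j q) = ?s i"
      using insert.hyps by (intro sum.cong) (auto simp: u'_def)
    have tot: "(\<Sum>j\<in>insert l J. m i j q * u' j q) = m i l q * (r q * (b k q - ?s k)) + ?s i"
      using insert.hyps by (simp add: J) (simp add: u'_def ul_def)
    have piv: "m k l q * r q = 1" using r(4) q by blast
    show ?thesis
    proof (cases "i = k")
      case True
      have row: "m k l q * (r q * (b k q - ?s k)) = b k q - ?s k"
        by (simp only: mult.assoc[symmetric] piv mult_1)
      show ?thesis using tot unfolding True row by simp
    next
      case False
      have "(\<Sum>j\<in>J. m' i j q * u j q) = ?s i - m i l q * r q * ?s k"
        by (simp add: m'_def left_diff_distrib sum_subtractf sum_distrib_left mult.assoc)
      then show ?thesis
        using tot sol[of q i] q i False by (simp add: b'_def algebra_simps)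
    qed
  qed
  ultimately show ?case
    using N r(2,3) by (intro exI[of _ u'] exI[of _ "N \<inter> N1"]) auto
qed

lemma metric_linear:
  assumes "pseudo_riemannian_metric A G" "w \<in> tangent_space A p"
  shows "linear_functional_on (tangent_space A p) (G p w)"
    and "linear_functional_on (tangent_space A p) (\<lambda>v. G p v w)"
  using assms by (simp_all add: pseudo_riemannian_metric_def bilinear_form_on_def)

lemma metric_smooth:
  "pseudo_riemannian_metric A G \<Longrightarrow> X \<in> vector_fields A \<Longrightarrow> Y \<in> vector_fields A \<Longrightarrow>
    (\<lambda>p. G p (X p) (Y p)) \<in> smooth_functions A"
  by (simp add: pseudo_riemannian_metric_def)

lemma metric_cancel:
  assumes G: "pseudo_riemannian_metric A G" and u: "u \<in> tangent_space A p" and v: "v \<in> tangent_space A p"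
    and "\<And>w. w \<in> tangent_space A p \<Longrightarrow> G p u w = G p v w"
  shows "u = v"
proof -
  let ?d = "\<lambda>f. 1 * u f + (- 1) * v f"
  have d: "?d \<in> tangent_space A p" by (rule tangent_space_comb[OF u v])
  moreover have "G p ?d w = 0" if "w \<in> tangent_space A p" for w
    using linear_functional_onD[OF metric_linear(2)[OF G that] u v, of 1 "- 1"] assms(4)[OF that] by simp
  ultimately have "?d = (\<lambda>f. 0)"
    using G unfolding pseudo_riemannian_metric_def by blast
  then show ?thesis by (simp add: fun_eq_iff)
qed

lemma gradient_eqI:
  assumes G: "pseudo_riemannian_metric A G" and v: "v \<in> tangent_space A p"
    and "\<And>w. w \<in> tangent_space A p \<Longrightarrow> G p v w = w f"
  shows "gradient A G f p = v"
  unfolding gradient_def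
proof (rule the_equality)
  show "v \<in> tangent_space A p \<and> (\<forall>w\<in>tangent_space A p. G p v w = differential A f p w)"
    using assms by (simp add: differential_apply)
  show "u = v" if "u \<in> tangent_space A p \<and> (\<forall>w\<in>tangent_space A p. G p u w = differential A f p w)" for u
    using that assms by (intro metric_cancel[OF G, of u p v]) (auto simp: differential_apply)
qed

text \<open>The components of the gradient in a frame solve a linear system whose matrix, the Gram matrix of the
  frame, is nondegenerate at \<open>p\<close>. So near \<open>p\<close> they can be chosen smooth.\<close>

lemma gradient_locally:
  fixes A :: "('a::{second_countable_topology,t2_space}, 'e::real_inner) atlas"
  assumes M: "smooth_manifold A" and G: "pseudo_riemannian_metric A G" and f: "f \<in> smooth_functions A"
  obtains V N where "V \<in> vector_fields A" "open N" "p \<in> N"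
    "\<forall>q\<in>N. \<forall>w\<in>tangent_space A q. G q (V q) w = w f"
proof -
  obtain N I x D where fr: "local_frame A N I x D" "p \<in> N"
    using local_frame_exists[OF M] .
  note D = local_frame_tangent[OF fr(1)]
  have fin: "finite I" and N: "open N" and DX: "\<And>c. D c \<in> vector_fields A"
    and dual: "\<And>c d. c \<in> I \<Longrightarrow> d \<in> I \<Longrightarrow> D c p (x d) = (if c = d then 1 else 0)"
    using fr by (auto simp: local_frame_def)
  \<comment> \<open>A vector in the kernel of the Gram matrix is orthogonal to the whole tangent space.\<close>
  have nondeg: "c k = 0" if z: "\<forall>i\<in>I. (\<Sum>j\<in>I. G p (D j p) (D i p) * c j) = 0" and k: "k \<in> I" for c k
  proof -
    let ?v = "\<lambda>f. \<Sum>j\<in>I. c j * D j p f"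
    have v: "?v \<in> tangent_space A p" by (rule tangent_space_sum[OF D])
    have "G p ?v (D i p) = 0" if "i \<in> I" for i
      using linear_functional_on_sum[OF metric_linear(2)[OF G D[of i p]] function_subspace_tangent,
          of I "\<lambda>j. D j p" c] D
        z that by (simp add: mult.commute)
    then have "G p ?v w = G p (\<lambda>f. 0) w" if w: "w \<in> tangent_space A p" for w
      using functional_frame_expansion[OF fr metric_linear(1)[OF G v] w]
        linear_functional_on_zero[OF metric_linear(2)[OF G w] function_subspace_tangent] by simp
    then have "?v = (\<lambda>f. 0)" by (rule metric_cancel[OF G v tangent_space_zero])
    then have "?v (x k) = 0" by (rule fun_cong)
    then show ?thesis using dual k fin by (simp add: if_distrib[of "\<lambda>t. _ * t"] cong: if_cong)
  qed
  have "\<exists>u N. (\<forall>j. u j \<in> smooth_functions A) \<and> open N \<and> p \<in> N \<and>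
      (\<forall>q\<in>N. \<forall>i\<in>I. (\<Sum>j\<in>I. G q (D j q) (D i q) * u j q) = D i q f)"
  proof (rule solve_linear_system_smooth[OF M fin fin refl])
    show "(\<lambda>q. G q (D j q) (D i q)) \<in> smooth_functions A" for i j
      by (rule metric_smooth[OF G DX DX])
    show "(\<lambda>q. D i q f) \<in> smooth_functions A" for i
      by (rule vector_field_smooth[OF DX f])
  qed (rule nondeg)
  then obtain u N' where uN: "(\<forall>j. u j \<in> smooth_functions A) \<and> open N' \<and> p \<in> N' \<and>
      (\<forall>q\<in>N'. \<forall>i\<in>I. (\<Sum>j\<in>I. G q (D j q) (D i q) * u j q) = D i q f)"
    by (elim exE)
  then have u: "u j \<in> smooth_functions A" and N': "open N'" "p \<in> N'"
    and sol: "q \<in> N' \<Longrightarrow> i \<in> I \<Longrightarrow> (\<Sum>j\<in>I. G q (D j q) (D i q) * u j q) = D i q f" for j q i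
    by simp_all
  let ?V = "\<lambda>q g. \<Sum>j\<in>I. u j q * D j q g"
  have V: "?V \<in> vector_fields A" by (rule vector_fields_sum[OF M u DX])
  have VG: "G q (?V q) w = w f" if q: "q \<in> N \<inter> N'" and w: "w \<in> tangent_space A q" for q w
  proof -
    have qN: "q \<in> N" using q by blast
    have "G q (?V q) (D i q) = D i q f" if "i \<in> I" for i
      using linear_functional_on_sum[OF metric_linear(2)[OF G D[of i q]] function_subspace_tangent,
          of I "\<lambda>j. D j q" "\<lambda>j. u j q"] D
        sol[of q i] that q by (simp add: mult.commute)
    then have "G q (?V q) w = (\<Sum>i\<in>I. w (x i) * D i q f)"
      using functional_frame_expansion[OF fr(1) qN metric_linear(1)[OF G vector_field_tangent[OF V]] w] by simp
    also have "\<dots> = w f"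
      using fun_cong[OF tangent_frame_expansion[OF fr(1) qN w], of f] by simp
    finally show ?thesis .
  qed
  show ?thesis by (rule that[of ?V "N \<inter> N'", OF V]) (use N N' fr(2) VG in auto)
qed

lemma gradient_tangent_apply:
  fixes A :: "('a::{second_countable_topology,t2_space}, 'e::real_inner) atlas"
  assumes M: "smooth_manifold A" and G: "pseudo_riemannian_metric A G" and f: "f \<in> smooth_functions A"
  shows "gradient A G f p \<in> tangent_space A p"
    and "w \<in> tangent_space A p \<Longrightarrow> G p (gradient A G f p) w = w f"
proof -
  obtain V N where V: "V \<in> vector_fields A" "open N" "p \<in> N"
    "\<forall>q\<in>N. \<forall>w\<in>tangent_space A q. G q (V q) w = w f"
    using gradient_locally[OF M G f, of p] .
  note VT = vector_field_tangent[OF V(1), of p]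
  have VG: "G p (V p) w = w f" if "w \<in> tangent_space A p" for w
    using V(4)[rule_format, OF V(3) that] .
  have "gradient A G f p = V p"
    by (rule gradient_eqI[OF G VT]) (simp add: VG)
  then show "gradient A G f p \<in> tangent_space A p"
    and "w \<in> tangent_space A p \<Longrightarrow> G p (gradient A G f p) w = w f"
    by (simp_all add: VT VG)
qed

lemma gradient_vector_field:
  fixes A :: "('a::{second_countable_topology,t2_space}, 'e::real_inner) atlas"
  assumes M: "smooth_manifold A" and G: "pseudo_riemannian_metric A G" and f: "f \<in> smooth_functions A"
  shows "gradient A G f \<in> vector_fields A"
  unfolding vector_fields_def mem_Collect_eq
proof (intro conjI allI ballI)
  show "gradient A G f p \<in> tangent_space A p" for p
    by (rule gradient_tangent_apply(1)[OF assms])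
  fix g assume g: "g \<in> smooth_functions A"
  show "(\<lambda>p. gradient A G f p g) \<in> smooth_functions A"
  proof (rule smooth_functions_local[OF M])
    fix p
    obtain V N where V: "V \<in> vector_fields A" "open N" "p \<in> N"
      "\<forall>q\<in>N. \<forall>w\<in>tangent_space A q. G q (V q) w = w f"
      using gradient_locally[OF M G f, of p] .
    have "gradient A G f q = V q" if "q \<in> N" for q
      using V(4) that by (intro gradient_eqI[OF G vector_field_tangent[OF V(1)]]) simp
    then show "\<exists>h\<in>smooth_functions A. \<exists>N. open N \<and> p \<in> N \<and> (\<forall>q\<in>N. h q = gradient A G f q g)"
      using V(2,3) by (intro bexI[OF _ vector_field_smooth[OF V(1) g]] exI[of _ N]) auto
  qed
qed

section \<open>Lie derivatives\<close>

lemma vector_field_second_derivative_mult: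
  assumes M: "smooth_manifold A" and X: "X \<in> vector_fields A" and Y: "Y \<in> vector_fields A"
    and f: "f \<in> smooth_functions A" and g: "g \<in> smooth_functions A"
  shows "X p (\<lambda>q. Y q (\<lambda>x. f x * g x)) =
    f p * X p (\<lambda>q. Y q g) + Y p g * X p f + (g p * X p (\<lambda>q. Y q f) + Y p f * X p g)"
proof -
  have eq: "(\<lambda>q. Y q (\<lambda>x. f x * g x)) = (\<lambda>q. f q * Y q g + g q * Y q f)"
    by (rule ext) (rule tangent_mult[OF vector_field_tangent[OF Y] f g])
  note Yf = vector_field_smooth[OF Y f] and Yg = vector_field_smooth[OF Y g]
  note XT = vector_field_tangent[OF X, of p]
  show ?thesis
    unfolding eq
      tangent_add[OF XT smooth_functions_mult[OF M f Yg] smooth_functions_mult[OF M g Yf]]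
      tangent_mult[OF XT f Yg] tangent_mult[OF XT g Yf] by simp
qed

lemma vector_field_second_derivative_comb:
  assumes X: "X \<in> vector_fields A" and Y: "Y \<in> vector_fields A"
    and f: "f \<in> smooth_functions A" and g: "g \<in> smooth_functions A"
  shows "X p (\<lambda>q. Y q (\<lambda>x. a * f x + b * g x)) = a * X p (\<lambda>q. Y q f) + b * X p (\<lambda>q. Y q g)"
proof -
  have eq: "(\<lambda>q. Y q (\<lambda>x. a * f x + b * g x)) = (\<lambda>q. a * Y q f + b * Y q g)"
    by (rule ext) (rule tangent_comb[OF vector_field_tangent[OF Y] f g])
  show ?thesis
    unfolding eq
    by (rule tangent_comb[OF vector_field_tangent[OF X] vector_field_smooth[OF Y f] vector_field_smooth[OF Y g]])
qed

lemma lie_bracket_vector_field: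
  assumes M: "smooth_manifold A" and X: "X \<in> vector_fields A" and Y: "Y \<in> vector_fields A"
  shows "lie_bracket X Y \<in> vector_fields A"
  unfolding vector_fields_def mem_Collect_eq
proof (intro conjI allI ballI)
  fix p
  show "lie_bracket X Y p \<in> tangent_space A p"
    unfolding tangent_space_def mem_Collect_eq linear_functional_on_def
  proof (intro conjI ballI allI impI)
    fix f g a b assume f: "f \<in> smooth_functions A" and g: "g \<in> smooth_functions A"
    show "lie_bracket X Y p (\<lambda>x. a * f x + b * g x) = a * lie_bracket X Y p f + b * lie_bracket X Y p g"
      unfolding lie_bracket_def vector_field_second_derivative_comb[OF X Y f g]
        vector_field_second_derivative_comb[OF Y X f g] by (simp add: algebra_simps)
    show "lie_bracket X Y p (\<lambda>x. f x * g x) = f p * lie_bracket X Y p g + g p * lie_bracket X Y p f"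
      unfolding lie_bracket_def vector_field_second_derivative_mult[OF M X Y f g]
        vector_field_second_derivative_mult[OF M Y X f g] by (simp add: algebra_simps)
  next
    fix f assume "f \<notin> smooth_functions A"
    then have "(\<lambda>q. X q f) = (\<lambda>q. 0)" "(\<lambda>q. Y q f) = (\<lambda>q. 0)"
      using tangent_outside vector_field_tangent[OF X] vector_field_tangent[OF Y] by blast+
    then show "lie_bracket X Y p f = 0"
      unfolding lie_bracket_def
      by (simp add: tangent_const[OF M vector_field_tangent[OF X]]
          tangent_const[OF M vector_field_tangent[OF Y]])
  qed
next
  fix f assume f: "f \<in> smooth_functions A"
  show "(\<lambda>p. lie_bracket X Y p f) \<in> smooth_functions A"
    unfolding lie_bracket_def
    by (rule smooth_functions_diff[OF M vector_field_smooth[OF X vector_field_smooth[OF Y f]]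
          vector_field_smooth[OF Y vector_field_smooth[OF X f]]])
qed

text \<open>Every tangent vector is a value of a vector field, so the identity that defines the Lie
  derivative of a form has at most one solution.\<close>

lemma lie_form_eqI:
  fixes A :: "('a::{second_countable_topology,t2_space}, 'e::real_inner) atlas"
  assumes M: "smooth_manifold A" and \<gamma>: "\<gamma> \<in> one_forms A"
    and eq: "\<And>Y p. Y \<in> vector_fields A \<Longrightarrow>
      \<gamma> p (Y p) = X p (\<lambda>q. \<beta> q (Y q)) - \<beta> p (lie_bracket X Y p)"
  shows "lie_form A X \<beta> = \<gamma>"
  unfolding lie_form_def
proof (rule the_equality)
  show "\<gamma> \<in> one_forms A \<and> (\<forall>Y\<in>vector_fields A. \<forall>p.
      \<gamma> p (Y p) = X p (\<lambda>q. \<beta> q (Y q)) - \<beta> p (lie_bracket X Y p))"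
    using \<gamma> eq by simp
  fix \<delta> assume \<delta>: "\<delta> \<in> one_forms A \<and> (\<forall>Y\<in>vector_fields A. \<forall>p.
      \<delta> p (Y p) = X p (\<lambda>q. \<beta> q (Y q)) - \<beta> p (lie_bracket X Y p))"
  show "\<delta> = \<gamma>"
  proof
    fix p
    show "\<delta> p = \<gamma> p"
    proof (rule cotangent_eqI)
      show "\<delta> p \<in> cotangent_space A p" using \<delta> by (simp add: one_form_cotangent)
      show "\<gamma> p \<in> cotangent_space A p" using \<gamma> by (simp add: one_form_cotangent)
      fix v assume "v \<in> tangent_space A p"
      then obtain Y where Y: "Y \<in> vector_fields A" "Y p = v"
        using tangent_extension[OF M] by blast
      have "\<delta> p (Y p) = \<gamma> p (Y p)" using \<delta> eq[OF Y(1)] Y(1) by simp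
      then show "\<delta> p v = \<gamma> p v" by (simp add: Y(2))
    qed
  qed
qed

lemma lie_form_differential:
  fixes A :: "('a::{second_countable_topology,t2_space}, 'e::real_inner) atlas"
  assumes M: "smooth_manifold A" and X: "X \<in> vector_fields A" and f: "f \<in> smooth_functions A"
  shows "lie_form A X (differential A f) = differential A (\<lambda>q. X q f)"
proof (rule lie_form_eqI[OF M differential_one_form[OF vector_field_smooth[OF X f]]])
  fix Y p assume Y: "Y \<in> vector_fields A"
  show "differential A (\<lambda>q. X q f) p (Y p) =
      X p (\<lambda>q. differential A f q (Y q)) - differential A f p (lie_bracket X Y p)"
    by (simp add: differential_apply[OF vector_field_tangent[OF Y]]
        differential_apply[OF vector_field_tangent[OF lie_bracket_vector_field[OF M X Y]]])
      (simp add: lie_bracket_def)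
qed

text \<open>The Leibniz rule \<open>L\<^sub>X(h dx) = X(h) dx + h d(Xx)\<close>, summed over a local frame. The factors \<open>1\<close> make
  it literally a linear combination \<open>a u + b v\<close>, the form in which linearity of functionals is stated.\<close>

definition frame_lie_form ::
    "('a::topological_space, 'e::real_inner) atlas \<Rightarrow> 'e set \<Rightarrow> ('e \<Rightarrow> 'a \<Rightarrow> real) \<Rightarrow>
     ('e \<Rightarrow> 'a \<Rightarrow> 'a tangent) \<Rightarrow> ('a \<Rightarrow> 'a tangent) \<Rightarrow> ('a \<Rightarrow> 'a cotangent) \<Rightarrow> 'a \<Rightarrow> 'a cotangent" where
  "frame_lie_form A I x D X \<alpha> p = (\<lambda>v.
     1 * (\<Sum>c\<in>I. X p (\<lambda>q. \<alpha> q (D c q)) * differential A (x c) p v) +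
     1 * (\<Sum>c\<in>I. \<alpha> p (D c p) * differential A (\<lambda>q. X q (x c)) p v))"

lemma frame_lie_form_cotangent: "frame_lie_form A I x D X \<alpha> p \<in> cotangent_space A p"
  unfolding frame_lie_form_def
  by (rule function_subspaceD[OF function_subspace_cotangent
        cotangent_space_sum[OF differential_cotangent] cotangent_space_sum[OF differential_cotangent]])

lemma frame_lie_form_apply:
  fixes A :: "('a::{second_countable_topology,t2_space}, 'e::real_inner) atlas"
  assumes M: "smooth_manifold A" and fr: "local_frame A N I x D" "p \<in> N"
    and X: "X \<in> vector_fields A" and \<alpha>: "\<alpha> \<in> one_forms A" and Y: "Y \<in> vector_fields A"
  shows "frame_lie_form A I x D X \<alpha> p (Y p) =
    X p (\<lambda>q. \<alpha> q (Y q)) - \<alpha> p (lie_bracket X Y p)"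
proof -
  have N: "open N" and xC: "\<And>c. x c \<in> smooth_functions A" and DX: "\<And>c. D c \<in> vector_fields A"
    using fr(1) by (simp_all add: local_frame_def)
  note XT = vector_field_tangent[OF X, of p]
  let ?h = "\<lambda>c q. \<alpha> q (D c q)"
  have h: "?h c \<in> smooth_functions A" for c by (rule one_form_smooth[OF \<alpha> DX])
  note Yx = vector_field_smooth[OF Y xC]
  have "X p (\<lambda>q. \<alpha> q (Y q)) = X p (\<lambda>q. \<Sum>c\<in>I. ?h c q * Y q (x c))"
  proof (rule tangent_local[OF M XT one_form_smooth[OF \<alpha> Y] _ N fr(2)])
    show "(\<lambda>q. \<Sum>c\<in>I. ?h c q * Y q (x c)) \<in> smooth_functions A"
      by (rule smooth_functions_sum[OF M smooth_functions_mult[OF M h Yx]])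
    show "\<alpha> q (Y q) = (\<Sum>c\<in>I. ?h c q * Y q (x c))" if "q \<in> N" for q
      using functional_frame_expansion[OF fr(1) that cotangent_linear[OF one_form_cotangent[OF \<alpha>]]
          vector_field_tangent[OF Y]] by (simp add: mult.commute)
  qed
  also have "\<dots> = (\<Sum>c\<in>I. X p (\<lambda>q. ?h c q * Y q (x c)))"
    by (rule tangent_sum[OF M XT smooth_functions_mult[OF M h Yx]])
  also have "\<dots> = (\<Sum>c\<in>I. ?h c p * X p (\<lambda>q. Y q (x c)) + Y p (x c) * X p (?h c))"
    by (rule sum.cong[OF refl]) (rule tangent_mult[OF XT h Yx])
  finally have 1: "X p (\<lambda>q. \<alpha> q (Y q)) =
      (\<Sum>c\<in>I. ?h c p * X p (\<lambda>q. Y q (x c)) + Y p (x c) * X p (?h c))" .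
  have 2: "\<alpha> p (lie_bracket X Y p) =
      (\<Sum>c\<in>I. (X p (\<lambda>q. Y q (x c)) - Y p (\<lambda>q. X q (x c))) * ?h c p)"
    using functional_frame_expansion[OF fr cotangent_linear[OF one_form_cotangent[OF \<alpha>]]
        vector_field_tangent[OF lie_bracket_vector_field[OF M X Y]]]
    by (simp add: lie_bracket_def)
  show ?thesis
    unfolding 1 2 frame_lie_form_def differential_apply[OF vector_field_tangent[OF Y]]
    by (simp add: sum.distrib[symmetric] sum_subtractf[symmetric] algebra_simps)
qed

text \<open>The frame formula gives a covector at every point. Which frame is used does not matter, as the value on
  any vector field is prescribed, so these covectors form a one-form; smoothness is also read off from
  the prescribed values.\<close>

lemma lie_form_frame:
  fixes A :: "('a::{second_countable_topology,t2_space}, 'e::real_inner) atlas"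
  assumes M: "smooth_manifold A" and fr: "local_frame A N I x D" "p \<in> N"
    and X: "X \<in> vector_fields A" and \<alpha>: "\<alpha> \<in> one_forms A"
  shows "lie_form A X \<alpha> p = frame_lie_form A I x D X \<alpha> p"
proof -
  let ?R = "\<lambda>Y p. X p (\<lambda>q. \<alpha> q (Y q)) - \<alpha> p (lie_bracket X Y p)"
  have "\<exists>\<xi>. \<xi> \<in> cotangent_space A p \<and> (\<forall>Y\<in>vector_fields A. \<xi> (Y p) = ?R Y p)" for p
  proof -
    obtain N I x D where fr: "local_frame A N I x D" "p \<in> N"
      using local_frame_exists[OF M] .
    show ?thesis
      using frame_lie_form_cotangent frame_lie_form_apply[OF M fr X \<alpha>]
      by (intro exI[of _ "frame_lie_form A I x D X \<alpha> p"]) simp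
  qed
  then have "\<forall>p. \<exists>\<xi>. \<xi> \<in> cotangent_space A p \<and> (\<forall>Y\<in>vector_fields A. \<xi> (Y p) = ?R Y p)"
    by (rule allI)
  from choice[OF this] obtain \<gamma> where
    \<gamma>: "\<forall>p. \<gamma> p \<in> cotangent_space A p \<and> (\<forall>Y\<in>vector_fields A. \<gamma> p (Y p) = ?R Y p)" ..
  have "?R Y \<in> smooth_functions A" if Y: "Y \<in> vector_fields A" for Y
    by (rule smooth_functions_diff[OF M vector_field_smooth[OF X one_form_smooth[OF \<alpha> Y]]
          one_form_smooth[OF \<alpha> lie_bracket_vector_field[OF M X Y]]])
  then have "\<gamma> \<in> one_forms A"
    using \<gamma> by (simp add: one_forms_def)
  then have "lie_form A X \<alpha> = \<gamma>"
    by (rule lie_form_eqI[OF M]) (simp add: \<gamma>)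
  moreover have "\<gamma> p = frame_lie_form A I x D X \<alpha> p"
  proof (rule cotangent_eqI)
    show "\<gamma> p \<in> cotangent_space A p" using \<gamma> by simp
    show "frame_lie_form A I x D X \<alpha> p \<in> cotangent_space A p" by (rule frame_lie_form_cotangent)
    fix v assume "v \<in> tangent_space A p"
    then obtain Y where Y: "Y \<in> vector_fields A" "Y p = v"
      using tangent_extension[OF M] by blast
    have "\<gamma> p (Y p) = frame_lie_form A I x D X \<alpha> p (Y p)"
      using \<gamma> Y(1) frame_lie_form_apply[OF M fr X \<alpha> Y(1)] by simp
    then show "\<gamma> p v = frame_lie_form A I x D X \<alpha> p v" by (simp add: Y(2))
  qed
  ultimately show ?thesis by simp
qed

lemma poisson_bracket_smooth:
  assumes "bivector_field A \<pi>" "f \<in> smooth_functions A" "g \<in> smooth_functions A"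
  shows "poisson_bracket A \<pi> f g \<in> smooth_functions A"
  using bivector_smooth[OF assms(1) differential_one_form[OF assms(2)] differential_one_form[OF assms(3)]]
  by (simp add: poisson_bracket_def[abs_def])

lemma lie_bivector_differential:
  fixes A :: "('a::{second_countable_topology,t2_space}, 'e::real_inner) atlas"
  assumes "smooth_manifold A" "X \<in> vector_fields A" "f \<in> smooth_functions A" "g \<in> smooth_functions A"
  shows "lie_bivector A X \<pi> (differential A f) (differential A g) p =
    X p (poisson_bracket A \<pi> f g) - poisson_bracket A \<pi> (\<lambda>q. X q f) g p - poisson_bracket A \<pi> f (\<lambda>q. X q g) p"
  using assms by (simp add: lie_bivector_def lie_form_differential poisson_bracket_def[abs_def])

text \<open>The Lie derivative of a bivector is a tensor: at \<open>p\<close> it is determined by its values on the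
  differentials of coordinates.\<close>

lemma lie_bivector_frame:
  fixes A :: "('a::{second_countable_topology,t2_space}, 'e::real_inner) atlas"
  assumes M: "smooth_manifold A" and \<pi>: "bivector_field A \<pi>" and fr: "local_frame A N I x D" "p \<in> N"
    and X: "X \<in> vector_fields A" and \<alpha>: "\<alpha> \<in> one_forms A" and \<beta>: "\<beta> \<in> one_forms A"
  shows "lie_bivector A X \<pi> \<alpha> \<beta> p = (\<Sum>c\<in>I. \<Sum>d\<in>I. \<alpha> p (D c p) * \<beta> p (D d p) *
    lie_bivector A X \<pi> (differential A (x c)) (differential A (x d)) p)"
proof -
  have N: "open N" and xC: "\<And>c. x c \<in> smooth_functions A" and DX: "\<And>c. D c \<in> vector_fields A"
    using fr(1) by (simp_all add: local_frame_def)
  note XT = vector_field_tangent[OF X, of p]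
  let ?h = "\<lambda>c q. \<alpha> q (D c q)" and ?k = "\<lambda>c q. \<beta> q (D c q)"
  let ?P = "\<lambda>c d. poisson_bracket A \<pi> (x c) (x d)"
  have h: "?h c \<in> smooth_functions A" for c by (rule one_form_smooth[OF \<alpha> DX])
  have k: "?k c \<in> smooth_functions A" for c by (rule one_form_smooth[OF \<beta> DX])
  have P: "?P c d \<in> smooth_functions A" for c d by (rule poisson_bracket_smooth[OF \<pi> xC xC])
  have hk: "(\<lambda>q. ?h c q * ?k d q) \<in> smooth_functions A" for c d
    by (rule smooth_functions_mult[OF M h k])
  have hkP: "(\<lambda>q. ?h c q * ?k d q * ?P c d q) \<in> smooth_functions A" for c d
    by (rule smooth_functions_mult[OF M hk P])
  have left: "\<pi> q \<xi> (\<beta> q) = (\<Sum>d\<in>I. ?k d q * \<pi> q \<xi> (differential A (x d) q))"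
    if "q \<in> N" "\<xi> \<in> cotangent_space A q" for q \<xi>
    by (rule covector_functional_expansion[OF fr(1) that(1) bivector_linear(1)[OF \<pi> that(2)]
          one_form_cotangent[OF \<beta>]])
  have right: "\<pi> q (\<alpha> q) \<xi> = (\<Sum>c\<in>I. ?h c q * \<pi> q (differential A (x c) q) \<xi>)"
    if "q \<in> N" "\<xi> \<in> cotangent_space A q" for q \<xi>
    by (rule covector_functional_expansion[OF fr(1) that(1) bivector_linear(2)[OF \<pi> that(2)]
          one_form_cotangent[OF \<alpha>]])
  have "X p (\<lambda>q. \<pi> q (\<alpha> q) (\<beta> q)) = X p (\<lambda>q. \<Sum>c\<in>I. \<Sum>d\<in>I. ?h c q * ?k d q * ?P c d q)"
  proof (rule tangent_local[OF M XT bivector_smooth[OF \<pi> \<alpha> \<beta>] _ N fr(2)])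
    show "(\<lambda>q. \<Sum>c\<in>I. \<Sum>d\<in>I. ?h c q * ?k d q * ?P c d q) \<in> smooth_functions A"
      by (rule smooth_functions_sum[OF M smooth_functions_sum[OF M hkP]])
    show "\<pi> q (\<alpha> q) (\<beta> q) = (\<Sum>c\<in>I. \<Sum>d\<in>I. ?h c q * ?k d q * ?P c d q)" if "q \<in> N" for q
      by (simp add: right[OF that one_form_cotangent[OF \<beta>]] left[OF that differential_cotangent]
          poisson_bracket_def sum_distrib_left mult.assoc)
  qed
  also have "\<dots> = (\<Sum>c\<in>I. X p (\<lambda>q. \<Sum>d\<in>I. ?h c q * ?k d q * ?P c d q))"
    by (rule tangent_sum[OF M XT smooth_functions_sum[OF M hkP]])
  also have "\<dots> = (\<Sum>c\<in>I. \<Sum>d\<in>I. X p (\<lambda>q. ?h c q * ?k d q * ?P c d q))"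
    by (rule sum.cong[OF refl]) (rule tangent_sum[OF M XT hkP])
  also have "\<dots> = (\<Sum>c\<in>I. \<Sum>d\<in>I. ?h c p * ?k d p * X p (?P c d) +
      ?P c d p * (?h c p * X p (?k d) + ?k d p * X p (?h c)))"
    by (intro sum.cong refl) (simp only: tangent_mult[OF XT hk P] tangent_mult[OF XT h k])
  finally have 1: "X p (\<lambda>q. \<pi> q (\<alpha> q) (\<beta> q)) = (\<Sum>c\<in>I. \<Sum>d\<in>I. ?h c p * ?k d p * X p (?P c d) +
      ?P c d p * (?h c p * X p (?k d) + ?k d p * X p (?h c)))" .
  \<comment> \<open>In \<open>2\<close> and \<open>3\<close> below, the terms with \<open>X h\<close> and \<open>X k\<close> are those of \<open>1\<close>, so that they cancel.\<close>
  have frame_linear: "l (frame_lie_form A I x D X \<omega> p) =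
      (\<Sum>c\<in>I. X p (\<lambda>q. \<omega> q (D c q)) * l (differential A (x c) p)) +
      (\<Sum>c\<in>I. \<omega> p (D c p) * l (differential A (\<lambda>q. X q (x c)) p))"
    if l: "linear_functional_on (cotangent_space A p) l" for l \<omega>
  proof -
    have S: "(\<lambda>v. \<Sum>c\<in>I. a c * differential A (u c) p v) \<in> cotangent_space A p" for a u
      by (rule cotangent_space_sum[OF differential_cotangent])
    have L: "l (\<lambda>v. \<Sum>c\<in>I. a c * differential A (u c) p v) = (\<Sum>c\<in>I. a c * l (differential A (u c) p))"
      for a u
      by (rule linear_functional_on_sum[OF l function_subspace_cotangent differential_cotangent])
    show ?thesis
      unfolding frame_lie_form_def linear_functional_onD[OF l S S] L by simp
  qed
  have 2: "\<pi> p (lie_form A X \<alpha> p) (\<beta> p) =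
      (\<Sum>c\<in>I. \<Sum>d\<in>I. X p (?h c) * ?k d p * ?P c d p +
        ?h c p * ?k d p * poisson_bracket A \<pi> (\<lambda>q. X q (x c)) (x d) p)"
    unfolding lie_form_frame[OF M fr X \<alpha>]
      frame_linear[OF bivector_linear(2)[OF \<pi> one_form_cotangent[OF \<beta>]]]
      left[OF fr(2) differential_cotangent] poisson_bracket_def
    by (simp add: sum_distrib_left sum.distrib mult.assoc)
  have 3: "\<pi> p (\<alpha> p) (lie_form A X \<beta> p) =
      (\<Sum>d\<in>I. \<Sum>c\<in>I. X p (?k d) * ?h c p * ?P c d p +
        ?k d p * ?h c p * poisson_bracket A \<pi> (x c) (\<lambda>q. X q (x d)) p)"
    unfolding lie_form_frame[OF M fr X \<beta>]
      frame_linear[OF bivector_linear(1)[OF \<pi> one_form_cotangent[OF \<alpha>]]]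
      right[OF fr(2) differential_cotangent] poisson_bracket_def
    by (simp add: sum_distrib_left sum.distrib mult.assoc)
  have 3: "\<pi> p (\<alpha> p) (lie_form A X \<beta> p) =
      (\<Sum>c\<in>I. \<Sum>d\<in>I. X p (?k d) * ?h c p * ?P c d p +
        ?k d p * ?h c p * poisson_bracket A \<pi> (x c) (\<lambda>q. X q (x d)) p)"
    unfolding 3 by (rule sum.swap)
  show ?thesis
    unfolding lie_bivector_differential[OF M X xC xC]
    unfolding lie_bivector_def 1 2 3
    by (simp add: sum_subtractf[symmetric] algebra_simps)
qed

section \<open>Casimir functions and the center of the Koszul bracket\<close>

lemma casimir_iff:
  fixes A :: "('a::{second_countable_topology,t2_space}, 'e::real_inner) atlas"
  assumes M: "smooth_manifold A" and \<pi>: "bivector_field A \<pi>"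
  shows "casimir A \<pi> f \<longleftrightarrow> f \<in> smooth_functions A \<and>
    (\<forall>g\<in>smooth_functions A. \<forall>p. poisson_bracket A \<pi> f g p = 0)"
  unfolding casimir_def sharp_eq_zero_iff[OF M \<pi> differential_cotangent] poisson_bracket_def by blast

lemma sharp_differential_apply:
  fixes A :: "('a::{second_countable_topology,t2_space}, 'e::real_inner) atlas"
  assumes "smooth_manifold A" "bivector_field A \<pi>"
  shows "sharp A \<pi> p (differential A f p) g = poisson_bracket A \<pi> f g p"
  using sharp_apply[OF assms differential_cotangent] by (simp add: poisson_bracket_def)

lemma poisson_bracket_skew:
  "bivector_field A \<pi> \<Longrightarrow> poisson_bracket A \<pi> g f p = - poisson_bracket A \<pi> f g p"
  unfolding poisson_bracket_def
  by (rule bivector_skew[OF _ differential_cotangent differential_cotangent])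

text \<open>\<open>[df, dg] = d{f, g} - d{g, f} - d{f, g}\<close>, as the Lie derivative of \<open>dg\<close> along the Hamiltonian vector
  field of \<open>f\<close> is \<open>d{f, g}\<close>.\<close>

lemma koszul_bracket_differential:
  fixes A :: "('a::{second_countable_topology,t2_space}, 'e::real_inner) atlas"
  assumes M: "smooth_manifold A" and \<pi>: "bivector_field A \<pi>"
    and f: "f \<in> smooth_functions A" and g: "g \<in> smooth_functions A"
  shows "koszul_bracket A \<pi> (differential A f) (differential A g) p =
    differential A (poisson_bracket A \<pi> f g) p"
proof
  fix v
  have L: "lie_form A (\<lambda>q. sharp A \<pi> q (differential A f q)) (differential A g) =
      differential A (poisson_bracket A \<pi> f g)"
    if "f \<in> smooth_functions A" "g \<in> smooth_functions A" for f g
    using lie_form_differential[OF M sharp_vector_field[OF M \<pi> differential_one_form[OF that(1)]] that(2)]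
    by (simp add: sharp_differential_apply[OF M \<pi>])
  have P: "(\<lambda>q. \<pi> q (differential A f q) (differential A g q)) = poisson_bracket A \<pi> f g"
    by (simp add: poisson_bracket_def[abs_def])
  have "differential A (poisson_bracket A \<pi> g f) p v = - differential A (poisson_bracket A \<pi> f g) p v"
  proof (cases "v \<in> tangent_space A p")
    case True
    \<comment> \<open>The zero term puts \<open>- {f, g}\<close> into the shape \<open>a f + b g\<close> of \<open>tangent_comb\<close>.\<close>
    have eq: "poisson_bracket A \<pi> g f = (\<lambda>q. (- 1) * poisson_bracket A \<pi> f g q + 0 * poisson_bracket A \<pi> f g q)"
    proof
      fix q
      show "poisson_bracket A \<pi> g f q = (- 1) * poisson_bracket A \<pi> f g q + 0 * poisson_bracket A \<pi> f g q"
        using poisson_bracket_skew[OF \<pi>, of g f q] by simp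
    qed
    note S = poisson_bracket_smooth[OF \<pi> f g]
    show ?thesis
      unfolding differential_apply[OF True] unfolding eq tangent_comb[OF True S S] by simp
  qed (simp add: differential_def)
  then show "koszul_bracket A \<pi> (differential A f) (differential A g) p v =
      differential A (poisson_bracket A \<pi> f g) p v"
    unfolding koszul_bracket_def L[OF f g] L[OF g f] P by simp
qed

lemma zero_one_form: "smooth_manifold A \<Longrightarrow> (\<lambda>p v. 0) \<in> one_forms A"
  by (simp add: one_forms_def cotangent_space_def linear_functional_on_def smooth_functions_const)

lemma lie_form_zero:
  fixes A :: "('a::{second_countable_topology,t2_space}, 'e::real_inner) atlas"
  assumes M: "smooth_manifold A" and \<beta>: "\<beta> \<in> one_forms A"
  shows "lie_form A (\<lambda>p f. 0) \<beta> = (\<lambda>p v. 0)"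
proof (rule lie_form_eqI[OF M zero_one_form[OF M]])
  fix Y p assume Y: "Y \<in> vector_fields A"
  have "lie_bracket (\<lambda>p f. 0) Y p = (\<lambda>f. 0)"
    by (simp add: lie_bracket_def tangent_const[OF M vector_field_tangent[OF Y]])
  then show "0 = 0 - \<beta> p (lie_bracket (\<lambda>p f. 0) Y p)"
    using linear_functional_on_zero[OF cotangent_linear[OF one_form_cotangent[OF \<beta>]]
        function_subspace_tangent] by simp
qed

text \<open>All three terms of \<open>[df, \<beta>]\<close> vanish: the vector field of \<open>df\<close> is zero, and so is the function
  \<open>\<pi>(df, \<beta>)\<close>, whose differential is, up to sign, the Lie derivative of \<open>df\<close> along the vector field of \<open>\<beta>\<close>.\<close>

lemma casimir_differential_central:
  fixes A :: "('a::{second_countable_topology,t2_space}, 'e::real_inner) atlas"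
  assumes M: "smooth_manifold A" and \<pi>: "bivector_field A \<pi>" and f: "casimir A \<pi> f"
  shows "differential A f \<in> koszul_center A \<pi>"
proof -
  have fC: "f \<in> smooth_functions A" and sh: "\<And>q. sharp A \<pi> q (differential A f q) = (\<lambda>h. 0)"
    using f by (simp_all add: casimir_def)
  have "koszul_bracket A \<pi> (differential A f) \<beta> p = (\<lambda>v. 0)" if \<beta>: "\<beta> \<in> one_forms A" for \<beta> p
  proof
    fix v
    have pairing: "\<pi> q (differential A f q) (\<beta> q) = 0" for q
      using sharp_tangent_apply(2)[OF M \<pi> differential_cotangent[of A f q] one_form_cotangent[OF \<beta>]]
        linear_functional_on_zero[OF cotangent_linear[OF one_form_cotangent[OF \<beta>]]
          function_subspace_tangent, of q] by (simp add: sh)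
    have "sharp A \<pi> q (\<beta> q) f = 0" for q
      using sharp_apply[OF M \<pi> one_form_cotangent[OF \<beta>], of q f]
        bivector_skew[OF \<pi> one_form_cotangent[OF \<beta>, of q] differential_cotangent[of A f q]] pairing
      by simp
    then have "lie_form A (\<lambda>q. sharp A \<pi> q (\<beta> q)) (differential A f) = differential A (\<lambda>q. 0)"
      using lie_form_differential[OF M sharp_vector_field[OF M \<pi> \<beta>] fC] by simp
    then show "koszul_bracket A \<pi> (differential A f) \<beta> p v = 0"
      unfolding koszul_bracket_def sh pairing lie_form_zero[OF M \<beta>]
      by (simp add: differential_def tangent_const[OF M])
  qed
  then show ?thesis
    unfolding koszul_center_def using differential_one_form[OF fC] by blast
qed

lemma casimir_differential_in_kernel:
  "casimir A \<pi> f \<Longrightarrow> differential A f \<in> sharp_kernel A \<pi>"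
  by (simp add: casimir_def sharp_kernel_def differential_one_form)

text \<open>If \<open>df\<close> is central, then \<open>d{f, g} = [df, dg] = 0\<close> for every \<open>g\<close>. For \<open>g\<^sup>2\<close> in place of \<open>g\<close> this
  gives \<open>{f, g} dg = 0\<close>, and applying this covector to the Hamiltonian vector field of \<open>f\<close> gives
  \<open>{f, g}\<^sup>2 = 0\<close>.\<close>

lemma casimir_if_differential_central:
  fixes A :: "('a::{second_countable_topology,t2_space}, 'e::real_inner) atlas"
  assumes M: "smooth_manifold A" and \<pi>: "bivector_field A \<pi>" and f: "f \<in> smooth_functions A"
    and central: "differential A f \<in> koszul_center A \<pi>"
  shows "casimir A \<pi> f"
  unfolding casimir_iff[OF M \<pi>]
proof (intro conjI ballI allI f)
  fix g p assume g: "g \<in> smooth_functions A"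
  let ?v = "sharp A \<pi> p (differential A f p)"
  let ?k = "poisson_bracket A \<pi> f g"
  have v: "?v \<in> tangent_space A p" by (rule sharp_tangent_apply(1)[OF M \<pi> differential_cotangent])
  have const: "?v (poisson_bracket A \<pi> f u) = 0" if u: "u \<in> smooth_functions A" for u
  proof -
    have "koszul_bracket A \<pi> (differential A f) (differential A u) p = (\<lambda>v. 0)"
      using central differential_one_form[OF u] by (simp add: koszul_center_def)
    then have "differential A (poisson_bracket A \<pi> f u) p ?v = 0"
      by (simp add: koszul_bracket_differential[OF M \<pi> f u])
    then show ?thesis by (simp add: differential_apply[OF v])
  qed
  note gk = smooth_functions_mult[OF M g poisson_bracket_smooth[OF \<pi> f g]]
  \<comment> \<open>The zero term gives \<open>2 g {f, g}\<close> the shape \<open>a u + b v\<close> of \<open>tangent_comb\<close>.\<close>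
  have "poisson_bracket A \<pi> f (\<lambda>q. g q * g q) = (\<lambda>q. 2 * (g q * ?k q) + 0 * (g q * ?k q))"
  proof
    fix q
    note T = sharp_tangent_apply(1)[OF M \<pi> differential_cotangent[of A f q]]
    show "poisson_bracket A \<pi> f (\<lambda>q. g q * g q) q = 2 * (g q * ?k q) + 0 * (g q * ?k q)"
      unfolding sharp_differential_apply[OF M \<pi>, symmetric] tangent_mult[OF T g g] by simp
  qed
  then have "?v (\<lambda>q. 2 * (g q * ?k q) + 0 * (g q * ?k q)) = 0"
    using const[OF smooth_functions_mult[OF M g g]] by simp
  then have "?v (\<lambda>q. g q * ?k q) = 0"
    unfolding tangent_comb[OF v gk gk] by simp
  then have "g p * ?v ?k + ?k p * ?v g = 0"
    unfolding tangent_mult[OF v g poisson_bracket_smooth[OF \<pi> f g]] .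
  then show "?k p = 0"
    using const[OF g] by (simp add: sharp_differential_apply[OF M \<pi>])
qed

section \<open>Riemannian Poisson submersions\<close>

lemma tangent_map_apply: "g \<in> smooth_functions A' \<Longrightarrow> tangent_map A' t v g = v (g \<circ> t)"
  by (simp add: tangent_map_def)

lemma submersion_tangent_map:
  assumes "surjective_submersion A A' t" "v \<in> tangent_space A p"
  shows "tangent_map A' t v \<in> tangent_space A' (t p)"
  using assms unfolding surjective_submersion_def by blast

lemma pullback_differential:
  assumes t: "surjective_submersion A A' t" and f: "f \<in> smooth_functions A'"
  shows "pullback_form A A' t (differential A' f) = differential A (f \<circ> t)"
proof (intro ext)
  fix p v
  show "pullback_form A A' t (differential A' f) p v = differential A (f \<circ> t) p v"
    using submersion_tangent_map[OF t, where v = v and p = p] f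
    by (simp add: pullback_form_def differential_def tangent_map_apply)
qed

text \<open>The gradient of \<open>f \<circ> t\<close> is orthogonal to the fibres, because \<open>f \<circ> t\<close> is constant on them; on the
  orthogonal complement of the fibres \<open>dt\<close> is an isometry.\<close>

lemma tangent_map_gradient:
  fixes A :: "('a::{second_countable_topology,t2_space}, 'e::real_inner) atlas"
    and A' :: "('b::{second_countable_topology,t2_space}, 'f::real_inner) atlas"
  assumes M: "smooth_manifold A" and G: "pseudo_riemannian_metric A G"
    and M': "smooth_manifold A'" and G': "pseudo_riemannian_metric A' G'"
    and t: "pseudo_riemannian_submersion A G A' G' t" and f: "f \<in> smooth_functions A'"
  shows "tangent_map A' t (gradient A G (f \<circ> t) p) = gradient A' G' f (t p)"
proof -
  let ?H = "orthogonal_space A G p (tangent_kernel A A' t p)"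
  let ?v = "gradient A G (f \<circ> t) p"
  have sub: "surjective_submersion A A' t"
    and bij: "bij_betw (tangent_map A' t) ?H (tangent_space A' (t p))"
    and iso: "\<And>u v. u \<in> ?H \<Longrightarrow> v \<in> ?H \<Longrightarrow>
      G' (t p) (tangent_map A' t u) (tangent_map A' t v) = G p u v"
    using t unfolding pseudo_riemannian_submersion_def Let_def by simp_all
  have "smooth_map A A' t" using sub by (simp add: surjective_submersion_def)
  then have F: "f \<circ> t \<in> smooth_functions A"
    by (rule smooth_functions_compose[OF M M' _ f])
  note grad = gradient_tangent_apply[OF M G F, where p = p]
  have "G p ?v w = 0" if "w \<in> tangent_kernel A A' t p" for w
  proof -
    have w: "w \<in> tangent_space A p" "tangent_map A' t w = (\<lambda>f. 0)"
      using that by (simp_all add: tangent_kernel_def)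
    have "w (f \<circ> t) = tangent_map A' t w f"
      by (rule tangent_map_apply[OF f, symmetric])
    then show ?thesis using grad(2)[OF w(1)] w(2) by simp
  qed
  then have vH: "?v \<in> ?H" using grad(1) by (simp add: orthogonal_space_def)
  have "gradient A' G' f (t p) = tangent_map A' t ?v"
  proof (rule gradient_eqI[OF G'])
    show "tangent_map A' t ?v \<in> tangent_space A' (t p)"
      by (rule submersion_tangent_map[OF sub grad(1)])
    fix w' assume "w' \<in> tangent_space A' (t p)"
    then obtain w where w: "w \<in> ?H" "w' = tangent_map A' t w"
      using bij unfolding bij_betw_def by blast
    have wT: "w \<in> tangent_space A p" using w(1) by (simp add: orthogonal_space_def)
    have "w' f = w (f \<circ> t)" unfolding w(2) by (rule tangent_map_apply[OF f])
    then show "G' (t p) (tangent_map A' t ?v) w' = w' f"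
      using iso[OF vH w(1)] grad(2)[OF wT] w(2) by simp
  qed
  then show ?thesis by simp
qed

text \<open>On differentials, \<open>L\<^sub>X \<pi> = 0\<close> says that \<open>X\<close> is a derivation of the Poisson bracket. In this form the
  condition can be pulled back along a Poisson map.\<close>

lemma transversally_invariant_iff:
  fixes A :: "('a::{second_countable_topology,t2_space}, 'e::real_inner) atlas"
  assumes M: "smooth_manifold A" and \<pi>: "bivector_field A \<pi>" and G: "pseudo_riemannian_metric A G"
  shows "transversally_invariant A \<pi> G \<longleftrightarrow> (\<forall>f. casimir A \<pi> f \<longrightarrow>
    (\<forall>g\<in>smooth_functions A. \<forall>h\<in>smooth_functions A. \<forall>p.
      gradient A G f p (poisson_bracket A \<pi> g h) =
      poisson_bracket A \<pi> (\<lambda>q. gradient A G f q g) h p + poisson_bracket A \<pi> g (\<lambda>q. gradient A G f q h) p))"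
    (is "_ \<longleftrightarrow> ?R")
proof
  assume L: "transversally_invariant A \<pi> G"
  show ?R
  proof (intro allI impI ballI)
    fix f g h p assume f: "casimir A \<pi> f" and g: "g \<in> smooth_functions A" and h: "h \<in> smooth_functions A"
    have X: "gradient A G f \<in> vector_fields A"
      using f by (intro gradient_vector_field[OF M G]) (simp add: casimir_def)
    have "lie_bivector A (gradient A G f) \<pi> (differential A g) (differential A h) p = 0"
      using L f differential_one_form[OF g] differential_one_form[OF h]
      by (simp add: transversally_invariant_def)
    then show "gradient A G f p (poisson_bracket A \<pi> g h) =
      poisson_bracket A \<pi> (\<lambda>q. gradient A G f q g) h p + poisson_bracket A \<pi> g (\<lambda>q. gradient A G f q h) p"
      unfolding lie_bivector_differential[OF M X g h] by simp
  qed
next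
  assume R: ?R
  show "transversally_invariant A \<pi> G"
    unfolding transversally_invariant_def
  proof (intro allI impI ballI)
    fix f \<alpha> \<beta> p assume f: "casimir A \<pi> f" and \<alpha>: "\<alpha> \<in> one_forms A" and \<beta>: "\<beta> \<in> one_forms A"
    have X: "gradient A G f \<in> vector_fields A"
      using f by (intro gradient_vector_field[OF M G]) (simp add: casimir_def)
    obtain N I x D where fr: "local_frame A N I x D" "p \<in> N"
      using local_frame_exists[OF M] .
    have xC: "x c \<in> smooth_functions A" for c using fr(1) by (simp add: local_frame_def)
    have "lie_bivector A (gradient A G f) \<pi> (differential A (x c)) (differential A (x d)) p = 0" for c d
      unfolding lie_bivector_differential[OF M X xC xC]
      using R[rule_format, OF f xC xC] by simp
    then show "lie_bivector A (gradient A G f) \<pi> \<alpha> \<beta> p = 0"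
      unfolding lie_bivector_frame[OF M \<pi> fr X \<alpha> \<beta>] by simp
  qed
qed

theorem proposition4p5:
  fixes A\<^sub>P :: "('p::{second_countable_topology,t2_space}, 'e::real_inner) atlas"
    and A\<^sub>M :: "('m::{second_countable_topology,t2_space}, 'f::real_inner) atlas"
    and \<pi>\<^sub>P :: "'p bivector_field" and G\<^sub>P :: "'p metric_field"
    and \<pi>\<^sub>M :: "'m bivector_field" and G\<^sub>M :: "'m metric_field"
    and t :: "'p \<Rightarrow> 'm"
  assumes "smooth_manifold A\<^sub>P" and "poisson_bivector A\<^sub>P \<pi>\<^sub>P" and "pseudo_riemannian_metric A\<^sub>P G\<^sub>P"
    and "smooth_manifold A\<^sub>M" and "poisson_bivector A\<^sub>M \<pi>\<^sub>M" and "pseudo_riemannian_metric A\<^sub>M G\<^sub>M"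
    and "pseudo_riemannian_submersion A\<^sub>P G\<^sub>P A\<^sub>M G\<^sub>M t"
    and "poisson_map A\<^sub>P \<pi>\<^sub>P A\<^sub>M \<pi>\<^sub>M t"
    and "transversally_invariant A\<^sub>P \<pi>\<^sub>P G\<^sub>P"
    and "pullback_form A\<^sub>P A\<^sub>M t ` koszul_center A\<^sub>M \<pi>\<^sub>M \<subseteq> koszul_center A\<^sub>P \<pi>\<^sub>P \<or>
         pullback_form A\<^sub>P A\<^sub>M t ` sharp_kernel A\<^sub>M \<pi>\<^sub>M \<subseteq> sharp_kernel A\<^sub>P \<pi>\<^sub>P"
  shows "transversally_invariant A\<^sub>M \<pi>\<^sub>M G\<^sub>M"
proof -
  note P = assms(1) and GP = assms(3) and M = assms(4) and GM = assms(6)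
  have \<pi>P: "bivector_field A\<^sub>P \<pi>\<^sub>P" and \<pi>M: "bivector_field A\<^sub>M \<pi>\<^sub>M"
    using assms(2,5) by (simp_all add: poisson_bivector_def)
  have sub: "surjective_submersion A\<^sub>P A\<^sub>M t"
    using assms(7) by (simp add: pseudo_riemannian_submersion_def)
  then have sm: "smooth_map A\<^sub>P A\<^sub>M t" and surj: "surj t"
    by (simp_all add: surjective_submersion_def)
  have pull: "g \<circ> t \<in> smooth_functions A\<^sub>P" if "g \<in> smooth_functions A\<^sub>M" for g
    by (rule smooth_functions_compose[OF P M sm that])
  have pm: "poisson_bracket A\<^sub>P \<pi>\<^sub>P (g \<circ> t) (h \<circ> t) = poisson_bracket A\<^sub>M \<pi>\<^sub>M g h \<circ> t"
    if "g \<in> smooth_functions A\<^sub>M" "h \<in> smooth_functions A\<^sub>M" for g h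
    using assms(8) that by (simp add: poisson_map_def)
  have casimir_pull: "casimir A\<^sub>P \<pi>\<^sub>P (f \<circ> t)" if f: "casimir A\<^sub>M \<pi>\<^sub>M f" for f
  proof -
    have fC: "f \<in> smooth_functions A\<^sub>M" using f by (simp add: casimir_def)
    note pd = pullback_differential[OF sub fC]
    from assms(10) show ?thesis
    proof
      assume "pullback_form A\<^sub>P A\<^sub>M t ` koszul_center A\<^sub>M \<pi>\<^sub>M \<subseteq> koszul_center A\<^sub>P \<pi>\<^sub>P"
      then have "differential A\<^sub>P (f \<circ> t) \<in> koszul_center A\<^sub>P \<pi>\<^sub>P"
        using casimir_differential_central[OF M \<pi>M f] unfolding pd[symmetric] by blast
      then show ?thesis by (rule casimir_if_differential_central[OF P \<pi>P pull[OF fC]])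
    next
      assume "pullback_form A\<^sub>P A\<^sub>M t ` sharp_kernel A\<^sub>M \<pi>\<^sub>M \<subseteq> sharp_kernel A\<^sub>P \<pi>\<^sub>P"
      then have "differential A\<^sub>P (f \<circ> t) \<in> sharp_kernel A\<^sub>P \<pi>\<^sub>P"
        using casimir_differential_in_kernel[OF f] unfolding pd[symmetric] by blast
      then show ?thesis using pull[OF fC] by (simp add: sharp_kernel_def casimir_def)
    qed
  qed
  show ?thesis
    unfolding transversally_invariant_iff[OF M \<pi>M GM]
  proof (intro allI impI ballI)
    fix f g h m
    assume f: "casimir A\<^sub>M \<pi>\<^sub>M f" and g: "g \<in> smooth_functions A\<^sub>M" and h: "h \<in> smooth_functions A\<^sub>M"
    have fC: "f \<in> smooth_functions A\<^sub>M" using f by (simp add: casimir_def)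
    obtain p where p: "m = t p" using surj by (rule surjE)
    let ?X = "gradient A\<^sub>P G\<^sub>P (f \<circ> t)" and ?Y = "gradient A\<^sub>M G\<^sub>M f"
    have Y: "?Y \<in> vector_fields A\<^sub>M" by (rule gradient_vector_field[OF M GM fC])
    have XY: "?X q (u \<circ> t) = ?Y (t q) u" if "u \<in> smooth_functions A\<^sub>M" for u q
      using tangent_map_gradient[OF P GP M GM assms(7) fC, of q] tangent_map_apply[OF that, of t "?X q"]
      by simp
    then have XYt: "(\<lambda>q. ?X q (u \<circ> t)) = (\<lambda>m. ?Y m u) \<circ> t" if "u \<in> smooth_functions A\<^sub>M" for u
      using that by (simp add: o_def)
    have "?X p (poisson_bracket A\<^sub>P \<pi>\<^sub>P (g \<circ> t) (h \<circ> t)) =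
        poisson_bracket A\<^sub>P \<pi>\<^sub>P (\<lambda>q. ?X q (g \<circ> t)) (h \<circ> t) p +
        poisson_bracket A\<^sub>P \<pi>\<^sub>P (g \<circ> t) (\<lambda>q. ?X q (h \<circ> t)) p"
      using assms(9) casimir_pull[OF f] pull[OF g] pull[OF h]
      unfolding transversally_invariant_iff[OF P \<pi>P GP] by blast
    then show "?Y m (poisson_bracket A\<^sub>M \<pi>\<^sub>M g h) =
        poisson_bracket A\<^sub>M \<pi>\<^sub>M (\<lambda>q. ?Y q g) h m + poisson_bracket A\<^sub>M \<pi>\<^sub>M g (\<lambda>q. ?Y q h) m"
      unfolding XYt[OF g] XYt[OF h] pm[OF g h] XY[OF poisson_bracket_smooth[OF \<pi>M g h]]
        pm[OF vector_field_smooth[OF Y g] h] pm[OF g vector_field_smooth[OF Y h]] p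
      by simp
  qed
qed

end
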